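(* Assume $\mathcal{T}^\star$-Bellman completeness ($\mathcal{T}^\star_hf_{h+1}\in\mathcal{F}_h$ for all $h\in[H]$ and all $f_{h+1}\in\mathcal{F}_{h+1}$) and that the offline dataset has size $|\mathcal{D}^{\mathrm{off}}|\ge\Omega(K)$. Let $\delta\in(0,1)$ and $\beta=2\ln(H|\mathcal{F}|/\delta)$. Then with probability at least $1-\delta$, fitted $Q$-iteration for hybrid RL (defined in the context) has the following guarantees for each loss function: 1. If $\ell=\ell_{\mathrm{sq}}$, then for any comparator policy $\tilde\pi\in\Pi_{\mathcal{F}}$, $$\sum_{k=1}^K\big(V^{\pi^k}-V^{\tilde\pi}\big)\le\widetilde{\mathcal{O}}\Big(H\sqrt{K\cdot(d+C^{\tilde\pi})\beta}\Big),$$ where $d=d_{\mathrm{sq}}$ if the uniform-action (UA) flag is false, and $d=A\,d_{\mathrm{sq}}^{\mathrm{V}}$ if the UA flag is true. 2. If $\ell=\ell_{\mathrm{bce}}$, then for any comparator policy $\tilde\pi\in\Pi_{\mathcal{F}}$, $$\sum_{k=1}^K\big(V^{\pi^k}-V^{\tilde\pi}\big)\le\widetilde{\mathcal{O}}\Big(H\sqrt{V^{\tilde\pi}K\cdot(d+C^{\tilde\pi})\beta}+H^2(d+C^{\tilde\pi})\beta\Big),$$ where $d=d_{\mathrm{bce}}$ if the UA flag is false, and $d=A\,d_{\mathrm{bce}}^{\mathrm{V}}$ if the UA flag is true. Here $A=|\mathcal{A}|$ is the number of actions.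
   Context: **MDP.** An MDP has observation space $\mathcal{X}$, action space $\mathcal{A}$, horizon $H$, transition kernels $P_h:\mathcal{X}\times\mathcal{A}\to\Delta(\mathcal{X})$ and conditional cost distributions $C_h:\mathcal{X}\times\mathcal{A}\to\Delta([0,1])$, $h\in[H]$. A policy is $\pi=\{\pi_h:\mathcal{X}\to\Delta(\mathcal{A})\}_{h\in[H]}$. Rolling in $\pi$: start at a fixed known initial state $x_1$; for $h=1,\dots,H$ draw $a_h\sim\pi_h(x_h)$, $c_h\sim C_h(x_h,a_h)$, $x_{h+1}\sim P_h(x_h,a_h)$. The cumulative cost $\sum_{h=1}^Hc_h$ is assumed to lie in $[0,1]$ almost surely. $V^\pi=\mathbb{E}_\pi[\sum_{h=1}^Hc_h]$. The Bellman optimality operator is $\mathcal{T}^\star_hf(x,a)=\mathbb{E}_{c\sim C_h(x,a),\,x'\sim P_h(x,a)}[c+\min_{a'}f(x',a')]$. **Function class.** $\mathcal{F}$ is a (finite) set of tuples $f=(f_1,\dots,f_H)$ with $f_h:\mathcal{X}\times\mathcal{A}\to[0,1]$, with the convention $f_{H+1}=0$; $\mathcal{F}_h$ is the set of step-$h$ components. $\Pi_{\mathcal{F}}=\{\pi_f:f\in\mathcal{F}\}$ where $\pi_f$ is greedy: $\pi_{f,h}(x)\in\operatorname{argmin}_af_h(x,a)$. **Offline data.** $\mathcal{D}^{\mathrm{off}}=(\mathcal{D}^{\mathrm{off}}_1,\dots,\mathcal{D}^{\mathrm{off}}_H)$, where $\mathcal{D}^{\mathrm{off}}_h$ consists of i.i.d.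 tuples $(x,a,c,x')$ with $(x,a)\sim\nu_h$, $c\sim C_h(x,a)$, $x'\sim P_h(x,a)$; the number of tuples per step is at least of order $K$. The coverage coefficient is $C^{\tilde\pi}=\max_{h\in[H]}\|\mathrm{d}d_h^{\tilde\pi}/\mathrm{d}\nu_h\|_\infty$, where $d^{\tilde\pi}_h$ is the distribution of $(x_h,a_h)$ under $\tilde\pi$. **Losses.** $\ell_{\mathrm{sq}}(\hat y,y)=(\hat y-y)^2$; $\ell_{\mathrm{bce}}(\hat y,y)=-y\ln\hat y-(1-y)\ln(1-\hat y)$ with $0\ln0=0$. **Algorithm (fitted $Q$-iteration for hybrid RL).** Set $L_h^\ell(f_h,g,\mathcal{D}_h)=\sum_i\ell\big(f_h(x_{h,i},a_{h,i}),\,c_{h,i}+\min_{a'}g(x'_{h,i},a')\big)$, the sum ranging over the tuples $(x_{h,i},a_{h,i},c_{h,i},x'_{h,i})$ of $\mathcal{D}_h$. For $k=1,\dots,K$: for $h=H,H-1,\dots,1$ let $f_h^k\in\operatorname{argmin}_{f_h\in\mathcal{F}_h}L^\ell_h(f_h,f^k_{h+1},\mathcal{D}_h^{\mathrm{off}}\cup\mathcal{D}^{\mathrm{on}}_{<k,h})$, with $f^k_{H+1}=0$ and $\mathcal{D}^{\mathrm{on}}_{<k,h}$ the step-$h$ tuples collected online before round $k$; let $\pi^k_h(x)\in\operatorname{argmin}_af^k_h(x,a)$; then collect one new tuple $(x_h,a_h,c_h,x'_h)$ for each $h$: if the UA flag is false, roll in $\pi^k$ once and set $x'_h=x_{h+1}$;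 if the UA flag is true, separately for each $h\in[H]$ roll in $\pi^k$ to reach $x_h$, draw $a_h\sim\mathrm{Unif}(\mathcal{A})$ and observe $c_h\sim C_h(x_h,a_h)$, $x'_h\sim P_h(x_h,a_h)$. **Eluder dimensions.** For a set $\mathcal{S}$, a class $\Psi$ of functions $\mathcal{S}\to\mathbb{R}$, a class $\mathcal{M}$ of distributions on $\mathcal{S}$, $\varepsilon_0>0$ and $q\in\mathbb{N}$, $\mathrm{EluDim}_q(\Psi,\mathcal{M},\varepsilon_0)$ is the length $L$ of the longest sequence $\mu^{(1)},\dots,\mu^{(L)}\in\mathcal{M}$ such that there is $\varepsilon\ge\varepsilon_0$ such that for every $t\in[L]$ there is $\psi\in\Psi$ with $|\mathbb{E}_{\mu^{(t)}}[\psi]|>\varepsilon$ but $\sum_{i<t}|\mathbb{E}_{\mu^{(i)}}[\psi]|^q\le\varepsilon^q$. Let $h^2_{\mathrm{Ber}}(u,v)=\frac12(\sqrt u-\sqrt v)^2+\frac12(\sqrt{1-u}-\sqrt{1-v})^2$. Define $\Psi_h^{\mathrm{sq}}=\{(x,a)\mapsto(f_h(x,a)-\mathcal{T}_h^\star f_{h+1}(x,a))^2:f\in\mathcal{F}\}$, $\Psi_h^{\mathrm{bce}}=\{(x,a)\mapsto h^2_{\mathrm{Ber}}(f_h(x,a),\mathcal{T}_h^\star f_{h+1}(x,a)):f\in\mathcal{F}\}$, and for $\bullet\in\{\mathrm{sq},\mathrm{bce}\}$, $\Psi_h^{\bullet,\mathrm{V}}=\{x\mapsto\mathbb{E}_{a\sim\mathrm{Unif}(\mathcal{A})}[\psi(x,a)]:\psi\in\Psi_h^\bullet\}$.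 Let $\mathcal{M}_h$ (resp. $\mathcal{M}_h^{\mathrm{V}}$) be the set of all distributions of $(x_h,a_h)$ (resp. of $x_h$) induced by rolling in any policy. Then $d_{\mathrm{sq}}=\max_h\mathrm{EluDim}_2(\Psi_h^{\mathrm{sq}},\mathcal{M}_h,1/K)$, $d^{\mathrm{V}}_{\mathrm{sq}}=\max_h\mathrm{EluDim}_2(\Psi_h^{\mathrm{sq},\mathrm{V}},\mathcal{M}^{\mathrm{V}}_h,1/K)$, $d_{\mathrm{bce}}=\max_h\mathrm{EluDim}_1(\Psi_h^{\mathrm{bce}},\mathcal{M}_h,1/K)$, $d^{\mathrm{V}}_{\mathrm{bce}}=\max_h\mathrm{EluDim}_1(\Psi_h^{\mathrm{bce},\mathrm{V}},\mathcal{M}^{\mathrm{V}}_h,1/K)$. $\widetilde{\mathcal{O}}$ hides universal constants and logarithmic factors.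
   Formalization: Formal version assumes any step-h and step-(h+1) components of F occur together in one f in F (true for product classes); for bce, that targets c+min f(x') lie in [0,1] a.s. at every (x,a); and with UA true uses d = A·max(1,d^V). The claim fails without these. *)

theory Defs
  imports "HOL-Probability.Probability"
begin

section \<open>Markov decision processes\<close>

text \<open>
  The observation space is the whole type \<open>'x\<close>, equipped with the sigma-algebra of \<open>obs M\<close>; the
  measure carried by \<open>obs M\<close> is never used. The action space is the finite type \<open>'a\<close>.
  Only the steps \<open>1, \<dots>, hor M\<close> are meaningful.
\<close>

record ('x, 'a) mdp =
  obs :: "'x measure"
  init :: 'x
  hor :: nat
  trans :: "nat \<Rightarrow> 'x \<times> 'a \<Rightarrow> 'x measure"
  cost :: "nat \<Rightarrow> 'x \<times> 'a \<Rightarrow> real measure"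

type_synonym ('x, 'a) policy = "nat \<Rightarrow> 'x \<Rightarrow> 'a measure"
type_synonym ('x, 'a) det_policy = "nat \<Rightarrow> 'x \<Rightarrow> 'a"
type_synonym ('x, 'a) qtuple = "nat \<Rightarrow> 'x \<times> 'a \<Rightarrow> real"
type_synonym ('x, 'a) sample = "'x \<times> 'a \<times> real \<times> 'x"
type_synonym ('x, 'a) trajectory = "nat \<Rightarrow> ('x, 'a) sample"

definition obs_act :: "('x, 'a) mdp \<Rightarrow> ('x \<times> 'a) measure" where
  "obs_act M = obs M \<Otimes>\<^sub>M count_space UNIV"

definition sampleM :: "('x, 'a) mdp \<Rightarrow> ('x, 'a) sample measure" where
  "sampleM M = obs M \<Otimes>\<^sub>M (count_space UNIV \<Otimes>\<^sub>M (borel \<Otimes>\<^sub>M obs M))"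

definition sample_cost :: "('x, 'a) sample \<Rightarrow> real" where
  "sample_cost z = fst (snd (snd z))"

definition is_policy :: "('x, 'a) mdp \<Rightarrow> ('x, 'a) policy \<Rightarrow> bool" where
  "is_policy M \<pi> \<longleftrightarrow>
     (\<forall>h\<in>{1..hor M}. \<pi> h \<in> obs M \<rightarrow>\<^sub>M prob_algebra (count_space UNIV))"

definition det :: "('x, 'a) det_policy \<Rightarrow> ('x, 'a) policy" where
  "det p h x = return (count_space UNIV) (p h x)"

definition outcome :: "('x, 'a) mdp \<Rightarrow> nat \<Rightarrow> 'x \<times> 'a \<Rightarrow> ('x, 'a) sample measure" where
  "outcome M h xa =
     distr (cost M h xa \<Otimes>\<^sub>M trans M h xa) (sampleM M) (\<lambda>(c, x'). (fst xa, snd xa, c, x'))"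

definition next_obs :: "('x, 'a) mdp \<Rightarrow> nat \<Rightarrow> ('x, 'a) trajectory \<Rightarrow> 'x" where
  "next_obs M h \<tau> = (if h = 0 then init M else snd (snd (snd (\<tau> h))))"

text \<open>
  \<open>rollout M \<pi> h\<close> is the joint law of the samples \<open>(x\<^sub>i, a\<^sub>i, c\<^sub>i, x\<^sub>i\<^sub>+\<^sub>1)\<close> of the first \<open>h\<close> steps
  of an episode.
\<close>

primrec rollout :: "('x, 'a) mdp \<Rightarrow> ('x, 'a) policy \<Rightarrow> nat \<Rightarrow> ('x, 'a) trajectory measure" where
  "rollout M \<pi> 0 = return (Pi\<^sub>M {1..0} (\<lambda>_. sampleM M)) (\<lambda>_. undefined)"
| "rollout M \<pi> (Suc h) =
     rollout M \<pi> h \<bind> (\<lambda>\<tau>. \<pi> (Suc h) (next_obs M h \<tau>) \<bind> (\<lambda>a.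
       distr (outcome M (Suc h) (next_obs M h \<tau>, a)) (Pi\<^sub>M {1..Suc h} (\<lambda>_. sampleM M))
         (\<lambda>z. \<tau>(Suc h := z))))"

definition occ_obs :: "('x, 'a) mdp \<Rightarrow> ('x, 'a) policy \<Rightarrow> nat \<Rightarrow> 'x measure" where
  "occ_obs M \<pi> h = distr (rollout M \<pi> (hor M)) (obs M) (\<lambda>\<tau>. fst (\<tau> h))"

definition occ :: "('x, 'a) mdp \<Rightarrow> ('x, 'a) policy \<Rightarrow> nat \<Rightarrow> ('x \<times> 'a) measure" where
  "occ M \<pi> h = distr (rollout M \<pi> (hor M)) (obs_act M) (\<lambda>\<tau>. (fst (\<tau> h), fst (snd (\<tau> h))))"

definition total_cost :: "('x, 'a) mdp \<Rightarrow> ('x, 'a) trajectory \<Rightarrow> real" where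
  "total_cost M \<tau> = (\<Sum>h=1..hor M. sample_cost (\<tau> h))"

definition policy_value :: "('x, 'a) mdp \<Rightarrow> ('x, 'a) policy \<Rightarrow> real" where
  "policy_value M \<pi> = (\<integral>\<tau>. total_cost M \<tau> \<partial>rollout M \<pi> (hor M))"

definition valid_mdp :: "('x, 'a::finite) mdp \<Rightarrow> bool" where
  "valid_mdp M \<longleftrightarrow>
     space (obs M) = UNIV \<and> 1 \<le> hor M \<and>
     (\<forall>h\<in>{1..hor M}.
        trans M h \<in> obs_act M \<rightarrow>\<^sub>M prob_algebra (obs M) \<and>
        cost M h \<in> obs_act M \<rightarrow>\<^sub>M prob_algebra borel \<and>
        (\<forall>xa. AE c in cost M h xa. c \<in> {0..1})) \<and>
     (\<forall>\<pi>. is_policy M \<pi> \<longrightarrow> (AE \<tau> in rollout M \<pi> (hor M). total_cost M \<tau> \<in> {0..1}))"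

definition bellman :: "('x, 'a::finite) mdp \<Rightarrow> nat \<Rightarrow> ('x \<times> 'a \<Rightarrow> real) \<Rightarrow> 'x \<times> 'a \<Rightarrow> real" where
  "bellman M h g xa = (\<integral>(c, x'). c + (MIN a'. g (x', a')) \<partial>(cost M h xa \<Otimes>\<^sub>M trans M h xa))"

section \<open>Function classes\<close>

text \<open>Tuples vanish outside \<open>1, \<dots>, H\<close>; this contains the convention \<open>f\<^sub>H\<^sub>+\<^sub>1 = 0\<close>.\<close>

definition function_class :: "('x, 'a) mdp \<Rightarrow> ('x, 'a) qtuple set \<Rightarrow> bool" where
  "function_class M F \<longleftrightarrow> finite F \<and> F \<noteq> {} \<and>
     (\<forall>f\<in>F. (\<forall>h\<in>{1..hor M}. f h \<in> borel_measurable (obs_act M) \<and> range (f h) \<subseteq> {0..1}) \<and>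
            (\<forall>h. h \<notin> {1..hor M} \<longrightarrow> f h = (\<lambda>_. 0)))"

definition component :: "('x, 'a) qtuple set \<Rightarrow> nat \<Rightarrow> ('x \<times> 'a \<Rightarrow> real) set" where
  "component F h = (\<lambda>f. f h) ` F"

text \<open>
  Every product class \<open>F = F\<^sub>1 \<times> \<dots> \<times> F\<^sub>H\<close> has this property. Fitted Q-iteration picks the components
  of its iterates one step at a time, so without it the Bellman residuals of the iterates need not
  belong to the classes whose eluder dimension enters the regret bound.
\<close>

definition consecutive_closed :: "('x, 'a) mdp \<Rightarrow> ('x, 'a) qtuple set \<Rightarrow> bool" where
  "consecutive_closed M F \<longleftrightarrow>
     (\<forall>h\<in>{1..<hor M}. \<forall>g\<in>component F h. \<forall>g'\<in>component F (Suc h).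
        \<exists>f\<in>F. f h = g \<and> f (Suc h) = g')"

definition bellman_complete :: "('x, 'a::finite) mdp \<Rightarrow> ('x, 'a) qtuple set \<Rightarrow> bool" where
  "bellman_complete M F \<longleftrightarrow>
     (\<forall>h\<in>{1..hor M}. \<forall>g\<in>component F (Suc h). bellman M h g \<in> component F h)"

text \<open>
  The binary cross-entropy loss is a loss for labels in \<open>[0,1]\<close>; this says that the regression
  targets almost surely are such labels.
\<close>

definition unit_targets :: "('x, 'a::finite) mdp \<Rightarrow> ('x, 'a) qtuple set \<Rightarrow> bool" where
  "unit_targets M F \<longleftrightarrow>
     (\<forall>h\<in>{1..hor M}. \<forall>g\<in>component F (Suc h). \<forall>xa.
        AE (c, x') in cost M h xa \<Otimes>\<^sub>M trans M h xa. c + (MIN a'. g (x', a')) \<in> {0..1})"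

definition greedy :: "('x, 'a) mdp \<Rightarrow> ('x, 'a) qtuple \<Rightarrow> ('x, 'a) det_policy \<Rightarrow> bool" where
  "greedy M f p \<longleftrightarrow>
     (\<forall>h\<in>{1..hor M}. \<forall>x. is_arg_min (\<lambda>a. f h (x, a)) (\<lambda>_. True) (p h x))"

text \<open>All measurable ways of breaking ties are allowed.\<close>

definition greedy_policies :: "('x, 'a) mdp \<Rightarrow> ('x, 'a) qtuple set \<Rightarrow> ('x, 'a) policy set" where
  "greedy_policies M F =
     {det p | p f. f \<in> F \<and> greedy M f p \<and> (\<forall>h\<in>{1..hor M}. p h \<in> obs M \<rightarrow>\<^sub>M count_space UNIV)}"

section \<open>Losses and eluder dimensions\<close>

datatype loss = Sq | Bce

definition neg_ln :: "real \<Rightarrow> ereal" where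
  "neg_ln t = (if t = 0 then \<infinity> else ereal (- ln t))"

text \<open>Multiplication on \<^typ>\<open>ereal\<close> satisfies \<open>0 * \<infinity> = 0\<close>, the convention \<open>0 ln 0 = 0\<close>.\<close>

fun loss_fun :: "loss \<Rightarrow> real \<Rightarrow> real \<Rightarrow> ereal" where
  "loss_fun Sq y' y = ereal ((y' - y)\<^sup>2)"
| "loss_fun Bce y' y = ereal y * neg_ln y' + ereal (1 - y) * neg_ln (1 - y')"

fun residual :: "loss \<Rightarrow> real \<Rightarrow> real \<Rightarrow> real" where
  "residual Sq u v = (u - v)\<^sup>2"
| "residual Bce u v = (sqrt u - sqrt v)\<^sup>2 / 2 + (sqrt (1 - u) - sqrt (1 - v))\<^sup>2 / 2"

fun eluder_order :: "loss \<Rightarrow> nat" where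
  "eluder_order Sq = 2"
| "eluder_order Bce = 1"

definition eluder_dim :: "nat \<Rightarrow> ('s \<Rightarrow> real) set \<Rightarrow> 's measure set \<Rightarrow> real \<Rightarrow> enat" where
  "eluder_dim q \<Psi> \<M> \<epsilon>0 = Sup {enat L | L. \<exists>\<mu>. (\<forall>t<L. \<mu> t \<in> \<M>) \<and>
     (\<exists>\<epsilon>\<ge>\<epsilon>0. \<forall>t<L. \<exists>\<psi>\<in>\<Psi>.
        \<bar>\<integral>s. \<psi> s \<partial>\<mu> t\<bar> > \<epsilon> \<and> (\<Sum>i<t. \<bar>\<integral>s. \<psi> s \<partial>\<mu> i\<bar> ^ q) \<le> \<epsilon> ^ q)}"

definition residual_class ::
  "('x, 'a::finite) mdp \<Rightarrow> ('x, 'a) qtuple set \<Rightarrow> loss \<Rightarrow> nat \<Rightarrow> ('x \<times> 'a \<Rightarrow> real) set" where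
  "residual_class M F l h = {\<lambda>xa. residual l (f h xa) (bellman M h (f (Suc h)) xa) | f. f \<in> F}"

definition residual_class_V ::
  "('x, 'a::finite) mdp \<Rightarrow> ('x, 'a) qtuple set \<Rightarrow> loss \<Rightarrow> nat \<Rightarrow> ('x \<Rightarrow> real) set" where
  "residual_class_V M F l h =
     {\<lambda>x. \<integral>a. \<psi> (x, a) \<partial>uniform_count_measure UNIV | \<psi>. \<psi> \<in> residual_class M F l h}"

definition eluder_Q :: "('x, 'a::finite) mdp \<Rightarrow> ('x, 'a) qtuple set \<Rightarrow> loss \<Rightarrow> nat \<Rightarrow> enat" where
  "eluder_Q M F l K = (MAX h\<in>{1..hor M}.
     eluder_dim (eluder_order l) (residual_class M F l h)
       {occ M \<pi> h | \<pi>. is_policy M \<pi>} (1 / real K))"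

definition eluder_V :: "('x, 'a::finite) mdp \<Rightarrow> ('x, 'a) qtuple set \<Rightarrow> loss \<Rightarrow> nat \<Rightarrow> enat" where
  "eluder_V M F l K = (MAX h\<in>{1..hor M}.
     eluder_dim (eluder_order l) (residual_class_V M F l h)
       {occ_obs M \<pi> h | \<pi>. is_policy M \<pi>} (1 / real K))"

text \<open>
  For finite \<open>F\<close> both dimensions are at most \<open>card F\<close>, since no function can be a witness twice;
  hence \<^const>\<open>the_enat\<close> is only applied to finite values. In the uniform-action case the degenerate
  dimension \<open>0\<close> counts as \<open>1\<close>: dimension \<open>0\<close> only makes the action-averaged residuals at most
  \<open>1/K\<close>, so the residual of a single action can still be as large as \<open>A/K\<close>, which no multiple of
  \<open>A * 0\<close> accounts for.
\<close>

definition dim_term :: "('x, 'a::finite) mdp \<Rightarrow> ('x, 'a) qtuple set \<Rightarrow> loss \<Rightarrow> bool \<Rightarrow> nat \<Rightarrow> real" where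
  "dim_term M F l ua K =
     (if ua then real CARD('a) * max 1 (real (the_enat (eluder_V M F l K)))
      else real (the_enat (eluder_Q M F l K)))"

section \<open>Offline data\<close>

text \<open>
  \<open>D\<close> is the joint law of the offline data, the \<open>i\<close>-th sample for step \<open>h\<close> being \<open>\<omega> h i\<close>.
  The samples of each step are i.i.d., while the dependence between different steps is arbitrary.
\<close>

definition offlineM :: "('x, 'a) mdp \<Rightarrow> (nat \<Rightarrow> nat) \<Rightarrow> (nat \<Rightarrow> nat \<Rightarrow> ('x, 'a) sample) measure" where
  "offlineM M n = Pi\<^sub>M {1..hor M} (\<lambda>h. Pi\<^sub>M {..<n h} (\<lambda>_. sampleM M))"

definition offline_law ::
  "('x, 'a) mdp \<Rightarrow> (nat \<Rightarrow> ('x \<times> 'a) measure) \<Rightarrow> (nat \<Rightarrow> nat) \<Rightarrow>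
   (nat \<Rightarrow> nat \<Rightarrow> ('x, 'a) sample) measure \<Rightarrow> bool" where
  "offline_law M \<nu> n D \<longleftrightarrow>
     D \<in> space (prob_algebra (offlineM M n)) \<and>
     (\<forall>h\<in>{1..hor M}. \<nu> h \<in> space (prob_algebra (obs_act M)) \<and>
        distr D (Pi\<^sub>M {..<n h} (\<lambda>_. sampleM M)) (\<lambda>\<omega>. \<omega> h) =
        Pi\<^sub>M {..<n h} (\<lambda>_. \<nu> h \<bind> outcome M h))"

definition coverage ::
  "('x, 'a) mdp \<Rightarrow> (nat \<Rightarrow> ('x \<times> 'a) measure) \<Rightarrow> ('x, 'a) policy \<Rightarrow> ennreal" where
  "coverage M \<nu> \<pi> = (MAX h\<in>{1..hor M}.
     if absolutely_continuous (\<nu> h) (occ M \<pi> h)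
     then esssup (\<nu> h) (RN_deriv (\<nu> h) (occ M \<pi> h)) else \<infinity>)"

section \<open>Fitted Q-iteration with hybrid data\<close>

text \<open>
  A history after \<open>j\<close> rounds is a pair \<open>(\<omega>, on)\<close> where \<open>on i h\<close> is the step-\<open>h\<close> sample
  collected online in round \<open>i \<in> {1..j}\<close>.
\<close>

type_synonym ('x, 'a) history = "(nat \<Rightarrow> nat \<Rightarrow> ('x, 'a) sample) \<times> (nat \<Rightarrow> ('x, 'a) trajectory)"

definition historyM :: "('x, 'a) mdp \<Rightarrow> (nat \<Rightarrow> nat) \<Rightarrow> nat \<Rightarrow> ('x, 'a) history measure" where
  "historyM M n j =
     offlineM M n \<Otimes>\<^sub>M Pi\<^sub>M {1..j} (\<lambda>_. Pi\<^sub>M {1..hor M} (\<lambda>_. sampleM M))"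

definition past :: "nat \<Rightarrow> ('x, 'a) history \<Rightarrow> ('x, 'a) history" where
  "past k D = (fst D, restrict (snd D) {1..<k})"

definition step_data :: "(nat \<Rightarrow> nat) \<Rightarrow> nat \<Rightarrow> nat \<Rightarrow> ('x, 'a) history \<Rightarrow> ('x, 'a) sample list" where
  "step_data n k h D = map (fst D h) [0..<n h] @ map (\<lambda>i. snd D i h) [1..<k]"

definition empirical_loss ::
  "loss \<Rightarrow> ('x \<times> 'a::finite \<Rightarrow> real) \<Rightarrow> ('x \<times> 'a \<Rightarrow> real) \<Rightarrow> ('x, 'a) sample list \<Rightarrow> ereal" where
  "empirical_loss l g g' zs =
     (\<Sum>(x, a, c, x')\<leftarrow>zs. loss_fun l (g (x, a)) (c + (MIN a'. g' (x', a'))))"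

text \<open>
  \<open>fit k D\<close> and \<open>pol k D\<close> are the regression tuple and the policy computed in round \<open>k\<close> from the
  history \<open>D\<close> of the earlier rounds, with arbitrary tie-breaking. The joint measurability of the
  policy is what makes the law of the interaction well defined.
\<close>

definition fitted_Q_iteration ::
  "('x, 'a::finite) mdp \<Rightarrow> ('x, 'a) qtuple set \<Rightarrow> loss \<Rightarrow> (nat \<Rightarrow> nat) \<Rightarrow> nat \<Rightarrow>
   (nat \<Rightarrow> ('x, 'a) history \<Rightarrow> ('x, 'a) qtuple) \<Rightarrow>
   (nat \<Rightarrow> ('x, 'a) history \<Rightarrow> ('x, 'a) det_policy) \<Rightarrow> bool" where
  "fitted_Q_iteration M F l n K fit pol \<longleftrightarrow>
     (\<forall>k\<in>{1..K}.
        (\<forall>D\<in>space (historyM M n (k - 1)).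
           fit k D (Suc (hor M)) = (\<lambda>_. 0) \<and>
           (\<forall>h\<in>{1..hor M}.
              is_arg_min (\<lambda>g. empirical_loss l g (fit k D (Suc h)) (step_data n k h D))
                (\<lambda>g. g \<in> component F h) (fit k D h)) \<and>
           greedy M (fit k D) (pol k D)) \<and>
        (\<forall>h\<in>{1..hor M}.
           (\<lambda>(D, x). pol k D h x) \<in> historyM M n (k - 1) \<Otimes>\<^sub>M obs M \<rightarrow>\<^sub>M count_space UNIV))"

definition collect ::
  "('x, 'a::finite) mdp \<Rightarrow> bool \<Rightarrow> ('x, 'a) policy \<Rightarrow> ('x, 'a) trajectory measure" where
  "collect M ua \<pi> =
     (if ua then Pi\<^sub>M {1..hor M} (\<lambda>h. occ_obs M \<pi> h \<bind> (\<lambda>x.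
        uniform_count_measure UNIV \<bind> (\<lambda>a. outcome M h (x, a))))
      else rollout M \<pi> (hor M))"

primrec interaction ::
  "('x, 'a::finite) mdp \<Rightarrow> bool \<Rightarrow> (nat \<Rightarrow> nat) \<Rightarrow> (nat \<Rightarrow> nat \<Rightarrow> ('x, 'a) sample) measure \<Rightarrow>
   (nat \<Rightarrow> ('x, 'a) history \<Rightarrow> ('x, 'a) det_policy) \<Rightarrow> nat \<Rightarrow> ('x, 'a) history measure" where
  "interaction M ua n Doff pol 0 = distr Doff (historyM M n 0) (\<lambda>\<omega>. (\<omega>, \<lambda>_. undefined))"
| "interaction M ua n Doff pol (Suc j) =
     interaction M ua n Doff pol j \<bind> (\<lambda>D.
       distr (collect M ua (det (pol (Suc j) D))) (historyM M n (Suc j))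
         (\<lambda>r. (fst D, (snd D)(Suc j := r))))"

definition regret ::
  "('x, 'a) mdp \<Rightarrow> (nat \<Rightarrow> ('x, 'a) history \<Rightarrow> ('x, 'a) det_policy) \<Rightarrow> nat \<Rightarrow> ('x, 'a) history \<Rightarrow>
   ('x, 'a) policy \<Rightarrow> real" where
  "regret M pol K D \<pi>' =
     (\<Sum>k=1..K. policy_value M (det (pol k (past k D))) - policy_value M \<pi>')"

text \<open>
  The factor hidden by the soft-O notation, where \<open>c0\<close> is the implicit constant in the requirement
  that there are \<open>\<Omega>(K)\<close> offline samples per step. It is explicit because an existentially quantified
  constant inside a polymorphic theorem could depend on the types of observations and actions,
  in particular on the number of actions.
\<close>

definition hidden_factor :: "real \<Rightarrow> nat \<Rightarrow> real" where
  "hidden_factor c0 K = 1000 * (1 + 1 / c0) * (1 + ln (real K))\<^sup>2"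

end

theory Submission
  imports Defs
begin

text \<open>
  For a step \<open>h\<close> and a tuple of the class, exponentiate a small multiple of the excess loss of the Bellman
  image over the step-\<open>h\<close> function on one sample. The conditional mean of this weight is at most one minus a
  multiple of the residual: by weighted AM-GM for the cross entropy, by a second order expansion of the exponential
  for the square loss. So the product of the weights, compensated by the exponential of the accumulated mean
  residuals, is a supermartingale along the interaction, and a maximal inequality with a union bound over steps and
  class keeps it below \<open>H |F| / \<delta>\<close> in all rounds. By completeness the empirical minimiser has a product of
  weights at least \<open>1\<close>, so its accumulated residual on the queried data is at most a multiple of \<open>\<beta>\<close>.

  Coverage transfers the offline part to the comparator. Online, the rounds with residual above \<open>\<epsilon>\<close> are
  distributed over about \<open>\<beta>/\<epsilon>\<close> eluder-independent sequences, and summing over \<open>\<epsilon> = j/K\<close> bounds the total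
  residual of the executed policies; order-one independence implies order-\<open>q\<close> independence, so this serves both
  losses. The performance difference identity turns residuals into regret: by Cauchy-Schwarz for the square
  loss, and through \<open>|u - v| \<le> 6 sqrt (h^2 u) + 4 h^2\<close> for the cross entropy, where the mean of \<open>u\<close> is
  controlled by the value of the policy.
\<close>

section \<open>Eluder dimension\<close>

text \<open>A fit depends on the very data it is tested on, so a bound for one fixed function and
  one fixed round does not apply to it. Exponential weights give uniformity cheaply: a maximal
  inequality covers all rounds at once, so \<open>\<beta>\<close> carries no logarithm of
  \<open>K\<close>. They also tolerate the unbounded cross entropy, where an infinite loss of the
  fitted function is just a weight \<open>0\<close>.

  A fit mixes components of different members of \<open>F\<close>. Its residual at step
  \<open>h\<close> involves only the components at \<open>h\<close> and \<open>h + 1\<close>, and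
  \<open>consecutive_closed\<close> supplies one member of \<open>F\<close> with both, so the union
  bound and the eluder dimensions still apply.

  For the cross entropy the mean of \<open>u\<close> is bounded by a value plus the very gaps to be
  estimated. This inequality is solved round by round, which leaves the value of the comparator in
  place of those of the executed policies.

  The eluder argument leaves terms without the factor \<open>\<beta>\<close>. They are absorbed by
  \<open>\<beta> \<ge> 1\<close>, which holds once \<open>F\<close> has two elements; for a single
  function completeness makes all residuals zero.\<close>

lemma harmonic_le:
  assumes "1 \<le> K"
  shows "(\<Sum>j\<in>{1..<K}. 1 / real j) \<le> 1 + ln (real K)"
proof -
  have "(\<Sum>j=1..K. 1 / real j) \<le> 1 + ln (real K)"
    using assms
  proof (induction K rule: dec_induct)
    case (step K)
    have "ln (real K / real (Suc K)) \<le> real K / real (Suc K) - 1"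
      using step by (intro ln_le_minus_one) auto
    then have "1 / real (Suc K) \<le> ln (real (Suc K)) - ln (real K)"
      using step by (simp add: ln_div field_simps)
    then show ?case using step by simp
  qed simp
  moreover have "(\<Sum>j\<in>{1..<K}. 1 / real j) \<le> (\<Sum>j=1..K. 1 / real j)"
    by (intro sum_mono2) auto
  ultimately show ?thesis by simp
qed

text \<open>Pigeonhole, one round at a time. The buckets are disjoint, so if each of the
  \<open>N\<close> buckets held at least \<open>\<epsilon>\<close> of row \<open>k\<close> over the
  earlier rounds, the total would be at least \<open>N * \<epsilon> > R\<close>; hence some bucket
  can still take \<open>k\<close>. Only rounds in \<open>G\<close> count as members, since only
  those are meant to form independent sequences.\<close>

lemma bucket_partition:
  fixes a :: "nat \<Rightarrow> nat \<Rightarrow> real"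
  assumes nonneg: "\<And>k i. 0 \<le> a k i" and eps: "0 < \<epsilon>"
    and total: "\<And>k. k \<in> {1..K} \<Longrightarrow> (\<Sum>i\<in>{1..<k}. a k i) \<le> R" and N: "R < real N * \<epsilon>"
  shows "\<exists>b. \<forall>k\<in>{1..K}. b k < N \<and> (\<Sum>i\<in>{i\<in>{1..<k}. i \<in> G \<and> b i = b k}. a k i) \<le> \<epsilon>"
  using total
proof (induction K)
  case (Suc K)
  have "(\<Sum>i\<in>{1..<k}. a k i) \<le> R" if "k \<in> {1..K}" for k
    using that by (intro Suc.prems) auto
  from Suc.IH[OF this] obtain b where b: "\<And>k. k \<in> {1..K} \<Longrightarrow>
      b k < N \<and> (\<Sum>i\<in>{i\<in>{1..<k}. i \<in> G \<and> b i = b k}. a k i) \<le> \<epsilon>"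
    by blast
  let ?S = "\<lambda>m. \<Sum>i\<in>{i\<in>{1..<Suc K}. i \<in> G \<and> b i = m}. a (Suc K) i"
  have "\<exists>m<N. ?S m \<le> \<epsilon>"
  proof (rule ccontr)
    assume "\<not> ?thesis"
    then have "\<And>m. m < N \<Longrightarrow> \<epsilon> \<le> ?S m" by force
    then have "real N * \<epsilon> \<le> (\<Sum>m<N. ?S m)"
      using sum_mono[of "{..<N}" "\<lambda>_. \<epsilon>" ?S] by simp
    also have "\<dots> = (\<Sum>m<N. \<Sum>i\<in>{i\<in>{i\<in>{1..<Suc K}. i \<in> G}. b i = m}. a (Suc K) i)"
      by (intro sum.cong refl) auto
    also have "\<dots> = (\<Sum>i\<in>{i\<in>{1..<Suc K}. i \<in> G}. a (Suc K) i)"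
      using b by (intro sum.group) (auto simp: less_Suc_eq_le)
    also have "\<dots> \<le> (\<Sum>i\<in>{1..<Suc K}. a (Suc K) i)"
      by (intro sum_mono2) (auto simp: nonneg)
    also have "\<dots> \<le> R" using Suc.prems[of "Suc K"] by simp
    finally show False using N by simp
  qed
  then obtain m where m: "m < N" "?S m \<le> \<epsilon>" by blast
  have "(b(Suc K := m)) k < N \<and>
      (\<Sum>i\<in>{i\<in>{1..<k}. i \<in> G \<and> (b(Suc K := m)) i = (b(Suc K := m)) k}. a k i) \<le> \<epsilon>"
    if k: "k \<in> {1..Suc K}" for k
  proof (cases "k = Suc K")
    case True
    have "{i\<in>{1..<k}. i \<in> G \<and> (b(Suc K := m)) i = (b(Suc K := m)) k} =
        {i\<in>{1..<Suc K}. i \<in> G \<and> b i = m}" using True by auto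
    then show ?thesis using True m by simp
  next
    case False
    then have "k \<in> {1..K}" using k by auto
    moreover from this
    have "{i\<in>{1..<k}. i \<in> G \<and> (b(Suc K := m)) i = (b(Suc K := m)) k} =
        {i\<in>{1..<k}. i \<in> G \<and> b i = b k}" using False by auto
    ultimately show ?thesis using b[of k] False by simp
  qed
  then show ?case by blast
qed simp

text \<open>With \<open>G\<close> the rounds whose diagonal entry exceeds \<open>\<epsilon>\<close>,
  every bucket restricted to \<open>G\<close> satisfies the premise of \<open>indep\<close> and so
  has at most \<open>d\<close> members; the number of buckets is the price of the budget
  \<open>R\<close>.\<close>

lemma card_large_le:
  fixes a :: "nat \<Rightarrow> nat \<Rightarrow> real"
  assumes nonneg: "\<And>k i. 0 \<le> a k i" and eps: "0 < \<epsilon>" and R: "0 \<le> R"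
    and total: "\<And>k. k \<in> {1..K} \<Longrightarrow> (\<Sum>i\<in>{1..<k}. a k i) \<le> R"
    and indep: "\<And>T. T \<subseteq> {1..K} \<Longrightarrow>
      (\<And>k. k \<in> T \<Longrightarrow> \<epsilon> < a k k \<and> (\<Sum>i\<in>{i\<in>T. i < k}. a k i) \<le> \<epsilon>) \<Longrightarrow> real (card T) \<le> d"
  shows "real (card {k\<in>{1..K}. \<epsilon> < a k k}) \<le> (R / \<epsilon> + 1) * d"
proof -
  let ?G = "{k\<in>{1..K}. \<epsilon> < a k k}"
  \<comment> \<open>The least integer above \<open>R / \<epsilon>\<close>: strictly above for the
    pigeonhole, at most one more for the count.\<close>
  define N where "N = nat \<lfloor>R / \<epsilon>\<rfloor> + 1"
  have "real (nat \<lfloor>R / \<epsilon>\<rfloor>) = of_int \<lfloor>R / \<epsilon>\<rfloor>" using R eps by simp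
  then have "R / \<epsilon> < real N" "real N \<le> R / \<epsilon> + 1"
    unfolding N_def of_nat_add by linarith+
  then have N: "R < real N * \<epsilon>" "real N \<le> R / \<epsilon> + 1" using eps by (simp_all add: field_simps)
  obtain b where b: "\<And>k. k \<in> {1..K} \<Longrightarrow>
      b k < N \<and> (\<Sum>i\<in>{i\<in>{1..<k}. i \<in> ?G \<and> b i = b k}. a k i) \<le> \<epsilon>"
    using bucket_partition[where a=a and \<epsilon>=\<epsilon> and K=K and R=R and N=N and G="?G"]
      nonneg eps total N(1) by blast
  have d: "0 \<le> d" using indep[of "{}"] by simp
  have "card {k\<in>?G. b k = m} \<le> d" for m
  proof (rule indep)
    fix k assume k: "k \<in> {k\<in>?G. b k = m}"
    have "{i\<in>{k\<in>?G. b k = m}. i < k} = {i\<in>{1..<k}. i \<in> ?G \<and> b i = b k}" using k by auto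
    then show "\<epsilon> < a k k \<and> (\<Sum>i\<in>{i\<in>{k\<in>?G. b k = m}. i < k}. a k i) \<le> \<epsilon>"
      using b[of k] k by simp
  qed auto
  moreover have "real (card ?G) = (\<Sum>m<N. real (card {k\<in>?G. b k = m}))"
    using sum.group[of ?G "{..<N}" b "\<lambda>_. 1::real"] b by force
  ultimately have "real (card ?G) \<le> (\<Sum>m<N. d)" by (simp add: sum_mono del: sum_constant)
  also have "\<dots> \<le> (R / \<epsilon> + 1) * d" using N(2) d by (simp add: mult_right_mono)
  finally show ?thesis .
qed

text \<open>Layer cake on the grid \<open>j / K\<close>. The grid starts at \<open>1 / K\<close>
  because independence is only controlled at scales \<open>\<epsilon> \<ge> 1 / K\<close>; what the
  grid cannot see costs \<open>1 / K\<close>.\<close>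

lemma grid_bound:
  fixes x :: real
  assumes "0 \<le> x" "x \<le> 1" "1 \<le> K"
  shows "x \<le> 1 / real K + (\<Sum>j\<in>{1..<K}. if real j / real K < x then 1 / real K else 0)"
proof -
  define m where "m = nat \<lceil>x * real K\<rceil>"
  have mK: "m \<le> K" unfolding m_def using assms
    by (simp add: nat_le_iff ceiling_le_iff mult_left_le_one_le)
  have "x * real K \<le> real m" unfolding m_def using assms by (simp add: real_nat_ceiling_ge)
  then have "x \<le> real m / real K" using assms by (simp add: field_simps)
  also have "\<dots> \<le> 1 / real K + real (card {1..<m}) / real K"
    using assms by (simp add: field_simps)
  also have "real (card {1..<m}) / real K = (\<Sum>j\<in>{1..<m}. 1 / real K)" by simp
  also have "\<dots> = (\<Sum>j\<in>{1..<m}. if real j / real K < x then 1 / real K else 0)"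
  proof (intro sum.cong refl)
    fix j assume j: "j \<in> {1..<m}"
    then have "int j < \<lceil>x * real K\<rceil>" unfolding m_def by auto
    then have "real j < x * real K" by (simp add: less_ceiling_iff)
    then show "1 / real K = (if real j / real K < x then 1 / real K else 0)"
      using assms by (simp add: field_simps)
  qed
  also have "\<dots> \<le> (\<Sum>j\<in>{1..<K}. if real j / real K < x then 1 / real K else 0)"
    using mK by (intro sum_mono2) auto
  finally show ?thesis by simp
qed

text \<open>At level \<open>j / K\<close> the count is at most \<open>(R * K / j + 1) * d\<close>,
  and each counted round weighs \<open>1 / K\<close>. Summing over \<open>j\<close> turns the first
  part into a harmonic sum, the origin of the logarithm, and the second into at most
  \<open>d\<close>; the leading \<open>1\<close> is the grid remainder of all \<open>K\<close>
  rounds.\<close>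

lemma sum_diagonal_le:
  fixes a :: "nat \<Rightarrow> nat \<Rightarrow> real"
  assumes nonneg: "\<And>k i. 0 \<le> a k i" and le1: "\<And>k. k \<in> {1..K} \<Longrightarrow> a k k \<le> 1"
    and K: "1 \<le> K" and R: "0 \<le> R"
    and total: "\<And>k. k \<in> {1..K} \<Longrightarrow> (\<Sum>i\<in>{1..<k}. a k i) \<le> R"
    and indep: "\<And>T \<epsilon>. T \<subseteq> {1..K} \<Longrightarrow> 1 / real K \<le> \<epsilon> \<Longrightarrow>
      (\<And>k. k \<in> T \<Longrightarrow> \<epsilon> < a k k \<and> (\<Sum>i\<in>{i\<in>T. i < k}. a k i) \<le> \<epsilon>) \<Longrightarrow> real (card T) \<le> d"
  shows "(\<Sum>k=1..K. a k k) \<le> 1 + d + R * d * (1 + ln (real K))"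
proof -
  have d: "0 \<le> d" using indep[of "{}" 1] K by simp
  have count: "real (card {k\<in>{1..K}. real j / real K < a k k}) \<le> (R / (real j / real K) + 1) * d"
    if j: "j \<in> {1..<K}" for j
  proof (rule card_large_le[where a=a])
    fix T assume T: "T \<subseteq> {1..K}"
      "\<And>k. k \<in> T \<Longrightarrow> real j / real K < a k k \<and> (\<Sum>i\<in>{i\<in>T. i < k}. a k i) \<le> real j / real K"
    have "1 / real K \<le> real j / real K" using j by (simp add: divide_right_mono)
    then show "real (card T) \<le> d" using T by (intro indep[of T "real j / real K"])
  qed (use nonneg R total j in auto)
  have "(\<Sum>k=1..K. a k k) \<le> (\<Sum>k=1..K. 1 / real K +
      (\<Sum>j\<in>{1..<K}. if real j / real K < a k k then 1 / real K else 0))"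
    using nonneg le1 K by (intro sum_mono grid_bound) auto
  also have "\<dots> = 1 + (\<Sum>j\<in>{1..<K}. \<Sum>k=1..K. if real j / real K < a k k then 1 / real K else 0)"
    using K by (simp add: sum.distrib) (rule sum.swap)
  also have "\<dots> = 1 + (\<Sum>j\<in>{1..<K}. real (card {k\<in>{1..K}. real j / real K < a k k}) / real K)"
    by (simp add: sum.If_cases Int_def)
  also have "\<dots> \<le> 1 + (\<Sum>j\<in>{1..<K}. (R / (real j / real K) + 1) * d / real K)"
    by (intro add_left_mono sum_mono divide_right_mono count) auto
  also have "\<dots> = 1 + (\<Sum>j\<in>{1..<K}. R * d * (1 / real j) + d / real K)"
    using K by (intro arg_cong2[of _ _ _ _ "(+)"] sum.cong refl) (simp add: field_simps)
  also have "\<dots> = 1 + R * d * (\<Sum>j\<in>{1..<K}. 1 / real j) + real (K - 1) * d / real K"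
    by (simp add: sum.distrib sum_distrib_left)
  also have "\<dots> \<le> 1 + R * d * (1 + ln (real K)) + d"
  proof (intro add_mono mult_left_mono harmonic_le order.refl)
    have "real (K - 1) * d \<le> d * real K" using d K by (subst mult.commute) (intro mult_left_mono, auto)
    then show "real (K - 1) * d / real K \<le> d" using K by (simp add: field_simps)
  qed (use R d K in auto)
  finally show ?thesis by simp
qed

text \<open>Independence is assumed for plain sums, whereas the dimension asks for sums of
  \<open>q\<close>-th powers. Nonnegative terms with sum at most \<open>\<epsilon>\<close> are each
  at most \<open>\<epsilon>\<close>, so a \<open>q\<close>-th power is at most
  \<open>\<epsilon> ^ (q - 1)\<close> times the term and the power sum stays below
  \<open>\<epsilon> ^ q\<close>. Listing \<open>T\<close> increasingly gives the sequence.\<close>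

lemma eluder_dim_ge:
  fixes T :: "nat set"
  assumes T: "finite T" and eps: "\<epsilon>0 \<le> \<epsilon>" "0 < \<epsilon>" and q: "1 \<le> q"
    and mem: "\<And>k. k \<in> T \<Longrightarrow> \<mu> k \<in> \<M>" "\<And>k. k \<in> T \<Longrightarrow> \<psi> k \<in> \<Psi>"
    and nonneg: "\<And>k i. 0 \<le> (\<integral>s. \<psi> k s \<partial>\<mu> i)"
    and indep: "\<And>k. k \<in> T \<Longrightarrow> \<epsilon> < (\<integral>s. \<psi> k s \<partial>\<mu> k) \<and>
      (\<Sum>i\<in>{i\<in>T. i < k}. (\<integral>s. \<psi> k s \<partial>\<mu> i)) \<le> \<epsilon>"
  shows "enat (card T) \<le> eluder_dim q \<Psi> \<M> \<epsilon>0"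
proof -
  define m where "m t = sorted_list_of_set T ! t" for t
  have inT: "m t \<in> T" if "t < card T" for t
    using that T unfolding m_def by (metis length_sorted_list_of_set nth_mem set_sorted_list_of_set)
  have mono: "m i < m t" if "i < t" "t < card T" for i t
    using that T unfolding m_def by (intro sorted_wrt_nth_less[of "(<)"]) auto
  have "\<exists>\<psi>\<in>\<Psi>. \<epsilon> < \<bar>\<integral>s. \<psi> s \<partial>\<mu> (m t)\<bar> \<and> (\<Sum>i<t. \<bar>\<integral>s. \<psi> s \<partial>\<mu> (m i)\<bar> ^ q) \<le> \<epsilon> ^ q"
    if t: "t < card T" for t
  proof -
    define a where "a i = (\<integral>s. \<psi> (m t) s \<partial>\<mu> i)" for i
    have a: "0 \<le> a i" for i unfolding a_def by (rule nonneg)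
    have inj: "inj_on m {..<t}"
      by (intro linorder_inj_onI) (use mono t in \<open>force simp: less_imp_neq\<close>)+
    have "(\<Sum>i<t. a (m i)) = sum a (m ` {..<t})"
      using inj by (simp add: sum.reindex)
    also have "\<dots> \<le> (\<Sum>i\<in>{i\<in>T. i < m t}. a i)"
      using mono inT t T a by (intro sum_mono2) auto
    also have "\<dots> \<le> \<epsilon>" using indep[OF inT[OF t]] by (simp add: a_def)
    finally have le: "(\<Sum>i<t. a (m i)) \<le> \<epsilon>" .
    have each: "a (m i) \<le> \<epsilon>" if "i < t" for i
      using le member_le_sum[of i "{..<t}" "\<lambda>i. a (m i)"] that a by simp
    obtain q' where q': "q = Suc q'" using q by (cases q) auto
    have "(\<Sum>i<t. \<bar>a (m i)\<bar> ^ q) \<le> (\<Sum>i<t. a (m i) * \<epsilon> ^ q')"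
      using a each by (intro sum_mono) (simp add: q' mult_left_mono power_mono)
    also have "\<dots> = (\<Sum>i<t. a (m i)) * \<epsilon> ^ q'" by (simp add: sum_distrib_right)
    also have "\<dots> \<le> \<epsilon> ^ q" using le eps by (simp add: q' mult_right_mono)
    finally have "(\<Sum>i<t. \<bar>a (m i)\<bar> ^ q) \<le> \<epsilon> ^ q" .
    moreover have "\<epsilon> < \<bar>a (m t)\<bar>" using indep[OF inT[OF t]] unfolding a_def by linarith
    ultimately show ?thesis
      unfolding a_def using mem(2)[OF inT[OF t]] by blast
  qed
  then show ?thesis
    unfolding eluder_dim_def using mem(1)[OF inT] eps(1)
    by (intro Sup_upper CollectI exI[of _ "card T"] exI[of _ "\<lambda>t. \<mu> (m t)"] exI[of _ \<epsilon>] conjI refl) auto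
qed

text \<open>\<open>d\<close> is only asked to dominate every natural number below the dimension, so
  a possibly infinite value never has to be converted here.\<close>

lemma sum_eluder_le:
  fixes \<mu> :: "nat \<Rightarrow> 's measure"
  assumes K: "1 \<le> K" and q: "1 \<le> q" and R: "0 \<le> R"
    and mem: "\<And>k. k \<in> {1..K} \<Longrightarrow> \<mu> k \<in> \<M>" "\<And>k. k \<in> {1..K} \<Longrightarrow> \<psi> k \<in> \<Psi>"
    and nonneg: "\<And>k i. 0 \<le> (\<integral>s. \<psi> k s \<partial>\<mu> i)" and le1: "\<And>k. k \<in> {1..K} \<Longrightarrow> (\<integral>s. \<psi> k s \<partial>\<mu> k) \<le> 1"
    and total: "\<And>k. k \<in> {1..K} \<Longrightarrow> (\<Sum>i\<in>{1..<k}. \<integral>s. \<psi> k s \<partial>\<mu> i) \<le> R"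
    and d: "\<And>c. enat c \<le> eluder_dim q \<Psi> \<M> (1 / real K) \<Longrightarrow> real c \<le> d"
  shows "(\<Sum>k=1..K. \<integral>s. \<psi> k s \<partial>\<mu> k) \<le> 1 + d + R * d * (1 + ln (real K))"
proof (rule sum_diagonal_le[where a="\<lambda>k i. \<integral>s. \<psi> k s \<partial>\<mu> i", OF nonneg le1 K R total])
  fix T and \<epsilon> :: real
  assume T: "T \<subseteq> {1..K}" and eps: "1 / real K \<le> \<epsilon>"
    and ind: "\<And>k. k \<in> T \<Longrightarrow> \<epsilon> < (\<integral>s. \<psi> k s \<partial>\<mu> k) \<and> (\<Sum>i\<in>{i\<in>T. i < k}. \<integral>s. \<psi> k s \<partial>\<mu> i) \<le> \<epsilon>"
  have "0 < 1 / real K" using K by simp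
  then have e0: "0 < \<epsilon>" using eps by linarith
  have "finite T" using T by (rule finite_subset) simp
  then show "real (card T) \<le> d"
    using T by (intro d eluder_dim_ge[where \<mu>=\<mu> and \<psi>=\<psi>, OF _ eps e0 q mem nonneg ind]) auto
qed

text \<open>A witness at \<open>s\<close> has mean above \<open>\<epsilon>\<close> there; if it
  served again at \<open>t > s\<close>, the term at \<open>s\<close> alone would exceed the
  allowance \<open>\<epsilon> ^ q\<close>. Witnesses are thus distinct.\<close>

lemma eluder_dim_le_card:
  assumes "finite \<Psi>" "0 < \<epsilon>0" "1 \<le> q"
  shows "eluder_dim q \<Psi> \<M> \<epsilon>0 \<le> enat (card \<Psi>)"
  unfolding eluder_dim_def
proof (rule Sup_least)
  fix x assume "x \<in> {enat L | L. \<exists>\<mu>. (\<forall>t<L. \<mu> t \<in> \<M>) \<and>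
     (\<exists>\<epsilon>\<ge>\<epsilon>0. \<forall>t<L. \<exists>\<psi>\<in>\<Psi>.
        \<bar>\<integral>s. \<psi> s \<partial>\<mu> t\<bar> > \<epsilon> \<and> (\<Sum>i<t. \<bar>\<integral>s. \<psi> s \<partial>\<mu> i\<bar> ^ q) \<le> \<epsilon> ^ q)}"
  then obtain L \<mu> \<epsilon> where x: "x = enat L" and \<epsilon>: "\<epsilon>0 \<le> \<epsilon>"
    and "\<forall>t<L. \<exists>\<psi>\<in>\<Psi>. \<bar>\<integral>s. \<psi> s \<partial>\<mu> t\<bar> > \<epsilon> \<and> (\<Sum>i<t. \<bar>\<integral>s. \<psi> s \<partial>\<mu> i\<bar> ^ q) \<le> \<epsilon> ^ q"
    by auto
  then obtain \<psi> where \<psi>: "\<And>t. t < L \<Longrightarrow> \<psi> t \<in> \<Psi> \<and> \<bar>\<integral>s. \<psi> t s \<partial>\<mu> t\<bar> > \<epsilon> \<and>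
      (\<Sum>i<t. \<bar>\<integral>s. \<psi> t s \<partial>\<mu> i\<bar> ^ q) \<le> \<epsilon> ^ q"
    by metis
  have ne: "\<psi> s \<noteq> \<psi> t" if "s < t" "t < L" for s t
  proof
    assume eq: "\<psi> s = \<psi> t"
    have "\<epsilon> ^ q < \<bar>\<integral>x. \<psi> t x \<partial>\<mu> s\<bar> ^ q"
      using \<psi>[of s] that eq \<epsilon> assms by (intro power_strict_mono) auto
    also have "\<dots> \<le> (\<Sum>i<t. \<bar>\<integral>x. \<psi> t x \<partial>\<mu> i\<bar> ^ q)"
      using that by (intro member_le_sum) auto
    finally show False using \<psi>[OF that(2)] by simp
  qed
  have "inj_on \<psi> {..<L}"
    by (intro linorder_inj_onI) (use ne in auto)
  then have "L \<le> card \<Psi>" using assms \<psi> card_inj_on_le[of \<psi> "{..<L}" \<Psi>] by auto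
  then show "x \<le> enat (card \<Psi>)" by (simp add: x)
qed

lemma eluder_dim_finite:
  assumes "finite \<Psi>" "0 < \<epsilon>0" "1 \<le> q"
  shows "eluder_dim q \<Psi> \<M> \<epsilon>0 \<noteq> \<infinity>"
proof
  assume "eluder_dim q \<Psi> \<M> \<epsilon>0 = \<infinity>"
  with eluder_dim_le_card[OF assms, of \<M>] show False by simp
qed

section \<open>Excess losses\<close>

text \<open>With these constants the mean of \<open>excess_weight\<close> below is at most \<open>1 - residual / slack\<close>.\<close>

fun temperature :: "loss \<Rightarrow> real" where
  "temperature Sq = 1 / 10"
| "temperature Bce = 1 / 2"

fun slack :: "loss \<Rightarrow> real" where
  "slack Sq = 20"
| "slack Bce = 1"

text \<open>Cost and continuation value each lie in \<open>[0,1]\<close>, so the square loss sees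
  targets up to \<open>2\<close>; for the cross entropy \<open>unit_targets\<close> keeps them in
  \<open>[0,1]\<close>.\<close>

fun max_target :: "loss \<Rightarrow> real" where
  "max_target Sq = 2"
| "max_target Bce = 1"

text \<open>Samples on which comparing a minimiser with the Bellman image \<open>v\<close> could
  break down. They are almost surely absent when \<open>v\<close> is the mean of a target in range;
  separating them makes the comparison of total losses a pointwise statement.\<close>

definition flawed :: "loss \<Rightarrow> real \<Rightarrow> real \<Rightarrow> bool" where
  "flawed l v y \<longleftrightarrow> y \<notin> {0..max_target l} \<or> \<bar>loss_fun l v y\<bar> = \<infinity>"

text \<open>The value \<open>0\<close> is the limit of the exponential for an infinite loss of
  \<open>u\<close>; it is set by hand because \<open>real_of_ereal\<close> sends infinity to
  \<open>0\<close>.\<close>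

definition excess_weight :: "loss \<Rightarrow> real \<Rightarrow> real \<Rightarrow> real \<Rightarrow> real" where
  "excess_weight l u v y = (if loss_fun l u y = \<infinity> then 0 else
     exp (temperature l * (real_of_ereal (loss_fun l v y) - real_of_ereal (loss_fun l u y))))"

lemma slack_pos: "0 < slack l" by (cases l) auto

lemma measurable_excess_weight [measurable (raw)]:
  assumes [measurable]: "u \<in> borel_measurable N" "v \<in> borel_measurable N" "y \<in> borel_measurable N"
  shows "(\<lambda>x. excess_weight l (u x) (v x) (y x)) \<in> borel_measurable N"
    and "Measurable.pred N (\<lambda>x. flawed l (v x) (y x))"
proof -
  have [measurable]: "(\<lambda>x. loss_fun l (w x) (y x)) \<in> borel_measurable N"
    if [measurable]: "w \<in> borel_measurable N" for w
  proof -
    have [measurable]: "neg_ln \<in> borel_measurable borel"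
      unfolding neg_ln_def[abs_def] by measurable
    show ?thesis by (cases l) auto
  qed
  show "(\<lambda>x. excess_weight l (u x) (v x) (y x)) \<in> borel_measurable N"
    unfolding excess_weight_def by measurable
  show "Measurable.pred N (\<lambda>x. flawed l (v x) (y x))"
    unfolding flawed_def by measurable
qed

text \<open>The subtracted terms are the Hellinger affinity of the Bernoulli laws with means
  \<open>u\<close> and \<open>v\<close>, which reappears below as the mean of a root likelihood
  ratio.\<close>

lemma residual_bce:
  assumes "0 \<le> u" "u \<le> 1" "0 \<le> v" "v \<le> 1"
  shows "residual Bce u v = 1 - sqrt u * sqrt v - sqrt (1 - u) * sqrt (1 - v)"
  using assms by (simp add: power2_diff) (simp add: field_simps)

lemma residual_bounds:
  assumes "0 \<le> u" "u \<le> 1" "0 \<le> v" "v \<le> 1"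
  shows "0 \<le> residual l u v" "residual l u v \<le> 1"
proof -
  show "0 \<le> residual l u v" by (cases l) auto
  show "residual l u v \<le> 1"
  proof (cases l)
    case Sq
    have "\<bar>u - v\<bar> \<le> 1" using assms by auto
    then show ?thesis using Sq by (simp add: abs_square_le_1)
  next
    case Bce
    have "0 \<le> sqrt u * sqrt v" "0 \<le> sqrt (1 - u) * sqrt (1 - v)" using assms by simp_all
    then have "residual Bce u v \<le> 1" using residual_bce[OF assms] by linarith
    then show ?thesis using Bce by simp
  qed
qed

lemma measurable_residual [measurable (raw)]:
  assumes [measurable]: "u \<in> borel_measurable N" "v \<in> borel_measurable N"
  shows "(\<lambda>x. residual l (u x) (v x)) \<in> borel_measurable N"
  by (cases l) auto

text \<open>For negative arguments, with \<open>x = - t\<close>, the product of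
  \<open>1 - x + x^2\<close> with the quadratic Taylor minorant of \<open>exp x\<close> is at least
  \<open>1\<close>; dividing by \<open>exp x\<close> gives the claim.\<close>

lemma exp_le_quadratic:
  fixes t :: real
  assumes "\<bar>t\<bar> \<le> 1"
  shows "exp t \<le> 1 + t + t\<^sup>2"
proof (cases "0 \<le> t")
  case True
  then show ?thesis using exp_bound assms by simp
next
  case False
  define x where "x = - t"
  have x: "0 \<le> x" using False by (simp add: x_def)
  have q: "1 + x + x\<^sup>2 / 2 \<le> exp x" using x by (rule exp_lower_Taylor_quadratic)
  have "0 \<le> (x - 1 / 2)\<^sup>2 + 3 / 4" by simp
  then have p: "0 \<le> 1 - x + x\<^sup>2" by (simp add: power2_eq_square field_simps)
  have "1 \<le> (1 - x + x\<^sup>2) * (1 + x + x\<^sup>2 / 2)"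
  proof -
    have "(1 - x + x\<^sup>2) * (1 + x + x\<^sup>2 / 2) = 1 + (x\<^sup>2 + x ^ 3 + x ^ 4) / 2"
      by (simp add: field_simps power2_eq_square power3_eq_cube power4_eq_xxxx)
    then show ?thesis using x by simp
  qed
  also have "\<dots> \<le> (1 - x + x\<^sup>2) * exp x" using q p by (rule mult_left_mono)
  finally have "exp (- x) \<le> 1 - x + x\<^sup>2" by (simp add: exp_minus field_simps)
  then show ?thesis by (simp add: x_def)
qed

text \<open>The exponent is \<open>(v - u) * (v + u - 2 * Y) / 10\<close>. As \<open>Y\<close> has
  mean \<open>v\<close>, its mean is \<open>- (v - u)^2 / 10\<close>, while
  \<open>v + u - 2 * Y\<close> has second moment at most \<open>5\<close>. A temperature
  \<open>t\<close> thus gives \<open>1 - (t - 5 * t^2) * (v - u)^2\<close>, and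
  \<open>t = 1/10\<close> is optimal: it leaves \<open>1/20\<close>, the reciprocal of
  \<open>slack Sq\<close>.\<close>

lemma (in prob_space) excess_weight_sq:
  assumes [measurable]: "Y \<in> borel_measurable M" and Y: "AE x in M. Y x \<in> {0..2}"
    and v: "expectation Y = v" "0 \<le> v" "v \<le> 1" and u: "0 \<le> u" "u \<le> 1"
  shows "(\<integral>\<^sup>+x. ennreal (excess_weight Sq u v (Y x)) \<partial>M) \<le> ennreal (1 - residual Sq u v / slack Sq)"
proof -
  define t where "t y = (v - u) * (v + u - 2 * y) / 10" for y
  have eq: "excess_weight Sq u v y = exp (t y)" for y
    by (simp add: excess_weight_def t_def power2_eq_square field_simps)
  have int: "integrable M Y" "integrable M (\<lambda>x. (Y x)\<^sup>2)"
  proof -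
    have "AE x in M. norm (Y x) \<le> 2" using Y by eventually_elim auto
    then show "integrable M Y" by (rule integrable_const_bound) simp
    have "AE x in M. norm ((Y x)\<^sup>2) \<le> 2\<^sup>2"
      using Y by eventually_elim (simp add: abs_le_square_iff[of _ 2, simplified, symmetric])
    then show "integrable M (\<lambda>x. (Y x)\<^sup>2)" by (rule integrable_const_bound) simp
  qed
  have "expectation (\<lambda>x. (Y x)\<^sup>2) \<le> expectation (\<lambda>x. 2 * Y x)"
  proof (rule integral_mono_AE)
    show "AE x in M. (Y x)\<^sup>2 \<le> 2 * Y x"
      using Y by eventually_elim (simp add: power2_eq_square mult_right_mono)
  qed (use int in simp_all)
  then have sq: "expectation (\<lambda>x. (Y x)\<^sup>2) \<le> 2 * v" using v by simp
  define B where "B = (\<lambda>y. 1 + (v - u) * (v + u) / 10 + ((v - u) * (v + u) / 10)\<^sup>2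
      + (- ((v - u) / 5) - (v - u)\<^sup>2 * (v + u) / 25) * y + (v - u)\<^sup>2 / 25 * y\<^sup>2)"
  have B: "1 + t y + (t y)\<^sup>2 = B y" for y
    unfolding t_def B_def by (simp add: power2_eq_square field_simps)
  have le: "exp (t y) \<le> B y" if "y \<in> {0..2}" for y
  proof -
    have "\<bar>t y\<bar> = \<bar>v - u\<bar> * \<bar>v + u - 2 * y\<bar> / 10" by (simp add: t_def abs_mult)
    also have "\<dots> \<le> 1 * 4 / 10"
      using that v u by (intro divide_right_mono mult_mono) auto
    finally show ?thesis using exp_le_quadratic[of "t y"] by (simp add: B)
  qed
  have Bnn: "0 \<le> B y" for y
  proof -
    have "0 \<le> (t y + 1 / 2)\<^sup>2 + 3 / 4" by simp
    then show ?thesis unfolding B[symmetric] by (simp add: power2_eq_square field_simps)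
  qed
  have intB: "integrable M (\<lambda>x. B (Y x))" unfolding B_def using int by simp
  have "(\<integral>\<^sup>+x. ennreal (excess_weight Sq u v (Y x)) \<partial>M) \<le> (\<integral>\<^sup>+x. ennreal (B (Y x)) \<partial>M)"
    unfolding eq
  proof (rule nn_integral_mono_AE)
    show "AE x in M. ennreal (exp (t (Y x))) \<le> ennreal (B (Y x))"
      using Y by eventually_elim (intro ennreal_leI le)
  qed
  also have "\<dots> = ennreal (expectation (\<lambda>x. B (Y x)))"
    using intB by (intro nn_integral_eq_integral AE_I2) (simp_all add: Bnn)
  also have "\<dots> \<le> ennreal (1 - residual Sq u v / slack Sq)"
  proof (rule ennreal_leI)
    have "expectation (\<lambda>x. B (Y x)) = 1 + (v - u) * (v + u) / 10 + ((v - u) * (v + u) / 10)\<^sup>2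
      + (- ((v - u) / 5) - (v - u)\<^sup>2 * (v + u) / 25) * v + (v - u)\<^sup>2 / 25 * expectation (\<lambda>x. (Y x)\<^sup>2)"
      unfolding B_def using int v(1) prob_space by simp
    also have "\<dots> \<le> 1 + (v - u) * (v + u) / 10 + ((v - u) * (v + u) / 10)\<^sup>2
      + (- ((v - u) / 5) - (v - u)\<^sup>2 * (v + u) / 25) * v + (v - u)\<^sup>2 / 25 * (2 * v)"
      using sq by (intro add_left_mono mult_left_mono) auto
    \<comment> \<open>The bracket is the squared mean of \<open>v + u - 2 * Y\<close> plus four
      times the bound \<open>2 * v - v^2\<close> on the variance of \<open>Y\<close>.\<close>
    also have "\<dots> = 1 - (v - u)\<^sup>2 / 10 + (v - u)\<^sup>2 * ((u - v)\<^sup>2 + 4 * v * (2 - v)) / 100"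
      by (simp add: power2_eq_square field_simps)
    also have "\<dots> \<le> 1 - (v - u)\<^sup>2 / 10 + (v - u)\<^sup>2 * 5 / 100"
    proof (intro add_left_mono divide_right_mono mult_left_mono)
      have "(u - v)\<^sup>2 \<le> 1" using u v by (simp add: abs_square_le_1)
      moreover have "0 \<le> (1 - v)\<^sup>2" by simp
      then have "4 * v * (2 - v) \<le> 4" by (simp add: power2_eq_square field_simps)
      ultimately show "(u - v)\<^sup>2 + 4 * v * (2 - v) \<le> 5" by simp
    qed auto
    finally show "expectation (\<lambda>x. B (Y x)) \<le> 1 - residual Sq u v / slack Sq"
      by (simp add: power2_commute)
  qed
  finally show ?thesis .
qed

text \<open>At temperature \<open>1/2\<close> the weight is the root of a likelihood ratio,
  \<open>(u / v)^(y / 2) * ((1 - u) / (1 - v))^((1 - y) / 2)\<close>. This is a geometric mean of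
  two square roots with weights \<open>y\<close> and \<open>1 - y\<close>; convexity of
  \<open>exp\<close> bounds it by the arithmetic mean, which is linear in \<open>y\<close>.\<close>

lemma bce_half_likelihood:
  assumes "0 \<le> v" "v \<le> 1" "0 \<le> u" "u \<le> 1" "\<not> flawed Bce v y"
  shows "excess_weight Bce u v y \<le> y * sqrt (u / v) + (1 - y) * sqrt ((1 - u) / (1 - v))"
proof -
  have y: "0 \<le> y" "y \<le> 1" and fin: "\<bar>ereal y * neg_ln v + ereal (1 - y) * neg_ln (1 - v)\<bar> \<noteq> \<infinity>"
    using assms by (auto simp: flawed_def)
  \<comment> \<open>At an end point \<open>v\<close> a finite loss pins \<open>y\<close> to the same
    end point, so the quotient with zero denominator is multiplied by \<open>0\<close>.\<close>
  have v0: "v = 0 \<Longrightarrow> y = 0" and v1: "v = 1 \<Longrightarrow> y = 1"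
    using fin y by (auto simp: neg_ln_def split: if_splits)
  have nn: "0 \<le> y * sqrt (u / v) + (1 - y) * sqrt ((1 - u) / (1 - v))"
    using y assms by simp
  have sq: "sqrt x = exp (ln x / 2)" if "0 < x" for x
    using that by (simp add: ln_sqrt[symmetric])
  consider "v = 0" | "v = 1" | "0 < v" "v < 1" using assms by linarith
  then show ?thesis
  proof cases
    case 1
    then show ?thesis using v0 assms by (auto simp: excess_weight_def neg_ln_def sq)
  next
    case 2
    then show ?thesis using v1 assms by (auto simp: excess_weight_def neg_ln_def sq)
  next
    case 3
    \<comment> \<open>Logarithms are only available in the last case. In the first two the extreme
      label removes the term with \<open>ln 0\<close>; in the next two the loss is infinite and the
      weight \<open>0\<close>.\<close>
    consider "u = 0" "y = 0" | "u = 1" "y = 1" | "u = 0" "0 < y" | "u = 1" "y < 1" | "0 < u" "u < 1"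
      using assms y by linarith
    then show ?thesis
    proof cases
      case 1
      then show ?thesis using 3 by (simp add: excess_weight_def neg_ln_def sq ln_div)
    next
      case 2
      then show ?thesis using 3 by (simp add: excess_weight_def neg_ln_def sq ln_div)
    next
      case 3
      then have "loss_fun Bce u y = \<infinity>" by (simp add: neg_ln_def)
      then show ?thesis using nn by (simp add: excess_weight_def)
    next
      case 4
      then have "loss_fun Bce u y = \<infinity>" by (simp add: neg_ln_def)
      then show ?thesis using nn by (simp add: excess_weight_def)
    next
      case 5
      have "excess_weight Bce u v y = exp ((1 - y) * (ln ((1 - u) / (1 - v)) / 2) + y * (ln (u / v) / 2))"
        using 3 5 by (simp add: excess_weight_def neg_ln_def ln_div) (simp add: field_simps)
      also have "\<dots> \<le> (1 - y) * exp (ln ((1 - u) / (1 - v)) / 2) + y * exp (ln (u / v) / 2)"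
        using y convex_onD[OF exp_convex, of y "ln ((1 - u) / (1 - v)) / 2" "ln (u / v) / 2"] by simp
      finally show ?thesis using 3 5 by (simp add: sq)
    qed
  qed
qed

text \<open>For the cross entropy only \<open>v = 0\<close> and \<open>v = 1\<close> can give an
  infinite loss. A variable in \<open>[0,1]\<close> with such a mean is almost surely constant, so
  the infinite logarithm is multiplied by \<open>0\<close>.\<close>

lemma (in prob_space) not_flawed_AE:
  assumes [measurable]: "Y \<in> borel_measurable M" and Y: "AE x in M. Y x \<in> {0..max_target l}"
    and v: "expectation Y = v" "0 \<le> v" "v \<le> 1"
  shows "AE x in M. \<not> flawed l v (Y x)"
proof (cases l)
  case Sq
  then show ?thesis using Y by (auto simp: flawed_def)
next
  case Bce
  have "AE x in M. norm (Y x) \<le> 1" using Y by eventually_elim (auto simp: Bce)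
  then have int: "integrable M Y" by (rule integrable_const_bound) simp
  have "AE x in M. v = 0 \<longrightarrow> Y x = 0"
  proof (cases "v = 0")
    case True
    then show ?thesis
      using integral_nonneg_eq_0_iff_AE[OF int] Y v by (auto elim!: eventually_mono)
  qed simp
  moreover have "AE x in M. v = 1 \<longrightarrow> Y x = 1"
  proof (cases "v = 1")
    case True
    then have "expectation (\<lambda>x. 1 - Y x) = 0" using v int prob_space by simp
    then have "AE x in M. 1 - Y x = 0"
      using integral_nonneg_eq_0_iff_AE[of M "\<lambda>x. 1 - Y x"] Y int Bce by (auto elim!: eventually_mono)
    then show ?thesis by (auto elim!: eventually_mono)
  qed simp
  ultimately show ?thesis using Y
  proof eventually_elim
    case (elim x)
    then show ?case using Bce v by (auto simp: flawed_def neg_ln_def)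
  qed
qed

text \<open>The mean of the linear bound is exactly the Hellinger affinity of \<open>u\<close> and
  \<open>v\<close>, which is why the slack is \<open>1\<close>.\<close>

lemma (in prob_space) excess_weight_bce:
  assumes [measurable]: "Y \<in> borel_measurable M" and Y: "AE x in M. Y x \<in> {0..1}"
    and v: "expectation Y = v" "0 \<le> v" "v \<le> 1" and u: "0 \<le> u" "u \<le> 1"
  shows "(\<integral>\<^sup>+x. ennreal (excess_weight Bce u v (Y x)) \<partial>M) \<le> ennreal (1 - residual Bce u v / slack Bce)"
proof -
  let ?B = "\<lambda>y. y * sqrt (u / v) + (1 - y) * sqrt ((1 - u) / (1 - v))"
  have "AE x in M. norm (Y x) \<le> 1" using Y by eventually_elim auto
  then have int: "integrable M Y" by (rule integrable_const_bound) simp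
  have "(\<integral>\<^sup>+x. ennreal (excess_weight Bce u v (Y x)) \<partial>M) \<le> (\<integral>\<^sup>+x. ennreal (?B (Y x)) \<partial>M)"
    using not_flawed_AE[of Y Bce v] Y v u
    by (intro nn_integral_mono_AE) (auto elim!: eventually_mono intro!: ennreal_leI bce_half_likelihood)
  also have "\<dots> = ennreal (expectation (\<lambda>x. ?B (Y x)))"
  proof (rule nn_integral_eq_integral)
    show "AE x in M. 0 \<le> ?B (Y x)"
      using Y by eventually_elim (use v u in simp)
  qed (use int in simp)
  also have "expectation (\<lambda>x. ?B (Y x)) = v * sqrt (u / v) + (1 - v) * sqrt ((1 - u) / (1 - v))"
    using int v(1) prob_space by simp
  also have "\<dots> = sqrt u * sqrt v + sqrt (1 - u) * sqrt (1 - v)"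
  proof -
    have "w * sqrt (s / w) = sqrt s * sqrt w" if "0 \<le> w" for s w :: real
      using that by (cases "w = 0") (simp_all add: real_sqrt_divide field_simps)
    then show ?thesis using v by simp
  qed
  also have "\<dots> = 1 - residual Bce u v / slack Bce"
    using residual_bce[of u v] u v by simp
  finally show ?thesis .
qed

lemma (in prob_space) excess_weight_le:
  assumes "Y \<in> borel_measurable M" and "AE x in M. Y x \<in> {0..max_target l}"
    and "expectation Y = v" "0 \<le> v" "v \<le> 1" and "0 \<le> u" "u \<le> 1"
  shows "(\<integral>\<^sup>+x. ennreal (excess_weight l u v (Y x)) \<partial>M) \<le> ennreal (1 - residual l u v / slack l)"
  using assms excess_weight_sq[of Y v u] excess_weight_bce[of Y v u] by (cases l) auto

text \<open>The product is the exponential of \<open>temperature l\<close> times the difference of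
  the total losses. The work is in the extended reals: the total loss of \<open>v\<close> is finite,
  hence so is that of \<open>u\<close>, and as no summand is negative no single loss of
  \<open>u\<close> is infinite. So no factor is \<open>0\<close>.\<close>

lemma prod_excess_weight_ge_1:
  assumes "\<And>z. z \<in> set zs \<Longrightarrow> \<not> flawed l (v z) (y z)"
    and "\<And>z. z \<in> set zs \<Longrightarrow> 0 \<le> u z \<and> u z \<le> 1"
    and "(\<Sum>z\<leftarrow>zs. loss_fun l (u z) (y z)) \<le> (\<Sum>z\<leftarrow>zs. loss_fun l (v z) (y z))"
  shows "1 \<le> (\<Prod>z\<leftarrow>zs. excess_weight l (u z) (v z) (y z))"
proof -
  have nonneg: "0 \<le> loss_fun l (u z) (y z)" if "z \<in> set zs" for z
  proof (cases l)
    case Bce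
    have "0 \<le> y z" "y z \<le> 1" using assms(1)[OF that] Bce by (auto simp: flawed_def)
    moreover have "0 \<le> neg_ln t" if "0 \<le> t" "t \<le> 1" for t
      using that by (simp add: neg_ln_def)
    ultimately show ?thesis
      using assms(2)[OF that] Bce by simp
  qed simp
  have vfin: "loss_fun l (v z) (y z) = ereal (real_of_ereal (loss_fun l (v z) (y z)))" if "z \<in> set zs" for z
    using assms(1)[OF that] by (auto simp: flawed_def ereal_real)
  have sv: "(\<Sum>z\<leftarrow>zs. loss_fun l (v z) (y z)) = ereal (\<Sum>z\<leftarrow>zs. real_of_ereal (loss_fun l (v z) (y z)))"
    using vfin
  proof (induction zs)
    case (Cons z zs)
    then show ?case by (metis (no_types, lifting) list.set_intros list.simps(9) plus_ereal.simps(1) sum_list.Cons)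
  qed simp
  have "(\<Sum>z\<leftarrow>ws. loss_fun l (u z) (y z)) = \<infinity>" if "z \<in> set ws" "loss_fun l (u z) (y z) = \<infinity>" "set ws \<subseteq> set zs" for z ws
    using that
  proof (induction ws)
    case (Cons w ws)
    have "0 \<le> (\<Sum>z\<leftarrow>ws. loss_fun l (u z) (y z))"
      using Cons.prems nonneg by (intro sum_list_nonneg) auto
    then show ?case using Cons nonneg[of w] by auto
  qed simp
  from this[of _ zs] have ufin': "loss_fun l (u z) (y z) \<noteq> \<infinity>" if "z \<in> set zs" for z
    using that assms(3) sv by auto
  have ufin: "loss_fun l (u z) (y z) = ereal (real_of_ereal (loss_fun l (u z) (y z)))" if "z \<in> set zs" for z
    using ufin'[OF that] nonneg[OF that] by (auto simp: ereal_real)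
  have su: "(\<Sum>z\<leftarrow>zs. loss_fun l (u z) (y z)) = ereal (\<Sum>z\<leftarrow>zs. real_of_ereal (loss_fun l (u z) (y z)))"
    using ufin
  proof (induction zs)
    case (Cons z zs)
    then show ?case by (metis (no_types, lifting) list.set_intros list.simps(9) plus_ereal.simps(1) sum_list.Cons)
  qed simp
  have "(\<Prod>z\<leftarrow>zs. excess_weight l (u z) (v z) (y z)) = exp (temperature l *
      ((\<Sum>z\<leftarrow>zs. real_of_ereal (loss_fun l (v z) (y z))) - (\<Sum>z\<leftarrow>zs. real_of_ereal (loss_fun l (u z) (y z)))))"
    using ufin' by (induction zs) (auto simp: excess_weight_def exp_add[symmetric] algebra_simps simp del: loss_fun.simps)
  moreover have "0 \<le> temperature l" by (cases l) auto
  ultimately show ?thesis using assms(3) unfolding su sv by simp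
qed

section \<open>Laws of episodes\<close>

lemma prob_algebraD:
  assumes "\<mu> \<in> space (prob_algebra N)"
  shows "prob_space \<mu>" "sets \<mu> = sets N" "space \<mu> = space N"
  using assms by (auto simp: space_prob_algebra dest: sets_eq_imp_space_eq)

lemma measurable_law:
  assumes "\<mu> \<in> space (prob_algebra N)"
  shows "f \<in> \<mu> \<rightarrow>\<^sub>M L \<longleftrightarrow> f \<in> N \<rightarrow>\<^sub>M L"
  using prob_algebraD(2)[OF assms] by (simp cong: measurable_cong_sets)

text \<open>Needed for the uniform-action mode, where a round is a product law depending on the
  history. Rectangles generate the product sigma-algebra and are stable under intersection, so
  measurability is tested on them, where the measure is a finite product.\<close>

lemma measurable_PiM_prob_algebra:
  assumes I: "finite I" and \<kappa>: "\<And>i. i \<in> I \<Longrightarrow> (\<lambda>x. \<kappa> x i) \<in> L \<rightarrow>\<^sub>M prob_algebra (N i)"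
  shows "(\<lambda>x. Pi\<^sub>M I (\<kappa> x)) \<in> L \<rightarrow>\<^sub>M prob_algebra (Pi\<^sub>M I N)"
proof (rule measurable_prob_algebra_generated[OF sets_PiM Int_stable_prod_algebra prod_algebra_sets_into_space])
  fix x assume x: "x \<in> space L"
  have k: "prob_space (\<kappa> x i)" "sets (\<kappa> x i) = sets (N i)" if "i \<in> I" for i
    using measurable_space[OF \<kappa>[OF that] x] by (auto simp: space_prob_algebra)
  show "prob_space (Pi\<^sub>M I (\<kappa> x))" using k by (intro prob_space_PiM)
  show "sets (Pi\<^sub>M I (\<kappa> x)) = sets (Pi\<^sub>M I N)" using k by (intro sets_PiM_cong) auto
next
  fix A assume "A \<in> prod_algebra I N"
  then obtain E where E: "A = (\<Pi>\<^sub>E i\<in>I. E i)" "\<And>i. i \<in> I \<Longrightarrow> E i \<in> sets (N i)"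
    by (rule prod_algebraE_all[of A I N]) auto
  have "emeasure (Pi\<^sub>M I (\<kappa> x)) A = (\<Prod>i\<in>I. emeasure (\<kappa> x i) (E i))" if x: "x \<in> space L" for x
  proof -
    have k: "prob_space (\<kappa> x i)" "sets (\<kappa> x i) = sets (N i)" if "i \<in> I" for i
      using measurable_space[OF \<kappa>[OF that] x] by (auto simp: space_prob_algebra)
    \<comment> \<open>\<open>product_prob_space\<close> asks for a probability measure at every
      index, so a point mass fills the indices outside \<open>I\<close>.\<close>
    define \<kappa>' where "\<kappa>' i = (if i \<in> I then \<kappa> x i else return (count_space UNIV) undefined)" for i
    interpret product_prob_space \<kappa>' I
      unfolding product_prob_space_def product_sigma_finite_def product_prob_space_axioms_def
      using k by (auto simp: \<kappa>'_def intro!: prob_space_return prob_space_imp_sigma_finite)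
    have "emeasure (Pi\<^sub>M I \<kappa>') A = (\<Prod>i\<in>I. emeasure (\<kappa>' i) (E i))"
      unfolding E(1) using E(2) k I by (intro emeasure_PiM) (auto simp: \<kappa>'_def)
    moreover have "Pi\<^sub>M I \<kappa>' = Pi\<^sub>M I (\<kappa> x)" by (intro PiM_cong) (auto simp: \<kappa>'_def)
    ultimately show ?thesis by (simp add: \<kappa>'_def)
  qed
  moreover have "(\<lambda>x. \<Prod>i\<in>I. emeasure (\<kappa> x i) (E i)) \<in> borel_measurable L"
    using \<kappa> E(2) by (intro borel_measurable_prod_ennreal
      measurable_compose[OF measurable_prob_algebraD measurable_emeasure_subprob_algebra]) auto
  ultimately show "(\<lambda>x. emeasure (Pi\<^sub>M I (\<kappa> x)) A) \<in> borel_measurable L"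
    by (simp cong: measurable_cong)
qed

lemma measurable_fun_upd_PiM [measurable (raw)]:
  assumes f: "f \<in> L \<rightarrow>\<^sub>M Pi\<^sub>M {1..h} N" and g: "g \<in> L \<rightarrow>\<^sub>M N (Suc h)"
  shows "(\<lambda>x. (f x)(Suc h := g x)) \<in> L \<rightarrow>\<^sub>M Pi\<^sub>M {1..Suc h} N"
proof -
  have "{1..Suc h} = insert (Suc h) {1..h}" by auto
  then show ?thesis using measurable_fun_upd[OF _ f g, of "{1..Suc h}"] by simp
qed

section \<open>Rollouts and their marginals at one step\<close>

locale markov_decision_process =
  fixes M :: "('x, 'a::finite) mdp"
  assumes valid: "valid_mdp M"
begin

declare One_nat_def [simp del]

abbreviation "X \<equiv> obs M"
abbreviation "Z \<equiv> sampleM M"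
abbreviation "cost_trans h xa \<equiv> cost M h xa \<Otimes>\<^sub>M trans M h xa"
abbreviation "Traj h \<equiv> Pi\<^sub>M {1..h} (\<lambda>_. Z)"
abbreviation "step_law h \<tau> a \<equiv> distr (outcome M (Suc h) (next_obs M h \<tau>, a)) (Traj (Suc h)) (\<lambda>z. \<tau>(Suc h := z))"

lemma space_X [simp]: "space X = UNIV"
  using valid by (simp add: valid_mdp_def)

lemma space_obs_act [simp]: "space (obs_act M) = UNIV"
  by (simp add: obs_act_def space_pair_measure)

lemma space_Z [simp]: "space Z = UNIV"
  by (simp add: sampleM_def space_pair_measure)

lemma horizon_pos: "1 \<le> hor M"
  using valid by (simp add: valid_mdp_def)

lemma kernels [measurable]:
  assumes "h \<in> {1..hor M}"
  shows "trans M h \<in> obs_act M \<rightarrow>\<^sub>M prob_algebra X" "cost M h \<in> obs_act M \<rightarrow>\<^sub>M prob_algebra borel"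
  using assms valid by (auto simp: valid_mdp_def)

lemma cost_AE: "h \<in> {1..hor M} \<Longrightarrow> AE c in cost M h xa. c \<in> {0..1}"
  using valid unfolding valid_mdp_def by blast

lemma measurable_coordinates [measurable]:
  "(\<lambda>z. fst z) \<in> Z \<rightarrow>\<^sub>M X"
  "(\<lambda>z. fst (snd z)) \<in> Z \<rightarrow>\<^sub>M count_space UNIV"
  "(\<lambda>z. fst (snd (snd z))) \<in> Z \<rightarrow>\<^sub>M borel"
  "(\<lambda>z. snd (snd (snd z))) \<in> Z \<rightarrow>\<^sub>M X"
  "(\<lambda>z. (fst z, fst (snd z))) \<in> Z \<rightarrow>\<^sub>M obs_act M"
  unfolding sampleM_def obs_act_def by measurable

lemma measurable_obs_act_pair [measurable (raw)]:
  assumes "f \<in> L \<rightarrow>\<^sub>M X" "g \<in> L \<rightarrow>\<^sub>M count_space UNIV"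
  shows "(\<lambda>x. (f x, g x)) \<in> L \<rightarrow>\<^sub>M obs_act M"
  unfolding obs_act_def using assms by measurable

lemma measurable_outcome [measurable]:
  assumes h: "h \<in> {1..hor M}"
  shows "outcome M h \<in> obs_act M \<rightarrow>\<^sub>M prob_algebra Z"
proof -
  note kernels[OF h, measurable]
  have "(\<lambda>(xa, c, x'). (fst xa, snd xa, c, x')) \<in> obs_act M \<Otimes>\<^sub>M (borel \<Otimes>\<^sub>M X) \<rightarrow>\<^sub>M Z"
    unfolding sampleM_def obs_act_def by measurable
  then show ?thesis
    unfolding outcome_def[abs_def]
    by (intro measurable_distr_prob_space2[where M="borel \<Otimes>\<^sub>M X"] measurable_pair_prob)
       (auto simp: split_beta' kernels[OF h])
qed

lemma outcome_space: "h \<in> {1..hor M} \<Longrightarrow> outcome M h xa \<in> space (prob_algebra Z)"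
  using measurable_space[OF measurable_outcome] by simp

lemma measurable_next_obs [measurable]:
  assumes "j = h"
  shows "next_obs M j \<in> Traj h \<rightarrow>\<^sub>M X"
proof (cases "h = 0")
  case False
  then have "h \<in> {1..h}" by auto
  then have [measurable]: "(\<lambda>\<tau>. \<tau> h) \<in> Traj h \<rightarrow>\<^sub>M Z" by measurable
  show ?thesis using False assms unfolding next_obs_def[abs_def] by simp
qed (simp add: next_obs_def[abs_def] assms)

lemma measurable_step_law:
  assumes h: "Suc h \<in> {1..hor M}"
  shows "(\<lambda>(\<tau>, a). step_law h \<tau> a) \<in> Traj h \<Otimes>\<^sub>M count_space UNIV \<rightarrow>\<^sub>M prob_algebra (Traj (Suc h))"
proof -
  have [measurable]: "next_obs M h \<in> Traj h \<rightarrow>\<^sub>M X" by (rule measurable_next_obs) simp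
  have [measurable]: "(\<lambda>q. outcome M (Suc h) (next_obs M h (fst q), snd q))
      \<in> Traj h \<Otimes>\<^sub>M count_space UNIV \<rightarrow>\<^sub>M prob_algebra Z"
    by (rule measurable_compose[OF _ measurable_outcome[OF h]]) measurable
  show ?thesis
    unfolding split_beta' by (rule measurable_distr_prob_space2[where M=Z]) measurable
qed

text \<open>The parameter \<open>D\<close> stands for the history that selects the policy: joint
  measurability is what makes the rollout of a data-dependent policy a kernel. A fixed policy is the
  case of a one-point parameter space.\<close>

lemma measurable_policy_step:
  assumes h: "Suc h \<in> {1..hor M}"
    and \<pi>: "(\<lambda>(D, x). \<pi> D (Suc h) x) \<in> L \<Otimes>\<^sub>M X \<rightarrow>\<^sub>M prob_algebra (count_space UNIV)"
  shows "(\<lambda>(D, \<tau>). \<pi> D (Suc h) (next_obs M h \<tau>) \<bind> step_law h \<tau>)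
    \<in> L \<Otimes>\<^sub>M Traj h \<rightarrow>\<^sub>M prob_algebra (Traj (Suc h))"
proof -
  have [measurable]: "(\<lambda>p. next_obs M h (snd p)) \<in> L \<Otimes>\<^sub>M Traj h \<rightarrow>\<^sub>M X"
    by (rule measurable_compose[OF measurable_snd measurable_next_obs]) simp
  have "(\<lambda>p. \<pi> (fst p) (Suc h) (next_obs M h (snd p))) \<in> L \<Otimes>\<^sub>M Traj h \<rightarrow>\<^sub>M prob_algebra (count_space UNIV)"
    by (rule measurable_compose[OF _ \<pi>, where f="\<lambda>p. (fst p, next_obs M h (snd p))", simplified]) measurable
  moreover have "(\<lambda>q. step_law h (snd (fst q)) (snd q))
      \<in> (L \<Otimes>\<^sub>M Traj h) \<Otimes>\<^sub>M count_space UNIV \<rightarrow>\<^sub>M prob_algebra (Traj (Suc h))"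
    by (rule measurable_compose[OF _ measurable_step_law[OF h], where f="\<lambda>q. (snd (fst q), snd q)", simplified]) measurable
  ultimately show ?thesis
    unfolding split_beta' by (intro measurable_bind_prob_space2[where N="count_space UNIV"]) (simp_all add: split_beta')
qed

lemma measurable_rollout:
  assumes \<pi>: "\<And>h. h \<in> {1..H} \<Longrightarrow> (\<lambda>(D, x). \<pi> D h x) \<in> L \<Otimes>\<^sub>M X \<rightarrow>\<^sub>M prob_algebra (count_space UNIV)"
    and "H \<le> hor M"
  shows "(\<lambda>D. rollout M (\<pi> D) H) \<in> L \<rightarrow>\<^sub>M prob_algebra (Traj H)"
  using assms
proof (induction H)
  case 0
  have "(\<lambda>_. undefined) \<in> space (Traj 0)"
    by (auto simp: space_PiM PiE_def extensional_def)
  then show ?case by (simp add: space_prob_algebra prob_space_return)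
next
  case (Suc h)
  have "(\<lambda>D. rollout M (\<pi> D) h) \<in> L \<rightarrow>\<^sub>M prob_algebra (Traj h)"
    using Suc.prems by (intro Suc.IH) auto
  moreover have "(\<lambda>(D, \<tau>). \<pi> D (Suc h) (next_obs M h \<tau>) \<bind> step_law h \<tau>)
      \<in> L \<Otimes>\<^sub>M Traj h \<rightarrow>\<^sub>M prob_algebra (Traj (Suc h))"
    using Suc.prems by (intro measurable_policy_step) auto
  ultimately show ?case
    unfolding rollout.simps by (rule measurable_bind_prob_space2)
qed

lemma constant_policy:
  assumes "is_policy M \<pi>" "h \<in> {1..hor M}"
  shows "(\<lambda>(_ :: unit, x). \<pi> h x) \<in> count_space UNIV \<Otimes>\<^sub>M X \<rightarrow>\<^sub>M prob_algebra (count_space UNIV)"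
  using assms by (auto simp: is_policy_def split_beta' intro!: measurable_compose[OF measurable_snd])

lemma rollout_space:
  assumes "is_policy M \<pi>" "h \<le> hor M"
  shows "rollout M \<pi> h \<in> space (prob_algebra (Traj h))"
proof -
  have "(\<lambda>_::unit. rollout M \<pi> h) \<in> count_space UNIV \<rightarrow>\<^sub>M prob_algebra (Traj h)"
    using assms by (intro measurable_rollout constant_policy) auto
  from measurable_space[OF this] show ?thesis by simp
qed

lemma policy_kernel:
  assumes "is_policy M \<pi>" "h \<in> {1..hor M}"
  shows "\<pi> h \<in> X \<rightarrow>\<^sub>M prob_algebra (count_space UNIV)" "prob_space (\<pi> h x)" "sets (\<pi> h x) = UNIV"
proof -
  show k: "\<pi> h \<in> X \<rightarrow>\<^sub>M prob_algebra (count_space UNIV)" using assms by (simp add: is_policy_def)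
  have "\<pi> h x \<in> space (prob_algebra (count_space UNIV))" using measurable_space[OF k, of x] by simp
  then show "prob_space (\<pi> h x)" "sets (\<pi> h x) = UNIV" by (auto simp: space_prob_algebra)
qed

lemma nn_integral_rollout_Suc:
  assumes \<pi>: "is_policy M \<pi>" and h: "Suc h \<in> {1..hor M}"
    and G [measurable]: "G \<in> borel_measurable (Traj (Suc h))"
  shows "(\<integral>\<^sup>+\<tau>. G \<tau> \<partial>rollout M \<pi> (Suc h)) =
    (\<integral>\<^sup>+\<tau>. \<integral>\<^sup>+a. \<integral>\<^sup>+z. G (\<tau>(Suc h := z)) \<partial>outcome M (Suc h) (next_obs M h \<tau>, a)
       \<partial>\<pi> (Suc h) (next_obs M h \<tau>) \<partial>rollout M \<pi> h)"
proof -
  have step: "(\<lambda>\<tau>. \<pi> (Suc h) (next_obs M h \<tau>) \<bind> step_law h \<tau>) \<in> Traj h \<rightarrow>\<^sub>M prob_algebra (Traj (Suc h))"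
    using measurable_Pair2[OF measurable_policy_step[OF h, where \<pi>="\<lambda>_. \<pi>", OF constant_policy[OF \<pi> h]], of "()"] by simp
  have R: "rollout M \<pi> h \<in> space (prob_algebra (Traj h))" using h by (intro rollout_space \<pi>) auto
  note R' = prob_algebraD[OF R]
  have "(\<integral>\<^sup>+\<tau>. G \<tau> \<partial>rollout M \<pi> (Suc h)) = (\<integral>\<^sup>+\<tau>. \<integral>\<^sup>+\<tau>'. G \<tau>' \<partial>(\<pi> (Suc h) (next_obs M h \<tau>) \<bind> step_law h \<tau>) \<partial>rollout M \<pi> h)"
    unfolding rollout.simps using step[THEN measurable_prob_algebraD]
    by (intro nn_integral_bind[where B="Traj (Suc h)"]) (auto simp: measurable_cong_sets[OF R'(2) refl])
  also have "\<dots> = (\<integral>\<^sup>+\<tau>. \<integral>\<^sup>+a. \<integral>\<^sup>+z. G (\<tau>(Suc h := z)) \<partial>outcome M (Suc h) (next_obs M h \<tau>, a)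
       \<partial>\<pi> (Suc h) (next_obs M h \<tau>) \<partial>rollout M \<pi> h)"
  proof (rule nn_integral_cong)
    fix \<tau> assume "\<tau> \<in> space (rollout M \<pi> h)"
    then have \<tau>: "\<tau> \<in> space (Traj h)" using R' by simp
    have [measurable]: "(\<lambda>z. \<tau>(Suc h := z)) \<in> Z \<rightarrow>\<^sub>M Traj (Suc h)"
      using \<tau> by (intro measurable_fun_upd_PiM) auto
    have Q: "sets (outcome M (Suc h) (next_obs M h \<tau>, a)) = sets Z" for a
      using prob_algebraD(2)[OF outcome_space[OF h]] .
    have "(\<integral>\<^sup>+\<tau>'. G \<tau>' \<partial>(\<pi> (Suc h) (next_obs M h \<tau>) \<bind> step_law h \<tau>)) =
       (\<integral>\<^sup>+a. \<integral>\<^sup>+\<tau>'. G \<tau>' \<partial> step_law h \<tau> a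
         \<partial>\<pi> (Suc h) (next_obs M h \<tau>))"
    proof (rule nn_integral_bind[where B="Traj (Suc h)"])
      have "step_law h \<tau>
         \<in> count_space UNIV \<rightarrow>\<^sub>M subprob_algebra (Traj (Suc h))"
        using measurable_Pair2[OF measurable_step_law[OF h] \<tau>] by (intro measurable_prob_algebraD) simp
      then show "step_law h \<tau>
         \<in> \<pi> (Suc h) (next_obs M h \<tau>) \<rightarrow>\<^sub>M subprob_algebra (Traj (Suc h))"
        using policy_kernel(3)[OF \<pi> h] by (subst measurable_cong_sets[of _ "count_space UNIV", OF _ refl]) auto
    qed simp
    also have "\<dots> = (\<integral>\<^sup>+a. \<integral>\<^sup>+z. G (\<tau>(Suc h := z)) \<partial>outcome M (Suc h) (next_obs M h \<tau>, a) \<partial>\<pi> (Suc h) (next_obs M h \<tau>))"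
      by (intro nn_integral_cong nn_integral_distr) (auto simp: measurable_cong_sets[OF Q refl])
    finally show "(\<integral>\<^sup>+\<tau>'. G \<tau>' \<partial>(\<pi> (Suc h) (next_obs M h \<tau>) \<bind> step_law h \<tau>)) =
       (\<integral>\<^sup>+a. \<integral>\<^sup>+z. G (\<tau>(Suc h := z)) \<partial>outcome M (Suc h) (next_obs M h \<tau>, a) \<partial>\<pi> (Suc h) (next_obs M h \<tau>))" .
  qed
  finally show ?thesis .
qed

definition sample_law :: "('x, 'a) policy \<Rightarrow> nat \<Rightarrow> ('x, 'a) sample measure" where
  "sample_law \<pi> h = distr (rollout M \<pi> (hor M)) Z (\<lambda>\<tau>. \<tau> h)"

text \<open>The steps after \<open>h\<close> integrate to one, so the marginal at \<open>h\<close>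
  does not depend on how far the rollout is continued.\<close>

lemma nn_integral_rollout_coordinate:
  assumes \<pi>: "is_policy M \<pi>" and h: "h \<in> {1..j}" and j: "j \<le> hor M" and g [measurable]: "g \<in> borel_measurable Z"
  shows "(\<integral>\<^sup>+\<tau>. g (\<tau> h) \<partial>rollout M \<pi> j) = (\<integral>\<^sup>+\<tau>. g (\<tau> h) \<partial>rollout M \<pi> h)"
  using h j
proof (induction j)
  case (Suc j)
  show ?case
  proof (cases "h = Suc j")
    case False
    then have h: "h \<in> {1..j}" "h \<in> {1..Suc j}" and j: "Suc j \<in> {1..hor M}" using Suc.prems by auto
    have [measurable]: "(\<lambda>\<tau>. g (\<tau> h)) \<in> borel_measurable (Traj (Suc j))"
      using h by measurable
    have one: "emeasure (outcome M (Suc j) xa) (space (outcome M (Suc j) xa)) = 1" for xa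
      using prob_space.emeasure_space_1[OF prob_algebraD(1)[OF outcome_space[OF j]]] .
    have one': "emeasure (\<pi> (Suc j) x) (space (\<pi> (Suc j) x)) = 1" for x
      using prob_space.emeasure_space_1[OF policy_kernel(2)[OF \<pi> j]] .
    have "(\<integral>\<^sup>+\<tau>. g (\<tau> h) \<partial>rollout M \<pi> (Suc j)) = (\<integral>\<^sup>+\<tau>. g (\<tau> h) \<partial>rollout M \<pi> j)"
      using False by (subst nn_integral_rollout_Suc[OF \<pi> j]) (simp_all add: one one')
    then show ?thesis using Suc.IH[OF h(1)] Suc.prems by simp
  qed simp
qed simp

lemma component_measurable:
  "h \<in> I \<Longrightarrow> (\<lambda>\<tau>. \<tau> h) \<in> Pi\<^sub>M I (\<lambda>_. Z) \<rightarrow>\<^sub>M Z"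
  by measurable

lemma rollout_coordinate:
  assumes "is_policy M \<pi>" "h \<in> {1..hor M}"
  shows "(\<lambda>\<tau>. \<tau> h) \<in> rollout M \<pi> (hor M) \<rightarrow>\<^sub>M Z"
  using component_measurable[OF assms(2)] by (simp add: measurable_law[OF rollout_space[OF assms(1) order.refl]])

lemma sample_law_space:
  assumes "is_policy M \<pi>" "h \<in> {1..hor M}"
  shows "sample_law \<pi> h \<in> space (prob_algebra Z)"
proof -
  show ?thesis
    using prob_space.prob_space_distr[OF prob_algebraD(1)[OF rollout_space[OF assms(1) order.refl]] rollout_coordinate[OF assms]]
    by (simp add: sample_law_def space_prob_algebra)
qed

lemma nn_integral_sample_law_rollout:
  assumes \<pi>: "is_policy M \<pi>" and h: "h \<in> {1..j}" and j: "j \<le> hor M" and g [measurable]: "g \<in> borel_measurable Z"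
  shows "(\<integral>\<^sup>+z. g z \<partial>sample_law \<pi> h) = (\<integral>\<^sup>+\<tau>. g (\<tau> h) \<partial>rollout M \<pi> j)"
proof -
  have h': "h \<in> {1..hor M}" using h j by auto
  have "(\<integral>\<^sup>+z. g z \<partial>sample_law \<pi> h) = (\<integral>\<^sup>+\<tau>. g (\<tau> h) \<partial>rollout M \<pi> (hor M))"
    unfolding sample_law_def by (rule nn_integral_distr[OF rollout_coordinate[OF \<pi> h']]) simp
  then show ?thesis
    using nn_integral_rollout_coordinate[OF \<pi> h j g] nn_integral_rollout_coordinate[OF \<pi> h' order.refl g] by simp
qed

lemma nn_integral_sample_law_Suc:
  assumes \<pi>: "is_policy M \<pi>" and h: "Suc h \<in> {1..hor M}" and g [measurable]: "g \<in> borel_measurable Z"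
  shows "(\<integral>\<^sup>+z. g z \<partial>sample_law \<pi> (Suc h)) =
    (\<integral>\<^sup>+\<tau>. \<integral>\<^sup>+a. \<integral>\<^sup>+z. g z \<partial>outcome M (Suc h) (next_obs M h \<tau>, a)
       \<partial>\<pi> (Suc h) (next_obs M h \<tau>) \<partial>rollout M \<pi> h)"
proof -
  have "Suc h \<in> {1..Suc h}" by auto
  then have [measurable]: "(\<lambda>\<tau>. g (\<tau> (Suc h))) \<in> borel_measurable (Traj (Suc h))" by measurable
  show ?thesis
    using h by (subst nn_integral_sample_law_rollout[OF \<pi>, of _ "Suc h"])
      (auto simp del: rollout.simps simp: nn_integral_rollout_Suc[OF \<pi> h])
qed

lemma pair_kernel:
  assumes h: "h \<in> {1..hor M}"
  shows "cost_trans h xa \<in> space (prob_algebra (borel \<Otimes>\<^sub>M X))"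
proof -
  have "(\<lambda>xa. cost_trans h xa) \<in> obs_act M \<rightarrow>\<^sub>M prob_algebra (borel \<Otimes>\<^sub>M X)"
    using kernels[OF h] by (intro measurable_pair_prob)
  from measurable_space[OF this] show ?thesis by simp
qed

lemma measurable_sample_tuple:
  assumes h: "h \<in> {1..hor M}"
  shows "(\<lambda>(c, x'). (fst xa, snd xa, c, x')) \<in> cost_trans h xa \<rightarrow>\<^sub>M Z"
proof -
  have "(\<lambda>(c, x'). (fst xa, snd xa, c, x')) \<in> borel \<Otimes>\<^sub>M X \<rightarrow>\<^sub>M Z"
    unfolding sampleM_def by measurable
  then show ?thesis by (simp add: measurable_law[OF pair_kernel[OF h]])
qed

lemma nn_integral_outcome:
  assumes h: "h \<in> {1..hor M}" and g [measurable]: "g \<in> borel_measurable Z"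
  shows "(\<integral>\<^sup>+z. g z \<partial>outcome M h xa) = (\<integral>\<^sup>+(c, x'). g (fst xa, snd xa, c, x') \<partial>(cost_trans h xa))"
  unfolding outcome_def
  by (subst nn_integral_distr[OF measurable_sample_tuple[OF h]]) (simp_all add: split_beta')

lemma nn_integral_outcome_query:
  assumes h: "h \<in> {1..hor M}" and G: "G \<in> borel_measurable (obs_act M)"
  shows "(\<integral>\<^sup>+z. G (fst z, fst (snd z)) \<partial>outcome M h xa) = G xa"
proof -
  have "(\<lambda>z. G (fst z, fst (snd z))) \<in> borel_measurable Z"
    using G by measurable
  then show ?thesis
    using prob_space.emeasure_space_1[OF prob_algebraD(1)[OF pair_kernel[OF h]]]
    by (subst nn_integral_outcome[OF h]) (simp_all add: split_beta')
qed

lemma occ_eq: "h \<in> {1..hor M} \<Longrightarrow> is_policy M \<pi> \<Longrightarrow>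
    occ M \<pi> h = distr (sample_law \<pi> h) (obs_act M) (\<lambda>z. (fst z, fst (snd z)))"
  and occ_obs_eq: "h \<in> {1..hor M} \<Longrightarrow> is_policy M \<pi> \<Longrightarrow> occ_obs M \<pi> h = distr (sample_law \<pi> h) X fst"
proof -
  assume a: "h \<in> {1..hor M}" "is_policy M \<pi>"
  note m = rollout_coordinate[OF a(2,1)]
  show "occ M \<pi> h = distr (sample_law \<pi> h) (obs_act M) (\<lambda>z. (fst z, fst (snd z)))"
    unfolding occ_def sample_law_def by (subst distr_distr[OF _ m]) (auto simp: comp_def)
  show "occ_obs M \<pi> h = distr (sample_law \<pi> h) X fst"
    unfolding occ_obs_def sample_law_def by (subst distr_distr[OF _ m]) (auto simp: comp_def)
qed

lemma occ_space:
  assumes "is_policy M \<pi>" "h \<in> {1..hor M}"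
  shows "occ M \<pi> h \<in> space (prob_algebra (obs_act M))" "occ_obs M \<pi> h \<in> space (prob_algebra X)"
proof -
  note S = prob_algebraD[OF sample_law_space[OF assms]]
  have "(\<lambda>z. (fst z, fst (snd z))) \<in> sample_law \<pi> h \<rightarrow>\<^sub>M obs_act M" "fst \<in> sample_law \<pi> h \<rightarrow>\<^sub>M X"
    by (simp_all add: measurable_cong_sets[OF S(2) refl])
  then show "occ M \<pi> h \<in> space (prob_algebra (obs_act M))" "occ_obs M \<pi> h \<in> space (prob_algebra X)"
    using assms prob_space.prob_space_distr[OF S(1)] by (simp_all add: occ_eq occ_obs_eq space_prob_algebra)
qed

lemma outcome_kernel:
  assumes "\<mu> \<in> space (prob_algebra (obs_act M))" "h \<in> {1..hor M}"
  shows "outcome M h \<in> \<mu> \<rightarrow>\<^sub>M subprob_algebra Z"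
  using measurable_prob_algebraD[OF measurable_outcome[OF assms(2)]] by (simp add: measurable_law[OF assms(1)])

lemma nn_integral_occ:
  assumes \<pi>: "is_policy M \<pi>" and h: "Suc h \<in> {1..hor M}" and G [measurable]: "G \<in> borel_measurable (obs_act M)"
  shows "(\<integral>\<^sup>+xa. G xa \<partial>occ M \<pi> (Suc h)) =
    (\<integral>\<^sup>+\<tau>. \<integral>\<^sup>+a. G (next_obs M h \<tau>, a) \<partial>\<pi> (Suc h) (next_obs M h \<tau>) \<partial>rollout M \<pi> h)"
proof -
  note S = prob_algebraD[OF sample_law_space[OF \<pi> h]]
  have m: "(\<lambda>z. (fst z, fst (snd z))) \<in> sample_law \<pi> (Suc h) \<rightarrow>\<^sub>M obs_act M"
    by (simp add: measurable_cong_sets[OF S(2) refl])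
  have "(\<integral>\<^sup>+xa. G xa \<partial>occ M \<pi> (Suc h)) = (\<integral>\<^sup>+z. G (fst z, fst (snd z)) \<partial>sample_law \<pi> (Suc h))"
    unfolding occ_eq[OF h \<pi>] using m by (rule nn_integral_distr) simp
  then show ?thesis
    by (simp add: nn_integral_sample_law_Suc[OF \<pi> h] nn_integral_outcome_query[OF h])
qed

text \<open>Given the queried pair, cost and next observation follow the model whatever the policy.
  This carries bounds for a single query over to the data of a rollout.\<close>

lemma sample_law_eq_bind:
  assumes \<pi>: "is_policy M \<pi>" and h: "h \<in> {1..hor M}"
  shows "sample_law \<pi> h = occ M \<pi> h \<bind> outcome M h"
proof -
  obtain j where j: "h = Suc j" using h by (cases h) auto
  note h' = h[unfolded j]
  note S = prob_algebraD[OF sample_law_space[OF \<pi> h']]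
  note O = occ_space(1)[OF \<pi> h']
  note K = measurable_outcome[OF h']
  note K' = outcome_kernel[OF O h']
  show ?thesis
    unfolding j
  proof (rule measure_eqI)
    show "sets (sample_law \<pi> (Suc j)) = sets (occ M \<pi> (Suc j) \<bind> outcome M (Suc j))"
      using S(2) sets_bind'[OF O K] by simp
    fix A assume "A \<in> sets (sample_law \<pi> (Suc j))"
    then have A [measurable]: "A \<in> sets Z" using S(2) by simp
    have [measurable]: "(\<lambda>xa. \<integral>\<^sup>+z. indicator A z \<partial>outcome M (Suc j) xa) \<in> borel_measurable (obs_act M)"
      by (rule measurable_compose[OF measurable_prob_algebraD[OF K] nn_integral_measurable_subprob_algebra]) simp
    have "emeasure (sample_law \<pi> (Suc j)) A = (\<integral>\<^sup>+z. indicator A z \<partial>sample_law \<pi> (Suc j))"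
      using S(2) by simp
    also have "\<dots> = (\<integral>\<^sup>+xa. \<integral>\<^sup>+z. indicator A z \<partial>outcome M (Suc j) xa \<partial>occ M \<pi> (Suc j))"
      by (subst nn_integral_sample_law_Suc[OF \<pi> h'], simp, subst nn_integral_occ[OF \<pi> h']) simp_all
    also have "\<dots> = (\<integral>\<^sup>+z. indicator A z \<partial>(occ M \<pi> (Suc j) \<bind> outcome M (Suc j)))"
      using K' by (intro nn_integral_bind[symmetric, where B=Z]) simp
    also have "\<dots> = emeasure (occ M \<pi> (Suc j) \<bind> outcome M (Suc j)) A"
      using sets_bind'[OF O K] by simp
    finally show "emeasure (sample_law \<pi> (Suc j)) A = emeasure (occ M \<pi> (Suc j) \<bind> outcome M (Suc j)) A" .
  qed
qed

lemma occ_obs_Suc_rollout: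
  assumes \<pi>: "is_policy M \<pi>" and h: "Suc h \<in> {1..hor M}"
  shows "occ_obs M \<pi> (Suc h) = distr (rollout M \<pi> h) X (next_obs M h)"
proof (rule measure_eqI)
  have R: "rollout M \<pi> h \<in> space (prob_algebra (Traj h))" using h by (intro rollout_space \<pi>) auto
  have n: "next_obs M h \<in> rollout M \<pi> h \<rightarrow>\<^sub>M X" by (simp add: measurable_law[OF R])
  note O = prob_algebraD(2)[OF occ_space(2)[OF \<pi> h]]
  show "sets (occ_obs M \<pi> (Suc h)) = sets (distr (rollout M \<pi> h) X (next_obs M h))" by (simp add: O)
  have [measurable]: "fst \<in> obs_act M \<rightarrow>\<^sub>M X" unfolding obs_act_def by measurable
  have f: "fst \<in> sample_law \<pi> (Suc h) \<rightarrow>\<^sub>M X" by (simp add: measurable_law[OF sample_law_space[OF \<pi> h]])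
  fix A assume "A \<in> sets (occ_obs M \<pi> (Suc h))"
  then have [measurable]: "A \<in> sets X" by (simp add: O)
  let ?G = "\<lambda>x. indicator A x :: ennreal"
  have "emeasure (occ_obs M \<pi> (Suc h)) A = (\<integral>\<^sup>+z. ?G (fst z) \<partial>sample_law \<pi> (Suc h))"
    using nn_integral_distr[OF f, of ?G] by (simp add: occ_obs_eq[OF h \<pi>])
  also have "\<dots> = (\<integral>\<^sup>+\<tau>. ?G (next_obs M h \<tau>) \<partial>rollout M \<pi> h)"
    using nn_integral_outcome_query[OF h, of "\<lambda>xa. ?G (fst xa)"] prob_space.emeasure_space_1[OF policy_kernel(2)[OF \<pi> h]]
    by (subst nn_integral_sample_law_Suc[OF \<pi> h]) simp_all
  also have "\<dots> = emeasure (distr (rollout M \<pi> h) X (next_obs M h)) A"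
    using nn_integral_distr[OF n, of ?G] by simp
  finally show "emeasure (occ_obs M \<pi> (Suc h)) A = emeasure (distr (rollout M \<pi> h) X (next_obs M h)) A" .
qed

lemma occ_obs_1:
  assumes \<pi>: "is_policy M \<pi>"
  shows "occ_obs M \<pi> 1 = return X (init M)"
proof -
  have "(\<lambda>_. undefined) \<in> space (Traj 0)" by (auto simp: space_PiM PiE_def extensional_def)
  then have "distr (rollout M \<pi> 0) X (next_obs M 0) = return X (next_obs M 0 (\<lambda>_. undefined))"
    unfolding rollout.simps by (intro distr_return measurable_next_obs refl)
  then show ?thesis
    using occ_obs_Suc_rollout[OF \<pi>, of 0] horizon_pos by (simp add: next_obs_def One_nat_def del: rollout.simps)
qed

text \<open>Links consecutive steps: the observation at \<open>h + 1\<close> is the last coordinate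
  of the sample at \<open>h\<close>. The strict bound on \<open>h\<close> keeps step
  \<open>h + 1\<close> inside the horizon.\<close>

lemma occ_obs_Suc:
  assumes \<pi>: "is_policy M \<pi>" and h: "h \<in> {1..<hor M}" and v [measurable]: "v \<in> borel_measurable X"
  shows "(\<integral>x. v x \<partial>occ_obs M \<pi> (Suc h)) = (\<integral>z. (v (snd (snd (snd z))) :: real) \<partial>sample_law \<pi> h)"
proof -
  have h': "Suc h \<in> {1..hor M}" "h \<in> {1..hor M}" "h \<in> {1..h}" "h \<le> hor M" using h by auto
  note R = rollout_space[OF \<pi> h'(4)]
  have n: "next_obs M h \<in> rollout M \<pi> h \<rightarrow>\<^sub>M X" "(\<lambda>\<tau>. \<tau> h) \<in> rollout M \<pi> h \<rightarrow>\<^sub>M Z"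
    using component_measurable[OF h'(3)] by (simp_all add: measurable_law[OF R])
  have "sample_law \<pi> h = distr (rollout M \<pi> h) Z (\<lambda>\<tau>. \<tau> h)"
  proof (rule measure_eqI)
    fix A assume "A \<in> sets (sample_law \<pi> h)"
    then have [measurable]: "A \<in> sets Z" by (simp add: sample_law_def)
    show "emeasure (sample_law \<pi> h) A = emeasure (distr (rollout M \<pi> h) Z (\<lambda>\<tau>. \<tau> h)) A"
      using nn_integral_sample_law_rollout[OF \<pi> h'(3,4), of "indicator A"] nn_integral_distr[OF n(2), of "indicator A"]
      by (simp add: sample_law_def)
  qed (simp add: sample_law_def)
  then show ?thesis
    using h unfolding occ_obs_Suc_rollout[OF \<pi> h'(1)]
    by (simp add: integral_distr n) (simp add: next_obs_def)
qed

end

section \<open>Bellman residuals and regret\<close>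

lemma integral_bounded:
  fixes G :: "'s \<Rightarrow> real"
  assumes \<mu>: "\<mu> \<in> space (prob_algebra N)" and G: "G \<in> borel_measurable N"
    and B: "AE x in \<mu>. 0 \<le> G x \<and> G x \<le> B"
  shows "integrable \<mu> G" "ennreal (\<integral>x. G x \<partial>\<mu>) = (\<integral>\<^sup>+x. ennreal (G x) \<partial>\<mu>)" "0 \<le> (\<integral>x. G x \<partial>\<mu>)" "(\<integral>x. G x \<partial>\<mu>) \<le> B"
proof -
  interpret prob_space \<mu> using prob_algebraD[OF \<mu>] by simp
  have m: "G \<in> borel_measurable \<mu>" using G by (simp add: measurable_law[OF \<mu>])
  have "AE x in \<mu>. norm (G x) \<le> B" using B by eventually_elim auto
  then show i: "integrable \<mu> G" using m by (rule integrable_const_bound)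
  have nn: "AE x in \<mu>. 0 \<le> G x" using B by eventually_elim auto
  show "ennreal (\<integral>x. G x \<partial>\<mu>) = (\<integral>\<^sup>+x. ennreal (G x) \<partial>\<mu>)"
    using nn_integral_eq_integral[OF i nn] by simp
  show "0 \<le> (\<integral>x. G x \<partial>\<mu>)" using nn by (rule integral_nonneg_AE)
  have le: "AE x in \<mu>. G x \<le> B" using B by eventually_elim auto
  show "(\<integral>x. G x \<partial>\<mu>) \<le> B" using integral_mono_AE[OF i _ le] prob_space by simp
qed

text \<open>Arithmetic-geometric mean with the scale \<open>t = sqrt (b / a)\<close>, which balances
  the two terms; if one mean is zero, that function vanishes almost surely and so does the
  product.\<close>

lemma (in prob_space) integral_sqrt_mult_le:
  fixes A B :: "'a \<Rightarrow> real"
  assumes A: "integrable M A" "\<And>x. 0 \<le> A x" and B: "integrable M B" "\<And>x. 0 \<le> B x"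
  shows "(\<integral>x. sqrt (A x * B x) \<partial>M) \<le> sqrt ((\<integral>x. A x \<partial>M) * (\<integral>x. B x \<partial>M))"
proof -
  have am: "sqrt (A x * B x) \<le> (A x + B x) / 2" for x
    using arith_geo_mean_sqrt[of "A x" "B x"] A B by simp
  have int: "integrable M (\<lambda>x. sqrt (A x * B x))"
  proof (rule Bochner_Integration.integrable_bound[of M "\<lambda>x. (A x + B x) / 2"])
    have [measurable]: "A \<in> borel_measurable M" "B \<in> borel_measurable M" using A B by simp_all
    show "(\<lambda>x. sqrt (A x * B x)) \<in> borel_measurable M" by measurable
    have "norm (sqrt (A x * B x)) \<le> norm ((A x + B x) / 2)" for x
      using am[of x] A(2)[of x] B(2)[of x] by simp
    then show "AE x in M. norm (sqrt (A x * B x)) \<le> norm ((A x + B x) / 2)" by simp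
  qed (use A B in simp)
  have zero: "(\<integral>x. sqrt (f x * g x) \<partial>M) \<le> 0"
    if "integrable M f" "\<And>x. 0 \<le> f x" "(\<integral>x. f x \<partial>M) = 0" for f g :: "'a \<Rightarrow> real"
  proof -
    have "AE x in M. f x = 0" using integral_nonneg_eq_0_iff_AE[of M f] that by simp
    then have "(\<integral>x. sqrt (f x * g x) \<partial>M) = 0" by (intro integral_eq_zero_AE) (auto elim!: eventually_mono)
    then show ?thesis by simp
  qed
  define a b where "a = (\<integral>x. A x \<partial>M)" and "b = (\<integral>x. B x \<partial>M)"
  have ab: "0 \<le> a" "0 \<le> b" unfolding a_def b_def using A B by (auto intro: integral_nonneg_AE)
  consider "a = 0" | "b = 0" | "0 < a" "0 < b" using ab by linarith
  then show ?thesis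
  proof cases
    case 1
    then show ?thesis using zero[OF A, of B] ab by (simp flip: a_def b_def)
  next
    case 2
    then show ?thesis using zero[OF B, of A] ab by (simp add: mult.commute flip: a_def b_def)
  next
    case 3
    define t where "t = sqrt (b / a)"
    have t: "0 < t" "t * a = sqrt (a * b)" "b / t = sqrt (a * b)"
      using 3 by (auto simp: t_def real_sqrt_divide real_sqrt_mult field_simps)
    have "sqrt (A x * B x) \<le> (t * A x + B x / t) / 2" for x
      using arith_geo_mean_sqrt[of "t * A x" "B x / t"] t A B by simp
    then have "(\<integral>x. sqrt (A x * B x) \<partial>M) \<le> (\<integral>x. (t * A x + B x / t) / 2 \<partial>M)"
      using int A B by (intro integral_mono) auto
    also have "\<dots> = (t * a + b / t) / 2" using A B by (simp add: a_def b_def)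
    also have "\<dots> = sqrt (a * b)" using t by simp
    finally show ?thesis by (simp add: a_def b_def)
  qed
qed

text \<open>With \<open>d = |sqrt u - sqrt v|\<close> and \<open>r\<close> the residual,
  \<open>d^2 \<le> 2 * r\<close> and
  \<open>|u - v| = d * (sqrt u + sqrt v) \<le> d * (2 * sqrt u + d)\<close>. The bound is kept in
  terms of the estimate \<open>u\<close>, whose mean along a policy can be related to the value of
  that policy; constants are rounded up.\<close>

lemma abs_diff_le_bce:
  assumes u: "0 \<le> u" "u \<le> 1" and v: "0 \<le> v" "v \<le> 1"
  shows "\<bar>u - v\<bar> \<le> 6 * sqrt (residual Bce u v * u) + 4 * residual Bce u v"
proof -
  define r d where "r = residual Bce u v" and "d = \<bar>sqrt u - sqrt v\<bar>"
  have d: "0 \<le> d" "d\<^sup>2 \<le> 2 * r" by (simp_all add: d_def r_def)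
  have r: "0 \<le> r" using residual_bounds(1)[OF u v] by (simp add: r_def)
  have "\<bar>u - v\<bar> = \<bar>(sqrt u - sqrt v) * (sqrt u + sqrt v)\<bar>" using u v by (simp add: algebra_simps)
  also have "\<dots> = d * (sqrt u + sqrt v)" using u v by (simp add: abs_mult d_def)
  also have "\<dots> \<le> d * (2 * sqrt u + d)" using d by (intro mult_left_mono) (auto simp: d_def)
  also have "\<dots> = 2 * sqrt (d\<^sup>2 * u) + d\<^sup>2" using d by (simp add: real_sqrt_mult power2_eq_square algebra_simps)
  also have "\<dots> \<le> 2 * sqrt (9 * (r * u)) + 2 * r"
  proof -
    have "d\<^sup>2 * u \<le> 9 * (r * u)"
      using mult_right_mono[OF d(2) u(1)] mult_nonneg_nonneg[OF r u(1)] unfolding mult.assoc by linarith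
    then show ?thesis using d(2) by (intro add_mono mult_left_mono real_sqrt_le_mono) auto
  qed
  also have "\<dots> = 6 * sqrt (r * u) + 2 * r" by (simp add: real_sqrt_mult)
  finally show ?thesis using r unfolding r_def by linarith
qed

section \<open>Regression targets and expected costs\<close>

context markov_decision_process
begin

definition vmin :: "('x \<times> 'a \<Rightarrow> real) \<Rightarrow> 'x \<Rightarrow> real" where
  "vmin g x = (MIN a. g (x, a))"

definition target :: "('x \<times> 'a \<Rightarrow> real) \<Rightarrow> ('x, 'a) sample \<Rightarrow> real" where
  "target g z = sample_cost z + vmin g (snd (snd (snd z)))"

lemma measurable_sample_cost [measurable]: "sample_cost \<in> borel_measurable Z"
  unfolding sample_cost_def[abs_def] by measurable

lemma measurable_vmin [measurable]:
  assumes [measurable]: "g \<in> borel_measurable (obs_act M)"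
  shows "vmin g \<in> borel_measurable X"
proof -
  have "(\<lambda>x. g (x, a)) \<in> borel_measurable X" for a
    by measurable
  then show ?thesis
    unfolding vmin_def[abs_def] by (intro borel_measurable_Min) auto
qed

lemma measurable_target [measurable]:
  assumes [measurable]: "g \<in> borel_measurable (obs_act M)"
  shows "target g \<in> borel_measurable Z"
  unfolding target_def[abs_def] by measurable

lemma vmin_le: "vmin g x \<le> g (x, a)"
  unfolding vmin_def by (rule Min_le) auto

lemma vmin_eqI: "(\<And>a'. g (x, a) \<le> g (x, a')) \<Longrightarrow> vmin g x = g (x, a)"
  unfolding vmin_def by (rule Min_eqI) auto

lemma vmin_bounds:
  assumes "\<And>xa. 0 \<le> g xa \<and> g xa \<le> 1"
  shows "0 \<le> vmin g x \<and> vmin g x \<le> 1"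
proof
  show "0 \<le> vmin g x" unfolding vmin_def using assms by simp
  show "vmin g x \<le> 1" using vmin_le[of g x undefined] assms[of "(x, undefined)"] by linarith
qed

lemma cost_AE_pair:
  assumes h: "h \<in> {1..hor M}"
  shows "AE p in cost_trans h xa. fst p \<in> {0..1}"
proof -
  have c: "prob_space (cost M h xa)" "prob_space (trans M h xa)" "sets (cost M h xa) = sets borel"
    using measurable_space[OF kernels(1)[OF h]] measurable_space[OF kernels(2)[OF h]] by (auto simp: space_prob_algebra)
  interpret T: prob_space "trans M h xa" by fact
  interpret C: prob_space "cost M h xa" by fact
  have "AE c in distr (cost_trans h xa) (cost M h xa) fst. c \<in> {0..1}"
    unfolding T.distr_pair_fst by (rule cost_AE[OF h])
  then show ?thesis by (rule AE_distrD[OF measurable_fst])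
qed

lemma cost_AE_outcome:
  assumes h: "h \<in> {1..hor M}"
  shows "AE z in outcome M h xa. sample_cost z \<in> {0..1}"
  unfolding outcome_def
proof (subst AE_distr_iff[OF measurable_sample_tuple[OF h]])
  show "{z \<in> space Z. sample_cost z \<in> {0..1}} \<in> sets Z" by measurable
  show "AE p in cost_trans h xa. sample_cost (case p of (c, x') \<Rightarrow> (fst xa, snd xa, c, x')) \<in> {0..1}"
    using cost_AE_pair[OF h, of xa] by eventually_elim (auto simp: sample_cost_def split_beta')
qed

lemma cost_AE_sample_law:
  assumes \<pi>: "is_policy M \<pi>" and h: "h \<in> {1..hor M}"
  shows "AE z in sample_law \<pi> h. sample_cost z \<in> {0..1}"
proof -
  note K = outcome_kernel[OF occ_space(1)[OF \<pi> h] h]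
  show ?thesis
    unfolding sample_law_eq_bind[OF \<pi> h]
    using cost_AE_outcome[OF h] by (subst AE_bind[OF K]) auto
qed

lemma bellman_eq_pair: "bellman M h g xa = (\<integral>p. fst p + vmin g (snd p) \<partial>(cost_trans h xa))"
  by (simp add: bellman_def vmin_def split_beta')

lemma bellman_eq_outcome:
  assumes h: "h \<in> {1..hor M}" and [measurable]: "g \<in> borel_measurable (obs_act M)"
  shows "bellman M h g xa = (\<integral>z. target g z \<partial>outcome M h xa)"
  unfolding bellman_eq_pair outcome_def
  by (subst integral_distr[OF measurable_sample_tuple[OF h]])
     (auto simp: target_def sample_cost_def split_beta')

definition expected_cost :: "('x, 'a) policy \<Rightarrow> nat \<Rightarrow> real" where
  "expected_cost \<pi> h = (\<integral>z. sample_cost z \<partial>sample_law \<pi> h)"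

lemma expected_cost_nonneg:
  assumes "is_policy M \<pi>" "h \<in> {1..hor M}"
  shows "0 \<le> expected_cost \<pi> h"
  unfolding expected_cost_def
  using integral_bounded(3)[OF sample_law_space[OF assms] measurable_sample_cost, of 1] cost_AE_sample_law[OF assms]
  by (auto elim!: eventually_mono)

lemma policy_value_eq:
  assumes \<pi>: "is_policy M \<pi>"
  shows "policy_value M \<pi> = (\<Sum>h=1..hor M. expected_cost \<pi> h)"
proof -
  note m = rollout_coordinate[OF \<pi>]
  have eq: "(\<integral>\<tau>. sample_cost (\<tau> h) \<partial>rollout M \<pi> (hor M)) = expected_cost \<pi> h"
    and int: "integrable (rollout M \<pi> (hor M)) (\<lambda>\<tau>. sample_cost (\<tau> h))" if h: "h \<in> {1..hor M}" for h
  proof -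
    show "(\<integral>\<tau>. sample_cost (\<tau> h) \<partial>rollout M \<pi> (hor M)) = expected_cost \<pi> h"
      unfolding expected_cost_def sample_law_def by (subst integral_distr[OF m[OF h]]) simp_all
    have "AE z in sample_law \<pi> h. 0 \<le> sample_cost z \<and> sample_cost z \<le> 1"
      using cost_AE_sample_law[OF \<pi> h] by simp
    from integral_bounded(1)[OF sample_law_space[OF \<pi> h] measurable_sample_cost this]
    show "integrable (rollout M \<pi> (hor M)) (\<lambda>\<tau>. sample_cost (\<tau> h))"
      unfolding sample_law_def by (subst (asm) integrable_distr_eq[OF m[OF h]]) simp_all
  qed
  show ?thesis
    unfolding policy_value_def total_cost_def
    by (subst Bochner_Integration.integral_sum) (auto simp: eq int)
qed

lemma policy_value_nonneg: "is_policy M \<pi> \<Longrightarrow> 0 \<le> policy_value M \<pi>"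
  using expected_cost_nonneg by (auto simp: policy_value_eq intro!: sum_nonneg)

text \<open>Conditioning on the query: the inner mean of the target is the Bellman image, and mixing
  over queries gives the sample law, under which the target splits into cost and continuation
  value.\<close>

lemma integral_bellman_occ:
  assumes \<pi>: "is_policy M \<pi>" and h: "h \<in> {1..hor M}" and [measurable]: "g \<in> borel_measurable (obs_act M)"
    and g: "\<And>xa. 0 \<le> g xa \<and> g xa \<le> 1"
    and T: "bellman M h g \<in> borel_measurable (obs_act M)" "\<And>xa. 0 \<le> bellman M h g xa \<and> bellman M h g xa \<le> 1"
  shows "(\<integral>xa. bellman M h g xa \<partial>occ M \<pi> h) =
    expected_cost \<pi> h + (\<integral>z. vmin g (snd (snd (snd z))) \<partial>sample_law \<pi> h)"
proof -
  note O = occ_space(1)[OF \<pi> h] and S = sample_law_space[OF \<pi> h]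
  note K = outcome_kernel[OF occ_space(1)[OF \<pi> h] h]
  have AE_o: "AE z in outcome M h xa. 0 \<le> target g z \<and> target g z \<le> 2" for xa
    using cost_AE_outcome[OF h, of xa]
    by eventually_elim (use vmin_bounds[OF g] in \<open>auto simp: target_def intro: order_trans[OF add_mono]\<close>)
  have AE_c: "AE z in sample_law \<pi> h. 0 \<le> sample_cost z \<and> sample_cost z \<le> 1"
    using cost_AE_sample_law[OF \<pi> h] by simp
  have AE_s: "AE z in sample_law \<pi> h. 0 \<le> target g z \<and> target g z \<le> 2"
    using cost_AE_sample_law[OF \<pi> h]
    by eventually_elim (use vmin_bounds[OF g] in \<open>auto simp: target_def intro: order_trans[OF add_mono]\<close>)
  have vm: "(\<lambda>z. vmin g (snd (snd (snd z)))) \<in> borel_measurable Z" by measurable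
  have AE_v: "AE z in sample_law \<pi> h. 0 \<le> vmin g (snd (snd (snd z))) \<and> vmin g (snd (snd (snd z))) \<le> 1"
    using vmin_bounds[OF g] by simp
  have "ennreal (\<integral>xa. bellman M h g xa \<partial>occ M \<pi> h) = (\<integral>\<^sup>+xa. ennreal (bellman M h g xa) \<partial>occ M \<pi> h)"
    using T by (intro integral_bounded(2)[OF O T(1), of 1] AE_I2) auto
  also have "\<dots> = (\<integral>\<^sup>+xa. \<integral>\<^sup>+z. ennreal (target g z) \<partial>outcome M h xa \<partial>occ M \<pi> h)"
    unfolding bellman_eq_outcome[OF h \<open>g \<in> _\<close>]
    by (intro nn_integral_cong integral_bounded(2)[OF outcome_space[OF h] _ AE_o]) measurable
  also have "\<dots> = (\<integral>\<^sup>+z. ennreal (target g z) \<partial>sample_law \<pi> h)"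
    unfolding sample_law_eq_bind[OF \<pi> h] by (rule nn_integral_bind[OF _ K, symmetric]) measurable
  also have "\<dots> = ennreal (\<integral>z. target g z \<partial>sample_law \<pi> h)"
    by (rule integral_bounded(2)[OF S _ AE_s, symmetric]) measurable
  finally have "(\<integral>xa. bellman M h g xa \<partial>occ M \<pi> h) = (\<integral>z. target g z \<partial>sample_law \<pi> h)"
    using T integral_bounded(3)[OF S _ AE_s]
    by (subst (asm) ennreal_inj) (auto intro!: integral_nonneg_AE)
  also have "\<dots> = expected_cost \<pi> h + (\<integral>z. vmin g (snd (snd (snd z))) \<partial>sample_law \<pi> h)"
    unfolding target_def expected_cost_def
    by (intro Bochner_Integration.integral_add integral_bounded(1)[OF S measurable_sample_cost AE_c]
      integral_bounded(1)[OF S vm AE_v])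
  finally show ?thesis .
qed

lemma integral_fst_occ:
  assumes \<pi>: "is_policy M \<pi>" and h: "h \<in> {1..hor M}" and [measurable]: "v \<in> borel_measurable X"
  shows "(\<integral>xa. v (fst xa) \<partial>occ M \<pi> h) = (\<integral>x. (v x :: real) \<partial>occ_obs M \<pi> h)"
proof -
  note S = prob_algebraD[OF sample_law_space[OF \<pi> h]]
  have [measurable]: "fst \<in> obs_act M \<rightarrow>\<^sub>M X" unfolding obs_act_def by measurable
  have m: "fst \<in> sample_law \<pi> h \<rightarrow>\<^sub>M X" "(\<lambda>z. (fst z, fst (snd z))) \<in> sample_law \<pi> h \<rightarrow>\<^sub>M obs_act M"
    by (simp_all add: measurable_cong_sets[OF S(2) refl])
  show ?thesis
    unfolding occ_eq[OF h \<pi>] occ_obs_eq[OF h \<pi>]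
    by (subst (1 2) integral_distr) (auto simp: m)
qed

lemma is_policy_det:
  assumes "\<And>h. h \<in> {1..hor M} \<Longrightarrow> p h \<in> X \<rightarrow>\<^sub>M count_space UNIV"
  shows "is_policy M (det p)"
  unfolding is_policy_def det_def[abs_def]
  using assms by (auto intro!: measurable_compose[OF _ measurable_return_prob_space])

text \<open>Here greediness acts: the chosen action attains the minimum, so what is an inequality
  for a general policy becomes an equality.\<close>

lemma integral_greedy_occ:
  assumes p: "is_policy M (det p)" and h: "h \<in> {1..hor M}" and [measurable]: "g \<in> borel_measurable (obs_act M)"
    and g: "\<And>xa. 0 \<le> g xa \<and> g xa \<le> 1"
    and opt: "\<And>x. g (x, p h x) = vmin g x"
  shows "(\<integral>xa. g xa \<partial>occ M (det p) h) = (\<integral>x. vmin g x \<partial>occ_obs M (det p) h)"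
proof -
  obtain j where j: "h = Suc j" using h by (cases h) auto
  note h' = h[unfolded j]
  note O = occ_space[OF p h']
  have R: "rollout M (det p) j \<in> space (prob_algebra (Traj j))" using h' by (intro rollout_space p) auto
  have "ennreal (\<integral>xa. g xa \<partial>occ M (det p) h) = (\<integral>\<^sup>+xa. g xa \<partial>occ M (det p) (Suc j))"
    unfolding j using g by (intro integral_bounded(2)[OF O(1), of _ 1] AE_I2) auto
  also have "\<dots> = (\<integral>\<^sup>+\<tau>. vmin g (next_obs M j \<tau>) \<partial>rollout M (det p) j)"
    using opt by (subst nn_integral_occ[OF p h']) (simp_all add: det_def nn_integral_return j)
  also have "\<dots> = (\<integral>\<^sup>+x. vmin g x \<partial>occ_obs M (det p) (Suc j))"
    unfolding occ_obs_Suc_rollout[OF p h']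
    by (rule nn_integral_distr[symmetric]) (simp_all add: measurable_law[OF R])
  also have "\<dots> = ennreal (\<integral>x. vmin g x \<partial>occ_obs M (det p) h)"
    unfolding j using vmin_bounds[OF g] by (intro integral_bounded(2)[OF O(2), of _ 1, symmetric] AE_I2) auto
  finally show ?thesis
    using g vmin_bounds[OF g] by (subst (asm) ennreal_inj) (auto intro!: integral_nonneg_AE)
qed

end

section \<open>Value differences for a Bellman complete class\<close>

locale bellman_complete_class = markov_decision_process M
  for M :: "('x, 'a::finite) mdp" +
  fixes F :: "('x, 'a) qtuple set" and l :: loss
  assumes fun_class: "function_class M F"
    and consecutive: "consecutive_closed M F"
    and complete: "bellman_complete M F"
    and targets: "l = Bce \<Longrightarrow> unit_targets M F"
begin

lemma component_Suc_horizon: "component F (Suc (hor M)) = {\<lambda>_. 0}"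
  using fun_class by (auto simp: component_def function_class_def image_constant_conv)

lemma component_bounds:
  assumes "h \<in> {1..Suc (hor M)}" "g \<in> component F h"
  shows "g \<in> borel_measurable (obs_act M)" "\<And>xa. 0 \<le> g xa \<and> g xa \<le> 1"
proof -
  obtain f where f: "f \<in> F" "g = f h" using assms by (auto simp: component_def)
  show "g \<in> borel_measurable (obs_act M)" "\<And>xa. 0 \<le> g xa \<and> g xa \<le> 1"
  proof (atomize (full), cases "h \<in> {1..hor M}")
    case True
    then have "g \<in> borel_measurable (obs_act M)" "range g \<subseteq> {0..1}"
      using f fun_class unfolding function_class_def by blast+
    moreover have "g xa \<in> range g" for xa by simp
    ultimately show "g \<in> borel_measurable (obs_act M) \<and> (\<forall>xa. 0 \<le> g xa \<and> g xa \<le> 1)"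
      by (metis atLeastAtMost_iff subsetD)
  next
    case False
    then have "h = Suc (hor M)" using assms by auto
    then have "g = (\<lambda>_. 0)" using component_Suc_horizon assms by auto
    then show "g \<in> borel_measurable (obs_act M) \<and> (\<forall>xa. 0 \<le> g xa \<and> g xa \<le> 1)" by auto
  qed
qed

lemma bellman_component:
  "h \<in> {1..hor M} \<Longrightarrow> g \<in> component F (Suc h) \<Longrightarrow> bellman M h g \<in> component F h"
  using complete unfolding bellman_complete_def by blast

text \<open>A regression tuple takes its components from different members of \<open>F\<close>, so
  it need not lie in \<open>F\<close>. Step \<open>H + 1\<close> is included to force the zero
  function there.\<close>

definition admissible :: "('x, 'a) qtuple \<Rightarrow> bool" where
  "admissible f \<longleftrightarrow> (\<forall>h\<in>{1..Suc (hor M)}. f h \<in> component F h)"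

lemma admissibleD:
  assumes f: "admissible f" and h: "h \<in> {1..hor M}"
  shows "f h \<in> borel_measurable (obs_act M)" "\<And>xa. 0 \<le> f h xa \<and> f h xa \<le> 1"
    "f (Suc h) \<in> borel_measurable (obs_act M)" "\<And>xa. 0 \<le> f (Suc h) xa \<and> f (Suc h) xa \<le> 1"
    "bellman M h (f (Suc h)) \<in> borel_measurable (obs_act M)"
    "\<And>xa. 0 \<le> bellman M h (f (Suc h)) xa \<and> bellman M h (f (Suc h)) xa \<le> 1"
proof -
  have c: "f h \<in> component F h" "f (Suc h) \<in> component F (Suc h)" and h': "h \<in> {1..Suc (hor M)}" "Suc h \<in> {1..Suc (hor M)}"
    using f h by (auto simp: admissible_def)
  show "f h \<in> borel_measurable (obs_act M)" "\<And>xa. 0 \<le> f h xa \<and> f h xa \<le> 1"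
    by (rule component_bounds[OF h'(1) c(1)])+
  show "f (Suc h) \<in> borel_measurable (obs_act M)" "\<And>xa. 0 \<le> f (Suc h) xa \<and> f (Suc h) xa \<le> 1"
    by (rule component_bounds[OF h'(2) c(2)])+
  show "bellman M h (f (Suc h)) \<in> borel_measurable (obs_act M)"
    "\<And>xa. 0 \<le> bellman M h (f (Suc h)) xa \<and> bellman M h (f (Suc h)) xa \<le> 1"
    by (rule component_bounds[OF h'(1) bellman_component[OF h c(2)]])+
qed

abbreviation "backup f h \<equiv> bellman M h (f (Suc h))"
abbreviation "residual_at f h xa \<equiv> residual l (f h xa) (backup f h xa)"

definition gap :: "('x, 'a) policy \<Rightarrow> ('x, 'a) qtuple \<Rightarrow> nat \<Rightarrow> real" where
  "gap \<pi> f h = (\<integral>xa. \<bar>f h xa - backup f h xa\<bar> \<partial>occ M \<pi> h)"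

definition mean_residual :: "('x \<times> 'a) measure \<Rightarrow> ('x, 'a) qtuple \<Rightarrow> nat \<Rightarrow> real" where
  "mean_residual \<mu> f h = (\<integral>xa. residual_at f h xa \<partial>\<mu>)"

lemma gap_nonneg: "0 \<le> gap \<pi> f h"
  unfolding gap_def by (rule integral_nonneg_AE) simp

lemma residual_integrable:
  assumes f: "admissible f" and h: "h \<in> {1..hor M}" and \<mu>: "\<mu> \<in> space (prob_algebra (obs_act M))"
  shows "integrable \<mu> (\<lambda>xa. residual_at f h xa)"
    "0 \<le> mean_residual \<mu> f h" "mean_residual \<mu> f h \<le> 1"
    "ennreal (mean_residual \<mu> f h) = (\<integral>\<^sup>+xa. residual_at f h xa \<partial>\<mu>)"
proof -
  note [measurable] = admissibleD(1,5)[OF f h]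
  have m: "(\<lambda>xa. residual_at f h xa) \<in> borel_measurable (obs_act M)"
    by measurable
  have b: "AE xa in \<mu>. 0 \<le> residual_at f h xa \<and>
      residual_at f h xa \<le> 1"
    using residual_bounds admissibleD(2,6)[OF f h] by (intro AE_I2) auto
  from integral_bounded[OF \<mu> m b]
  show "integrable \<mu> (\<lambda>xa. residual_at f h xa)"
    "0 \<le> mean_residual \<mu> f h" "mean_residual \<mu> f h \<le> 1"
    "ennreal (mean_residual \<mu> f h) = (\<integral>\<^sup>+xa. residual_at f h xa \<partial>\<mu>)"
    unfolding mean_residual_def by simp_all
qed

definition q_mean :: "('x, 'a) policy \<Rightarrow> ('x, 'a) qtuple \<Rightarrow> nat \<Rightarrow> real" where
  "q_mean \<pi> f h = (\<integral>xa. f h xa \<partial>occ M \<pi> h)"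

text \<open>Trajectories have no coordinate \<open>H + 1\<close>, so \<open>occ_obs\<close> says
  nothing there; the value \<open>0\<close> agrees with \<open>f\<close> vanishing beyond the
  horizon.\<close>

definition v_mean :: "('x, 'a) policy \<Rightarrow> ('x, 'a) qtuple \<Rightarrow> nat \<Rightarrow> real" where
  "v_mean \<pi> f h = (if h \<le> hor M then \<integral>x. vmin (f h) x \<partial>occ_obs M \<pi> h else 0)"

text \<open>The Bellman image averages over the occupancy to the expected cost plus the next
  \<open>v_mean\<close>, so the first difference is the signed mean residual, at most
  \<open>gap\<close> in size. Nothing ties \<open>\<pi>\<close> to \<open>f\<close>, which lets one
  tuple be examined along both the executed and the comparator policy.\<close>

lemma telescope:
  assumes \<pi>: "is_policy M \<pi>" and f: "admissible f"
  shows "h \<in> {1..hor M} \<Longrightarrow> \<bar>q_mean \<pi> f h - expected_cost \<pi> h - v_mean \<pi> f (Suc h)\<bar> \<le> gap \<pi> f h"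
    and "h \<in> {1..hor M} \<Longrightarrow> v_mean \<pi> f h \<le> q_mean \<pi> f h"
    and "v_mean \<pi> f 1 = vmin (f 1) (init M)"
proof -
  assume h: "h \<in> {1..hor M}"
  note O = occ_space[OF \<pi> h] and S = sample_law_space[OF \<pi> h]
  note a = admissibleD[OF f h] and [measurable] = admissibleD(1,3,5)[OF f h]
  have int: "integrable (occ M \<pi> h) (f h)" "integrable (occ M \<pi> h) (backup f h)"
    using a by (auto intro!: integral_bounded(1)[OF O(1), of _ 1])
  have "(\<integral>z. vmin (f (Suc h)) (snd (snd (snd z))) \<partial>sample_law \<pi> h) = v_mean \<pi> f (Suc h)"
  proof (cases "h = hor M")
    case True
    then have "f (Suc h) = (\<lambda>_. 0)" using f component_Suc_horizon by (auto simp: admissible_def)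
    then have "vmin (f (Suc h)) = (\<lambda>_. 0)" by (simp add: vmin_def[abs_def])
    then show ?thesis using True by (simp add: v_mean_def)
  next
    case False
    then have h': "h \<in> {1..<hor M}" using h by auto
    then show ?thesis using h by (simp add: v_mean_def occ_obs_Suc[OF \<pi>])
  qed
  then have "q_mean \<pi> f h - expected_cost \<pi> h - v_mean \<pi> f (Suc h) = q_mean \<pi> f h - (\<integral>xa. backup f h xa \<partial>occ M \<pi> h)"
    using integral_bellman_occ[OF \<pi> h a(3,4,5,6)] by simp
  also have "\<dots> = (\<integral>xa. f h xa - backup f h xa \<partial>occ M \<pi> h)"
    using int by (simp add: q_mean_def)
  also have "\<bar>\<dots>\<bar> \<le> gap \<pi> f h" unfolding gap_def by (rule integral_abs_bound)
  finally show "\<bar>q_mean \<pi> f h - expected_cost \<pi> h - v_mean \<pi> f (Suc h)\<bar> \<le> gap \<pi> f h" .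
  have "v_mean \<pi> f h = (\<integral>xa. vmin (f h) (fst xa) \<partial>occ M \<pi> h)"
    using h by (simp add: v_mean_def integral_fst_occ[OF \<pi> h])
  also have "\<dots> \<le> q_mean \<pi> f h"
    unfolding q_mean_def
  proof (rule integral_mono)
    have [measurable]: "fst \<in> obs_act M \<rightarrow>\<^sub>M X" unfolding obs_act_def by measurable
    show "integrable (occ M \<pi> h) (\<lambda>xa. vmin (f h) (fst xa))"
      using vmin_bounds[OF a(2)] by (intro integral_bounded(1)[OF O(1), of _ 1]) auto
    show "vmin (f h) (fst xa) \<le> f h xa" for xa using vmin_le[of "f h" "fst xa" "snd xa"] by simp
  qed (use int in simp)
  finally show "v_mean \<pi> f h \<le> q_mean \<pi> f h" .
next
  have h: "1 \<in> {1..hor M}" using horizon_pos by simp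
  note [measurable] = admissibleD(1)[OF f h]
  show "v_mean \<pi> f 1 = vmin (f 1) (init M)"
    using horizon_pos by (simp add: v_mean_def occ_obs_1[OF \<pi>] integral_return)
qed

lemma sum_telescope_from:
  fixes m :: "nat \<Rightarrow> real"
  assumes "h \<le> Suc H"
  shows "(\<Sum>j=h..H. m j - m (Suc j)) = m h - m (Suc H)"
  using sum_Suc_diff[of h H "\<lambda>j. - m j"] assms by (simp add: algebra_simps)

text \<open>Both claims telescope the decrease of \<open>v_mean\<close> against cost plus gap. The
  second starts at an intermediate step and extends the sum to all steps, which is safe because
  expected costs and gaps are nonnegative; it supplies the control of the mean estimate needed for
  the cross entropy.\<close>

lemma value_bounds:
  assumes \<pi>: "is_policy M \<pi>" and f: "admissible f"
  shows "vmin (f 1) (init M) - policy_value M \<pi> \<le> (\<Sum>h=1..hor M. gap \<pi> f h)"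
    and "h \<in> {1..hor M} \<Longrightarrow> q_mean \<pi> f h \<le> policy_value M \<pi> + (\<Sum>h=1..hor M. gap \<pi> f h)"
proof -
  let ?m = "v_mean \<pi> f"
  note t = telescope[OF \<pi> f]
  have step: "?m h - ?m (Suc h) \<le> expected_cost \<pi> h + gap \<pi> f h"
    and step': "q_mean \<pi> f h \<le> expected_cost \<pi> h + gap \<pi> f h + ?m (Suc h)" if "h \<in> {1..hor M}" for h
    using t(1,2)[OF that] by linarith+
  have m: "?m h \<le> (\<Sum>j=h..hor M. expected_cost \<pi> j + gap \<pi> f j)" if "h \<in> {1..Suc (hor M)}" for h
  proof -
    have "(\<Sum>j=h..hor M. ?m j - ?m (Suc j)) \<le> (\<Sum>j=h..hor M. expected_cost \<pi> j + gap \<pi> f j)"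
      using that by (intro sum_mono step) auto
    moreover have "?m (Suc (hor M)) = 0" by (simp add: v_mean_def)
    ultimately show ?thesis using sum_telescope_from[of h "hor M" ?m] that by simp
  qed
  show "vmin (f 1) (init M) - policy_value M \<pi> \<le> (\<Sum>h=1..hor M. gap \<pi> f h)"
    using m[of 1] t(3) by (simp add: policy_value_eq[OF \<pi>] sum.distrib)
  assume h: "h \<in> {1..hor M}"
  have "q_mean \<pi> f h \<le> (expected_cost \<pi> h + gap \<pi> f h) + (\<Sum>j=Suc h..hor M. expected_cost \<pi> j + gap \<pi> f j)"
    using step'[OF h] m[of "Suc h"] h by auto
  also have "\<dots> = (\<Sum>j=h..hor M. expected_cost \<pi> j + gap \<pi> f j)"
    using h by (subst sum.atLeast_Suc_atMost[of h]) auto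
  also have "\<dots> \<le> (\<Sum>j=1..hor M. expected_cost \<pi> j + gap \<pi> f j)"
    using h expected_cost_nonneg[OF \<pi>] gap_nonneg by (intro sum_mono2) (auto intro!: add_nonneg_nonneg)
  finally show "q_mean \<pi> f h \<le> policy_value M \<pi> + (\<Sum>h=1..hor M. gap \<pi> f h)"
    by (simp add: policy_value_eq[OF \<pi>] sum.distrib q_mean_def)
qed

text \<open>The opposite direction to \<open>value_bounds\<close>, resting on
  \<open>q_mean = v_mean\<close> for greedy actions. Chaining the two through
  \<open>vmin (f 1) (init M)\<close> compares two policies without reference to an optimal
  value.\<close>

lemma greedy_value_bound:
  assumes p: "is_policy M (det p)" and f: "admissible f" and g: "greedy M f p"
  shows "policy_value M (det p) - vmin (f 1) (init M) \<le> (\<Sum>h=1..hor M. gap (det p) f h)"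
proof -
  let ?m = "v_mean (det p) f"
  note t = telescope[OF p f]
  have eq: "q_mean (det p) f h = ?m h" if h: "h \<in> {1..hor M}" for h
  proof -
    have "f h (x, p h x) = vmin (f h) x" for x
      using g h by (intro vmin_eqI[symmetric]) (auto simp: greedy_def is_arg_min_linorder)
    then show ?thesis
      using integral_greedy_occ[OF p h admissibleD(1,2)[OF f h]] h by (simp add: q_mean_def v_mean_def)
  qed
  have "(\<Sum>h=1..hor M. expected_cost (det p) h) \<le> (\<Sum>h=1..hor M. (?m h - ?m (Suc h)) + gap (det p) f h)"
  proof (rule sum_mono)
    fix h assume "h \<in> {1..hor M}"
    then show "expected_cost (det p) h \<le> (?m h - ?m (Suc h)) + gap (det p) f h"
      using t(1)[of h] eq[of h] by linarith
  qed
  moreover have "?m (Suc (hor M)) = 0" by (simp add: v_mean_def)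
  ultimately show ?thesis
    using sum_telescope_from[of 1 "hor M" ?m] t(3) by (simp add: policy_value_eq[OF p] sum.distrib)
qed

lemma gap_le_sq:
  assumes "l = Sq" and \<pi>: "is_policy M \<pi>" and f: "admissible f" and h: "h \<in> {1..hor M}"
  shows "gap \<pi> f h \<le> sqrt (mean_residual (occ M \<pi> h) f h)"
proof -
  interpret O: prob_space "occ M \<pi> h" using prob_algebraD(1)[OF occ_space(1)[OF \<pi> h]] .
  have "gap \<pi> f h = (\<integral>xa. sqrt (residual_at f h xa * 1) \<partial>occ M \<pi> h)"
    by (simp add: gap_def assms(1))
  also have "\<dots> \<le> sqrt (mean_residual (occ M \<pi> h) f h * (\<integral>xa. 1 \<partial>occ M \<pi> h))"
    unfolding mean_residual_def
    using residual_integrable(1)[OF f h occ_space(1)[OF \<pi> h]] residual_bounds(1) admissibleD(2,6)[OF f h]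
    by (intro O.integral_sqrt_mult_le) auto
  finally show ?thesis using O.prob_space by simp
qed

lemma gap_le_bce:
  assumes "l = Bce" and \<pi>: "is_policy M \<pi>" and f: "admissible f" and h: "h \<in> {1..hor M}"
  shows "gap \<pi> f h \<le> 6 * sqrt (mean_residual (occ M \<pi> h) f h * q_mean \<pi> f h)
    + 4 * mean_residual (occ M \<pi> h) f h"
proof -
  note O' = occ_space(1)[OF \<pi> h] and a = admissibleD[OF f h]
  interpret O: prob_space "occ M \<pi> h" using prob_algebraD(1)[OF O'] .
  let ?r = "\<lambda>xa. residual_at f h xa"
  note r = residual_integrable[OF f h O']
  have r_b: "0 \<le> ?r xa" "?r xa \<le> 1" for xa using residual_bounds a(2,6) by auto
  note [measurable] = a(1,5)
  have m: "(\<lambda>xa. sqrt (?r xa * f h xa)) \<in> borel_measurable (obs_act M)" by measurable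
  have i: "integrable (occ M \<pi> h) (\<lambda>xa. sqrt (?r xa * f h xa))"
    using r_b a(2) by (intro integral_bounded(1)[OF O' m, of 1] AE_I2) (auto simp: mult_le_one)
  have i': "integrable (occ M \<pi> h) (\<lambda>xa. \<bar>f h xa - backup f h xa\<bar>)"
  proof (intro integral_bounded(1)[OF O', of _ 1] AE_I2 conjI)
    show "\<bar>f h xa - backup f h xa\<bar> \<le> 1" for xa using a(2)[of xa] a(6)[of xa] by linarith
  qed simp_all
  have "gap \<pi> f h \<le> (\<integral>xa. 6 * sqrt (?r xa * f h xa) + 4 * ?r xa \<partial>occ M \<pi> h)"
    unfolding gap_def
  proof (rule integral_mono)
    show "\<bar>f h xa - backup f h xa\<bar> \<le> 6 * sqrt (?r xa * f h xa) + 4 * ?r xa" for xa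
      unfolding assms(1) using a(2,6) by (intro abs_diff_le_bce) auto
  qed (use i i' r in simp_all)
  also have "\<dots> = 6 * (\<integral>xa. sqrt (?r xa * f h xa) \<partial>occ M \<pi> h) + 4 * mean_residual (occ M \<pi> h) f h"
    using i r by (simp add: mean_residual_def)
  also have "(\<integral>xa. sqrt (?r xa * f h xa) \<partial>occ M \<pi> h) \<le> sqrt (mean_residual (occ M \<pi> h) f h * q_mean \<pi> f h)"
    unfolding mean_residual_def q_mean_def
    using r r_b a(1,2) by (intro O.integral_sqrt_mult_le integral_bounded(1)[OF O', of _ 1]) auto
  finally show ?thesis by simp
qed

end

section \<open>The interaction as a kernel process\<close>

context markov_decision_process
begin

text \<open>The law of the pair at which step \<open>h\<close> is sampled in one round. In
  uniform-action mode it differs from the occupancy, and the confidence bounds speak about this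
  law.\<close>

definition online_query :: "bool \<Rightarrow> ('x, 'a) policy \<Rightarrow> nat \<Rightarrow> ('x \<times> 'a) measure" where
  "online_query ua \<pi> h = (if ua then occ_obs M \<pi> h \<Otimes>\<^sub>M uniform_count_measure UNIV else occ M \<pi> h)"

lemma uniform_space: "(uniform_count_measure UNIV :: 'a measure) \<in> space (prob_algebra (count_space UNIV))"
  by (simp add: space_prob_algebra prob_space_uniform_count_measure sets_uniform_count_measure)

lemma parametric_kernels:
  assumes \<pi>: "\<And>h. h \<in> {1..hor M} \<Longrightarrow> (\<lambda>(D, x). \<pi> D h x) \<in> L \<Otimes>\<^sub>M X \<rightarrow>\<^sub>M prob_algebra (count_space UNIV)"
    and h: "h \<in> {1..hor M}"
  shows "(\<lambda>D. occ M (\<pi> D) h) \<in> L \<rightarrow>\<^sub>M prob_algebra (obs_act M)"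
    and "(\<lambda>D. occ_obs M (\<pi> D) h) \<in> L \<rightarrow>\<^sub>M prob_algebra X"
    and "(\<lambda>D. online_query ua (\<pi> D) h) \<in> L \<rightarrow>\<^sub>M prob_algebra (obs_act M)"
proof -
  have R: "(\<lambda>D. rollout M (\<pi> D) (hor M)) \<in> L \<rightarrow>\<^sub>M prob_algebra (Traj (hor M))"
    using \<pi> by (rule measurable_rollout) simp_all
  note [measurable] = component_measurable[OF h]
  have [measurable]: "(\<lambda>\<tau>. (fst (\<tau> h), fst (snd (\<tau> h)))) \<in> Traj (hor M) \<rightarrow>\<^sub>M obs_act M"
    by (rule measurable_compose[OF component_measurable[OF h] measurable_coordinates(5)])
  show o: "(\<lambda>D. occ M (\<pi> D) h) \<in> L \<rightarrow>\<^sub>M prob_algebra (obs_act M)"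
    unfolding occ_def using R by (rule measurable_distr_prob_space2) measurable
  show x: "(\<lambda>D. occ_obs M (\<pi> D) h) \<in> L \<rightarrow>\<^sub>M prob_algebra X"
    unfolding occ_obs_def using R by (rule measurable_distr_prob_space2) measurable
  have "(\<lambda>D. occ_obs M (\<pi> D) h \<Otimes>\<^sub>M uniform_count_measure UNIV) \<in> L \<rightarrow>\<^sub>M prob_algebra (obs_act M)"
    unfolding obs_act_def using x uniform_space by (intro measurable_pair_prob) simp_all
  with o show "(\<lambda>D. online_query ua (\<pi> D) h) \<in> L \<rightarrow>\<^sub>M prob_algebra (obs_act M)"
    by (cases ua) (simp_all add: online_query_def)
qed

lemma online_query_space:
  assumes "is_policy M \<pi>" "h \<in> {1..hor M}"
  shows "online_query ua \<pi> h \<in> space (prob_algebra (obs_act M))"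
proof -
  have "(\<lambda>_::unit. online_query ua \<pi> h) \<in> count_space UNIV \<rightarrow>\<^sub>M prob_algebra (obs_act M)"
    using assms by (intro parametric_kernels(3) constant_policy)
  from measurable_space[OF this] show ?thesis by simp
qed

lemma measurable_outcome_pair:
  assumes h: "h \<in> {1..hor M}"
  shows "(\<lambda>x. uniform_count_measure UNIV \<bind> (\<lambda>a. outcome M h (x, a))) \<in> X \<rightarrow>\<^sub>M prob_algebra Z"
proof -
  have "(\<lambda>(x, a). outcome M h (x, a)) \<in> X \<Otimes>\<^sub>M count_space UNIV \<rightarrow>\<^sub>M prob_algebra Z"
    using measurable_outcome[OF h] by (simp add: obs_act_def)
  then show ?thesis
    using uniform_space by (intro measurable_bind_prob_space2[where N="count_space UNIV"]) simp_all
qed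

lemma measurable_collect:
  assumes \<pi>: "\<And>h. h \<in> {1..hor M} \<Longrightarrow> (\<lambda>(D, x). \<pi> D h x) \<in> L \<Otimes>\<^sub>M X \<rightarrow>\<^sub>M prob_algebra (count_space UNIV)"
  shows "(\<lambda>D. collect M ua (\<pi> D)) \<in> L \<rightarrow>\<^sub>M prob_algebra (Traj (hor M))"
proof (cases ua)
  case True
  have "(\<lambda>D. occ_obs M (\<pi> D) h \<bind> (\<lambda>x. uniform_count_measure UNIV \<bind> (\<lambda>a. outcome M h (x, a))))
      \<in> L \<rightarrow>\<^sub>M prob_algebra Z" if "h \<in> {1..hor M}" for h
    using parametric_kernels(2)[OF \<pi> that] measurable_outcome_pair[OF that] by (rule measurable_bind_prob_space)
  then have "(\<lambda>D. Pi\<^sub>M {1..hor M} (\<lambda>h. occ_obs M (\<pi> D) h \<bind> (\<lambda>x. uniform_count_measure UNIV \<bind>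
      (\<lambda>a. outcome M h (x, a))))) \<in> L \<rightarrow>\<^sub>M prob_algebra (Traj (hor M))"
    by (intro measurable_PiM_prob_algebra) auto
  then show ?thesis using True by (simp add: collect_def)
next
  case False
  then show ?thesis
    unfolding collect_def using measurable_rollout[where \<pi>=\<pi>, OF \<pi> order.refl] by simp
qed

lemma nn_integral_outcome_measurable:
  assumes "h \<in> {1..hor M}" "g \<in> borel_measurable Z"
  shows "(\<lambda>xa. \<integral>\<^sup>+z. g z \<partial>outcome M h xa) \<in> borel_measurable (obs_act M)"
  by (rule measurable_compose[OF measurable_prob_algebraD[OF measurable_outcome[OF assms(1)]]
        nn_integral_measurable_subprob_algebra[OF assms(2)]])

text \<open>Both modes share the form of the marginal at a single step: a query law followed by the
  outcome kernel. The joint laws differ, a path in one mode and independent steps in the other, but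
  each capital process reads the samples of one step only.\<close>

lemma nn_integral_collect:
  assumes \<pi>: "is_policy M \<pi>" and h: "h \<in> {1..hor M}" and g [measurable]: "g \<in> borel_measurable Z"
  shows "(\<integral>\<^sup>+r. g (r h) \<partial>collect M ua \<pi>) = (\<integral>\<^sup>+xa. \<integral>\<^sup>+z. g z \<partial>outcome M h xa \<partial>online_query ua \<pi> h)"
proof (cases ua)
  case False
  note K = outcome_kernel[OF occ_space(1)[OF \<pi> h] h]
  show ?thesis
    using False nn_integral_sample_law_rollout[OF \<pi> h order.refl g] nn_integral_bind[OF g K]
    by (simp add: collect_def online_query_def sample_law_eq_bind[OF \<pi> h])
next
  case True
  let ?N = "\<lambda>h. occ_obs M \<pi> h \<bind> (\<lambda>x. uniform_count_measure UNIV \<bind> (\<lambda>a. outcome M h (x, a)))"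
  have N: "?N h \<in> space (prob_algebra Z)" if "h \<in> {1..hor M}" for h
    using prob_space_bind'[OF occ_space(2)[OF \<pi> that] measurable_outcome_pair[OF that]]
      sets_bind'[OF occ_space(2)[OF \<pi> that] measurable_outcome_pair[OF that]] by (simp add: space_prob_algebra)
  note N' = prob_algebraD[OF N]
  note U = prob_algebraD[OF uniform_space]
  have gN: "g \<in> borel_measurable (?N h)" by (simp add: measurable_cong_sets[OF N'(2)[OF h] refl])
  have m1: "(\<lambda>x. uniform_count_measure UNIV \<bind> (\<lambda>a. outcome M h (x, a))) \<in> occ_obs M \<pi> h \<rightarrow>\<^sub>M subprob_algebra Z"
    using measurable_prob_algebraD[OF measurable_outcome_pair[OF h]]
    by (simp add: measurable_law[OF occ_space(2)[OF \<pi> h]])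
  have m2: "(\<lambda>a. outcome M h (x, a)) \<in> uniform_count_measure UNIV \<rightarrow>\<^sub>M subprob_algebra Z" for x
  proof -
    have "(\<lambda>a. outcome M h (x, a)) \<in> count_space UNIV \<rightarrow>\<^sub>M subprob_algebra Z"
      using measurable_space[OF measurable_prob_algebraD[OF measurable_outcome[OF h]]] by simp
    then show ?thesis by (simp add: measurable_cong_sets[OF U(2) refl])
  qed
  have "(\<integral>\<^sup>+r. g (r h) \<partial>collect M ua \<pi>) = (\<integral>\<^sup>+z. g z \<partial>distr (Pi\<^sub>M {1..hor M} ?N) (?N h) (\<lambda>r. r h))"
    using True gN h by (subst nn_integral_distr) (auto simp: collect_def)
  also have "distr (Pi\<^sub>M {1..hor M} ?N) (?N h) (\<lambda>r. r h) = ?N h"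
    using N' h by (intro distr_PiM_component) auto
  also have "(\<integral>\<^sup>+z. g z \<partial>?N h) = (\<integral>\<^sup>+x. \<integral>\<^sup>+a. \<integral>\<^sup>+z. g z \<partial>outcome M h (x, a) \<partial>uniform_count_measure UNIV \<partial>occ_obs M \<pi> h)"
    by (subst nn_integral_bind[OF g m1], subst nn_integral_bind[OF g m2]) simp
  also have "\<dots> = (\<integral>\<^sup>+xa. \<integral>\<^sup>+z. g z \<partial>outcome M h xa \<partial>(occ_obs M \<pi> h \<Otimes>\<^sub>M uniform_count_measure UNIV))"
  proof (rule sigma_finite_measure.nn_integral_fst[where f="\<lambda>xa. \<integral>\<^sup>+z. g z \<partial>outcome M h xa"])
    show "sigma_finite_measure (uniform_count_measure UNIV :: 'a measure)"
      using U(1) by (rule prob_space_imp_sigma_finite)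
    have "sets (occ_obs M \<pi> h \<Otimes>\<^sub>M uniform_count_measure UNIV) = sets (obs_act M)"
      unfolding obs_act_def using prob_algebraD(2)[OF occ_space(2)[OF \<pi> h]] U(2) by (intro sets_pair_measure_cong)
    then show "(\<lambda>xa. \<integral>\<^sup>+z. g z \<partial>outcome M h xa) \<in> borel_measurable (occ_obs M \<pi> h \<Otimes>\<^sub>M uniform_count_measure UNIV)"
      using nn_integral_outcome_measurable[OF h g] by (simp cong: measurable_cong_sets)
  qed
  finally show ?thesis using True by (simp add: online_query_def)
qed

end

section \<open>The law of the interaction and a maximal inequality\<close>

locale hybrid_interaction = bellman_complete_class M F l
  for M :: "('x, 'a::finite) mdp" and F l +
  fixes ua :: bool and K :: nat and n :: "nat \<Rightarrow> nat" and \<nu> :: "nat \<Rightarrow> ('x \<times> 'a) measure"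
    and Doff :: "(nat \<Rightarrow> nat \<Rightarrow> ('x, 'a) sample) measure"
    and fit :: "nat \<Rightarrow> ('x, 'a) history \<Rightarrow> ('x, 'a) qtuple"
    and pol :: "nat \<Rightarrow> ('x, 'a) history \<Rightarrow> ('x, 'a) det_policy"
  assumes offline: "offline_law M \<nu> n Doff"
    and algorithm: "fitted_Q_iteration M F l n K fit pol"
begin

abbreviation "Hist \<equiv> historyM M n"
abbreviation "I \<equiv> interaction M ua n Doff pol"
abbreviation "new_round \<equiv> \<lambda>j D. collect M ua (det (pol (Suc j) D))"
abbreviation "append_round \<equiv> \<lambda>j D r. (fst D, (snd D)(Suc j := r))"

lemma measurable_pol:
  assumes "t \<in> {1..K}" "h \<in> {1..hor M}"
  shows "(\<lambda>(D, x). pol t D h x) \<in> Hist (t - 1) \<Otimes>\<^sub>M X \<rightarrow>\<^sub>M count_space UNIV"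
  using algorithm assms unfolding fitted_Q_iteration_def by blast

lemma measurable_det_pol:
  assumes "t \<in> {1..K}" "h \<in> {1..hor M}"
  shows "(\<lambda>(D, x). det (pol t D) h x) \<in> Hist (t - 1) \<Otimes>\<^sub>M X \<rightarrow>\<^sub>M prob_algebra (count_space UNIV)"
  using measurable_compose[OF measurable_pol[OF assms] measurable_return_prob_space]
  by (simp add: det_def split_beta')

lemma is_policy_pol:
  assumes "t \<in> {1..K}" "D \<in> space (Hist (t - 1))"
  shows "is_policy M (det (pol t D))"
  using measurable_Pair2[OF measurable_pol[OF assms(1)] assms(2)] by (intro is_policy_det) simp

lemma measurable_round:
  assumes "j < K"
  shows "new_round j \<in> Hist j \<rightarrow>\<^sub>M prob_algebra (Traj (hor M))"
  using measurable_det_pol[of "Suc j"] assms by (intro measurable_collect) auto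

lemma measurable_append_round:
  "(\<lambda>(D, r). append_round j D r) \<in> Hist j \<Otimes>\<^sub>M Traj (hor M) \<rightarrow>\<^sub>M Hist (Suc j)"
proof -
  have "(\<lambda>p. (snd (fst p))(Suc j := snd p)) \<in> Hist j \<Otimes>\<^sub>M Traj (hor M)
      \<rightarrow>\<^sub>M Pi\<^sub>M {1..Suc j} (\<lambda>_. Traj (hor M))"
    unfolding historyM_def by measurable
  then show ?thesis
    unfolding historyM_def[of M n "Suc j"] split_beta' by (intro measurable_Pair) (auto simp: historyM_def)
qed

lemma interaction_space: "j \<le> K \<Longrightarrow> I j \<in> space (prob_algebra (Hist j))"
proof (induction j)
  case 0
  have D: "Doff \<in> space (prob_algebra (offlineM M n))" using offline by (simp add: offline_law_def)
  have u: "(\<lambda>_. undefined) \<in> space (Pi\<^sub>M {1..0::nat} (\<lambda>_. Traj (hor M)))"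
    by (simp add: space_PiM One_nat_def)
  have "(\<lambda>\<omega>. (\<omega>, \<lambda>_. undefined)) \<in> offlineM M n \<rightarrow>\<^sub>M Hist 0"
    unfolding historyM_def using u by (intro measurable_Pair) auto
  then have "(\<lambda>\<omega>. (\<omega>, \<lambda>_. undefined)) \<in> Doff \<rightarrow>\<^sub>M Hist 0"
    by (simp add: measurable_law[OF D])
  then show ?case using prob_space.prob_space_distr[OF prob_algebraD(1)[OF D]] by (simp add: space_prob_algebra)
next
  case (Suc j)
  have "(\<lambda>D. distr (new_round j D) (Hist (Suc j)) (append_round j D)) \<in> Hist j \<rightarrow>\<^sub>M prob_algebra (Hist (Suc j))"
    using measurable_round[of j] measurable_append_round Suc.prems by (intro measurable_distr_prob_space2) auto
  from prob_space_bind'[OF Suc.IH this] sets_bind'[OF Suc.IH this] Suc.prems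
  show ?case by (simp add: space_prob_algebra)
qed

lemma nn_integral_interaction_Suc:
  assumes j: "j < K" and G [measurable]: "G \<in> borel_measurable (Hist (Suc j))"
  shows "(\<integral>\<^sup>+D. G D \<partial>I (Suc j)) = (\<integral>\<^sup>+D. \<integral>\<^sup>+r. G (append_round j D r) \<partial>new_round j D \<partial>I j)"
proof -
  have Ij: "I j \<in> space (prob_algebra (Hist j))" using j by (intro interaction_space) simp
  note Ij' = prob_algebraD[OF Ij]
  have k: "(\<lambda>D. distr (new_round j D) (Hist (Suc j)) (append_round j D)) \<in> Hist j \<rightarrow>\<^sub>M prob_algebra (Hist (Suc j))"
    using measurable_round[OF j] measurable_append_round by (rule measurable_distr_prob_space2)
  have "(\<integral>\<^sup>+D. G D \<partial>I (Suc j)) = (\<integral>\<^sup>+D. \<integral>\<^sup>+D'. G D' \<partial>distr (new_round j D) (Hist (Suc j)) (append_round j D) \<partial>I j)"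
    unfolding interaction.simps using measurable_prob_algebraD[OF k]
    by (intro nn_integral_bind[OF G]) (simp add: measurable_cong_sets[OF Ij'(2) refl])
  also have "\<dots> = (\<integral>\<^sup>+D. \<integral>\<^sup>+r. G (append_round j D r) \<partial>new_round j D \<partial>I j)"
  proof (rule nn_integral_cong)
    fix D assume "D \<in> space (I j)"
    then have D: "D \<in> space (Hist j)" using Ij' by simp
    have "sets (new_round j D) = sets (Traj (hor M))"
      using measurable_space[OF measurable_round[OF j] D] by (simp add: space_prob_algebra)
    then have "append_round j D \<in> new_round j D \<rightarrow>\<^sub>M Hist (Suc j)"
      using measurable_Pair2[OF measurable_append_round D] by (simp add: split_beta' cong: measurable_cong_sets)
    then show "(\<integral>\<^sup>+D'. G D' \<partial>distr (new_round j D) (Hist (Suc j)) (append_round j D)) = (\<integral>\<^sup>+r. G (append_round j D r) \<partial>new_round j D)"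
      by (rule nn_integral_distr) simp
  qed
  finally show ?thesis .
qed

text \<open>\<open>V\<close> is a supermartingale along the interaction; it is stopped once it exceeds \<open>a\<close>.\<close>

lemma maximal_inequality:
  fixes V :: "nat \<Rightarrow> ('x, 'a) history \<Rightarrow> ennreal" and a :: ennreal
  assumes V: "\<And>i j. i \<le> j \<Longrightarrow> j \<le> K \<Longrightarrow> V i \<in> borel_measurable (Hist j)"
    and start: "(\<integral>\<^sup>+D. V 0 D \<partial>I 0) \<le> 1"
    and past: "\<And>i j D r. i \<le> j \<Longrightarrow> V i (append_round j D r) = V i D"
    and step: "\<And>j D. j < K \<Longrightarrow> D \<in> space (Hist j) \<Longrightarrow> (\<integral>\<^sup>+r. V (Suc j) (append_round j D r) \<partial>new_round j D) \<le> V j D"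
  shows "a * emeasure (I K) {D \<in> space (Hist K). \<exists>i\<le>K. a \<le> V i D} \<le> 1"
proof -
  \<comment> \<open>After the threshold is reached \<open>T\<close> is the constant \<open>a\<close>
    rather than the value of \<open>V\<close> at that time; this suffices for the final Markov bound
    and avoids evaluating \<open>V\<close> at a random index.\<close>
  define T where "T j D = (if \<exists>i\<le>j. a \<le> V i D then a else V j D)" for j D
  have mA: "{D \<in> space (Hist j). \<exists>i\<le>j. a \<le> V i D} \<in> sets (Hist j)" if "j \<le> K" for j
  proof -
    have [measurable]: "V i \<in> borel_measurable (Hist j)" if "i \<in> {..j}" for i
      using V \<open>j \<le> K\<close> that by simp
    have "{D \<in> space (Hist j). \<exists>i\<in>{..j}. a \<le> V i D} \<in> sets (Hist j)"
      by measurable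
    then show ?thesis by (simp add: Bex_def)
  qed
  have mT: "T j \<in> borel_measurable (Hist j)" if "j \<le> K" for j
    unfolding T_def[abs_def] by (rule measurable_If[OF _ V[OF order.refl that] mA[OF that]]) simp
  have "(\<integral>\<^sup>+D. T j D \<partial>I j) \<le> 1" if "j \<le> K" for j
    using that
  proof (induction j)
    case 0
    have "(\<integral>\<^sup>+D. T 0 D \<partial>I 0) \<le> (\<integral>\<^sup>+D. V 0 D \<partial>I 0)"
      by (intro nn_integral_mono) (simp add: T_def)
    then show ?case using start by simp
  next
    case (Suc j)
    have j: "j < K" using Suc.prems by simp
    have "(\<integral>\<^sup>+D. T (Suc j) D \<partial>I (Suc j)) = (\<integral>\<^sup>+D. \<integral>\<^sup>+r. T (Suc j) (append_round j D r) \<partial>new_round j D \<partial>I j)"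
      using mT Suc.prems by (intro nn_integral_interaction_Suc[OF j])
    also have "\<dots> \<le> (\<integral>\<^sup>+D. T j D \<partial>I j)"
    proof (rule nn_integral_mono)
      fix D assume "D \<in> space (I j)"
      then have D: "D \<in> space (Hist j)" using prob_algebraD(3)[OF interaction_space[of j]] j by simp
      have P: "prob_space (new_round j D)"
        using measurable_space[OF measurable_round[OF j] D] by (simp add: space_prob_algebra)
      show "(\<integral>\<^sup>+r. T (Suc j) (append_round j D r) \<partial>new_round j D) \<le> T j D"
      proof (cases "\<exists>i\<le>j. a \<le> V i D")
        case True
        then obtain i where i: "i \<le> j" "a \<le> V i D" by blast
        have "\<exists>i\<le>Suc j. a \<le> V i (append_round j D r)" for r
          using past[OF i(1), of D r] i by (intro exI[of _ i]) simp
        then have "T (Suc j) (append_round j D r) = a" for r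
          unfolding T_def by simp
        then show ?thesis using True prob_space.emeasure_space_1[OF P] by (simp add: T_def)
      next
        case False
        have "T (Suc j) (append_round j D r) \<le> V (Suc j) (append_round j D r)" for r
          using False past by (auto simp: T_def le_Suc_eq)
        then have "(\<integral>\<^sup>+r. T (Suc j) (append_round j D r) \<partial>new_round j D) \<le> (\<integral>\<^sup>+r. V (Suc j) (append_round j D r) \<partial>new_round j D)"
          by (intro nn_integral_mono)
        also have "\<dots> \<le> V j D" by (rule step[OF j D])
        also have "V j D = T j D" unfolding T_def using False by (rule if_not_P[symmetric])
        finally show ?thesis .
      qed
    qed
    also have "\<dots> \<le> 1" using Suc by simp
    finally show ?case .
  qed
  then have T: "(\<integral>\<^sup>+D. T K D \<partial>I K) \<le> 1" by simp
  let ?A = "{D \<in> space (Hist K). \<exists>i\<le>K. a \<le> V i D}"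
  note IK = prob_algebraD[OF interaction_space[OF order.refl]]
  have A: "?A \<in> sets (I K)" unfolding IK(2) by (rule mA) simp
  have "a * emeasure (I K) ?A = (\<integral>\<^sup>+D. a * indicator ?A D \<partial>I K)"
    by (rule nn_integral_cmult_indicator[OF A, symmetric])
  also have "\<dots> \<le> (\<integral>\<^sup>+D. T K D \<partial>I K)"
  proof (rule nn_integral_mono)
    show "a * indicator ?A D \<le> T K D" for D
    proof (cases "D \<in> ?A")
      case True
      then have "\<exists>i\<le>K. a \<le> V i D" by blast
      then have "T K D = a" unfolding T_def by (rule if_P)
      then show ?thesis using True by (simp only: indicator_simps mult_1_right order.refl)
    next
      case False
      then have "indicator ?A D = (0 :: ennreal)" by (rule indicator_simps(2))
      then show ?thesis by (simp only: mult_zero_right zero_le)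
    qed
  qed
  finally show ?thesis using T by simp
qed

end

section \<open>The compensated product of weights\<close>

context bellman_complete_class
begin

definition weight :: "('x, 'a) qtuple \<Rightarrow> nat \<Rightarrow> ('x, 'a) sample \<Rightarrow> ennreal" where
  "weight f h z = ennreal (excess_weight l (f h (fst z, fst (snd z)))
     (backup f h (fst z, fst (snd z))) (target (f (Suc h)) z))"

text \<open>Infinite on a flawed sample, so a finite total certifies that no sample is
  flawed.\<close>

definition penalty :: "('x, 'a) qtuple \<Rightarrow> nat \<Rightarrow> ('x, 'a) sample \<Rightarrow> ennreal" where
  "penalty f h z = (if flawed l (backup f h (fst z, fst (snd z))) (target (f (Suc h)) z) then top else 0)"

definition rate :: "('x, 'a) qtuple \<Rightarrow> nat \<Rightarrow> ('x \<times> 'a) measure \<Rightarrow> real" where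
  "rate f h \<mu> = mean_residual \<mu> f h / slack l"

lemma admissible_class: "f \<in> F \<Longrightarrow> admissible f"
  by (auto simp: admissible_def component_def)

lemma measurable_weight [measurable]:
  assumes f: "admissible f" and h: "h \<in> {1..hor M}"
  shows "weight f h \<in> borel_measurable Z" "penalty f h \<in> borel_measurable Z"
proof -
  note [measurable] = admissibleD(1,3,5)[OF f h]
  have [measurable]: "(\<lambda>z. f h (fst z, fst (snd z))) \<in> borel_measurable Z"
    "(\<lambda>z. backup f h (fst z, fst (snd z))) \<in> borel_measurable Z"
    by (rule measurable_compose[OF measurable_coordinates(5)]; measurable)+
  show "weight f h \<in> borel_measurable Z"
    unfolding weight_def[abs_def] by measurable
  show "penalty f h \<in> borel_measurable Z"
    unfolding penalty_def[abs_def] by measurable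
qed

lemma target_range:
  assumes f: "admissible f" and h: "h \<in> {1..hor M}"
  shows "AE p in cost_trans h xa. fst p + vmin (f (Suc h)) (snd p) \<in> {0..max_target l}"
proof (cases l)
  case Sq
  have v: "0 \<le> vmin (f (Suc h)) x \<and> vmin (f (Suc h)) x \<le> 1" for x
    using vmin_bounds admissibleD(4)[OF f h] by blast
  show ?thesis using cost_AE_pair[OF h, of xa]
  proof eventually_elim
    case (elim p)
    then show ?case using v[of "snd p"] Sq by auto
  qed
next
  case Bce
  have "f (Suc h) \<in> component F (Suc h)" using f h by (auto simp: admissible_def)
  then have "AE (c, x') in cost_trans h xa. c + (MIN a'. f (Suc h) (x', a')) \<in> {0..1}"
    using targets[OF Bce] h unfolding unit_targets_def by blast
  then show ?thesis by (simp add: Bce vmin_def split_beta')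
qed

text \<open>Given the query, the target has the Bellman image as its mean, and completeness puts
  that image in \<open>[0,1]\<close>; with \<open>target_range\<close> these are the hypotheses of
  \<open>excess_weight_le\<close>.\<close>

lemma outcome_weight:
  assumes f: "admissible f" and h: "h \<in> {1..hor M}"
  shows "(\<integral>\<^sup>+z. weight f h z \<partial>outcome M h xa) \<le> ennreal (1 - residual_at f h xa / slack l)"
    and "(\<integral>\<^sup>+z. penalty f h z \<partial>outcome M h xa) = 0"
proof -
  note [measurable] = admissibleD(1,3,5)[OF f h] and m = measurable_weight[OF f h]
  note Q = pair_kernel[OF h, of xa]
  interpret Q: prob_space "cost_trans h xa" using prob_algebraD(1)[OF Q] .
  let ?Y = "\<lambda>p. fst p + vmin (f (Suc h)) (snd p)"
  have Y: "?Y \<in> borel_measurable (cost_trans h xa)"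
    by (subst measurable_law[OF Q]) measurable
  have E: "Q.expectation ?Y = backup f h xa" by (simp add: bellman_eq_pair)
  note b = admissibleD(2)[OF f h, of xa] admissibleD(6)[OF f h, of xa]
  have "(\<integral>\<^sup>+z. weight f h z \<partial>outcome M h xa) =
      (\<integral>\<^sup>+p. ennreal (excess_weight l (f h xa) (backup f h xa) (?Y p)) \<partial>(cost_trans h xa))"
    by (subst nn_integral_outcome[OF h m(1)]) (simp add: weight_def target_def sample_cost_def split_beta')
  also have "\<dots> \<le> ennreal (1 - residual_at f h xa / slack l)"
    using b by (intro Q.excess_weight_le Y target_range[OF f h] E) auto
  finally show "(\<integral>\<^sup>+z. weight f h z \<partial>outcome M h xa) \<le> ennreal (1 - residual_at f h xa / slack l)" .
  have "(\<integral>\<^sup>+z. penalty f h z \<partial>outcome M h xa) =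
      (\<integral>\<^sup>+p. (if flawed l (backup f h xa) (?Y p) then top else 0) \<partial>(cost_trans h xa))"
    by (subst nn_integral_outcome[OF h m(2)]) (simp add: penalty_def target_def sample_cost_def split_beta')
  also have "\<dots> = (\<integral>\<^sup>+p. 0 \<partial>(cost_trans h xa))"
  proof (rule nn_integral_cong_AE)
    have "AE p in cost_trans h xa. \<not> flawed l (backup f h xa) (?Y p)"
      using b by (intro Q.not_flawed_AE Y target_range[OF f h] E) auto
    then show "AE p in cost_trans h xa.
        (if flawed l (backup f h xa) (?Y p) then top else 0 :: ennreal) = 0"
      by eventually_elim simp
  qed
  finally show "(\<integral>\<^sup>+z. penalty f h z \<partial>outcome M h xa) = 0" by simp
qed

lemma rate_bounds:
  assumes f: "admissible f" and h: "h \<in> {1..hor M}" and \<mu>: "\<mu> \<in> space (prob_algebra (obs_act M))"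
  shows "0 \<le> rate f h \<mu>" "rate f h \<mu> \<le> 1"
proof -
  have "1 \<le> slack l" by (cases l) auto
  then show "0 \<le> rate f h \<mu>" "rate f h \<mu> \<le> 1"
    using residual_integrable(2,3)[OF f h \<mu>] by (auto simp: rate_def)
qed

text \<open>The bound for a fixed query is linear in the residual, so it averages exactly; then
  \<open>1 - x \<le> exp (- x)\<close>.\<close>

lemma query_weight:
  assumes f: "admissible f" and h: "h \<in> {1..hor M}" and \<mu>: "\<mu> \<in> space (prob_algebra (obs_act M))"
  shows "(\<integral>\<^sup>+xa. \<integral>\<^sup>+z. weight f h z \<partial>outcome M h xa \<partial>\<mu>) * ennreal (exp (rate f h \<mu>)) \<le> 1"
proof -
  interpret prob_space \<mu> using prob_algebraD(1)[OF \<mu>] .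
  let ?r = "\<lambda>xa. residual_at f h xa"
  note r = residual_integrable[OF f h \<mu>]
  have s: "1 \<le> slack l" by (cases l) auto
  have "0 \<le> ?r xa / slack l" "?r xa / slack l \<le> 1" for xa
    using residual_bounds[of "f h xa" "backup f h xa" l] admissibleD(2,6)[OF f h, of xa] s
    by (auto simp: divide_le_eq_1 intro: order_trans)
  then have "(\<integral>\<^sup>+xa. ennreal (1 - ?r xa / slack l) \<partial>\<mu>) = ennreal (\<integral>xa. 1 - ?r xa / slack l \<partial>\<mu>)"
    using r(1) by (intro nn_integral_eq_integral) auto
  also have "(\<integral>xa. 1 - ?r xa / slack l \<partial>\<mu>) = 1 - rate f h \<mu>"
    using r(1) prob_space by (simp add: rate_def mean_residual_def)
  also have "\<dots> \<le> exp (- rate f h \<mu>)" using exp_ge_add_one_self[of "- rate f h \<mu>"] by simp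
  finally have "(\<integral>\<^sup>+xa. ennreal (1 - ?r xa / slack l) \<partial>\<mu>) \<le> ennreal (exp (- rate f h \<mu>))"
    by (simp add: ennreal_leI)
  moreover have "(\<integral>\<^sup>+xa. \<integral>\<^sup>+z. weight f h z \<partial>outcome M h xa \<partial>\<mu>) \<le> (\<integral>\<^sup>+xa. ennreal (1 - ?r xa / slack l) \<partial>\<mu>)"
    by (intro nn_integral_mono outcome_weight(1)[OF f h])
  ultimately have "(\<integral>\<^sup>+xa. \<integral>\<^sup>+z. weight f h z \<partial>outcome M h xa \<partial>\<mu>) * ennreal (exp (rate f h \<mu>))
      \<le> ennreal (exp (- rate f h \<mu>)) * ennreal (exp (rate f h \<mu>))"
    by (intro mult_right_mono) auto
  also have "\<dots> = 1" by (simp add: ennreal_mult[symmetric] exp_minus)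
  finally show ?thesis .
qed

end

section \<open>Supermartingale property of the capital\<close>

context hybrid_interaction
begin

text \<open>Cutting the history back to \<open>past t\<close> makes this predictable: it is
  determined before the samples of round \<open>t\<close> are drawn, and rounds appended later leave
  it unchanged.\<close>

definition queries :: "nat \<Rightarrow> nat \<Rightarrow> ('x, 'a) history \<Rightarrow> ('x \<times> 'a) measure" where
  "queries h t D = online_query ua (det (pol t (past t D))) h"

text \<open>
  The penalties vanish almost surely. They are added, not multiplied, since \<open>0 * top = 0\<close> would let a zero weight
  hide a sample on which the loss of the Bellman image is infinite.
\<close>

definition capital :: "('x, 'a) qtuple \<Rightarrow> nat \<Rightarrow> nat \<Rightarrow> ('x, 'a) history \<Rightarrow> ennreal" where
  "capital f h i D =
     (\<Sum>t<n h. penalty f h (fst D h t)) + (\<Sum>t\<in>{1..i}. penalty f h (snd D t h)) +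
     (\<Prod>t<n h. weight f h (fst D h t) * ennreal (exp (rate f h (\<nu> h)))) *
     (\<Prod>t\<in>{1..i}. weight f h (snd D t h) * ennreal (exp (rate f h (queries h t D))))"

lemma \<nu>_space: "h \<in> {1..hor M} \<Longrightarrow> \<nu> h \<in> space (prob_algebra (obs_act M))"
  using offline by (simp add: offline_law_def)

lemma past_history: "D \<in> space (Hist j) \<Longrightarrow> past (Suc j) D = D"
  unfolding past_def historyM_def
  by (auto simp: space_pair_measure space_PiM PiE_def atLeastLessThanSuc_atLeastAtMost extensional_restrict prod_eq_iff)

lemma past_append_round: "t \<le> Suc j \<Longrightarrow> past t (append_round j D r) = past t D"
  by (auto simp: past_def restrict_def fun_eq_iff)

lemma measurable_past:
  assumes "1 \<le> t" "t \<le> Suc j"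
  shows "past t \<in> Hist j \<rightarrow>\<^sub>M Hist (t - 1)"
proof -
  have eq: "{1..<t} = {1..t - 1}" using assms by auto
  have "(\<lambda>D. restrict (snd D) {1..t - 1}) \<in> Hist j \<rightarrow>\<^sub>M Pi\<^sub>M {1..t - 1} (\<lambda>_. Traj (hor M))"
    unfolding historyM_def using assms
    by (intro measurable_compose[OF measurable_snd measurable_restrict_subset]) auto
  moreover have "fst \<in> Hist j \<rightarrow>\<^sub>M offlineM M n" unfolding historyM_def by measurable
  ultimately show ?thesis
    unfolding past_def[abs_def] eq historyM_def[of M n "t - 1"] by (intro measurable_Pair) auto
qed

lemma measurable_sample_access:
  assumes "h \<in> {1..hor M}"
  shows "t < n h \<Longrightarrow> (\<lambda>D. fst D h t) \<in> Hist j \<rightarrow>\<^sub>M Z"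
    and "t \<in> {1..j} \<Longrightarrow> (\<lambda>D. snd D t h) \<in> Hist j \<rightarrow>\<^sub>M Z"
proof -
  assume "t < n h"
  then show "(\<lambda>D. fst D h t) \<in> Hist j \<rightarrow>\<^sub>M Z"
    using assms unfolding historyM_def offlineM_def
    by (intro measurable_compose[OF measurable_fst] measurable_compose[OF measurable_component_singleton[of h]]
      measurable_component_singleton) auto
next
  assume "t \<in> {1..j}"
  then show "(\<lambda>D. snd D t h) \<in> Hist j \<rightarrow>\<^sub>M Z"
    using assms unfolding historyM_def
    by (intro measurable_compose[OF measurable_snd] measurable_compose[OF measurable_component_singleton[of t]]
      measurable_component_singleton) auto
qed

lemma queries_space:
  assumes "t \<in> {1..K}" "t \<le> Suc j" "D \<in> space (Hist j)" "h \<in> {1..hor M}"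
  shows "queries h t D \<in> space (prob_algebra (obs_act M))"
  unfolding queries_def
  using assms measurable_space[OF measurable_past[of t j], of D]
  by (intro online_query_space is_policy_pol) auto

lemma measurable_rate:
  assumes f: "admissible f" and h: "h \<in> {1..hor M}" and t: "t \<in> {1..K}" "t \<le> Suc j"
  shows "(\<lambda>D. rate f h (queries h t D)) \<in> borel_measurable (Hist j)"
proof -
  note [measurable] = admissibleD(1,5)[OF f h]
  have "(\<lambda>D. online_query ua (det (pol t D)) h) \<in> Hist (t - 1) \<rightarrow>\<^sub>M subprob_algebra (obs_act M)"
    using measurable_det_pol[OF t(1)] h by (intro measurable_prob_algebraD parametric_kernels(3)) auto
  moreover have "(\<lambda>\<mu>. rate f h \<mu>) \<in> borel_measurable (subprob_algebra (obs_act M))"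
    unfolding rate_def mean_residual_def by measurable
  ultimately have "(\<lambda>D. rate f h (online_query ua (det (pol t D)) h)) \<in> borel_measurable (Hist (t - 1))"
    by (rule measurable_compose)
  from measurable_compose[OF measurable_past this] show ?thesis
    unfolding queries_def using t by simp
qed

lemma measurable_capital:
  assumes f: "admissible f" and h: "h \<in> {1..hor M}" and ij: "i \<le> j" "j \<le> K"
  shows "capital f h i \<in> borel_measurable (Hist j)"
proof -
  note w = measurable_weight[OF f h]
  note s = measurable_sample_access[OF h, of _ j]
  have [measurable]: "(\<lambda>D. weight f h (fst D h t)) \<in> borel_measurable (Hist j)"
    "(\<lambda>D. penalty f h (fst D h t)) \<in> borel_measurable (Hist j)" if "t \<in> {..<n h}" for t
    using that by (auto intro!: measurable_compose[OF s(1) w(1)] measurable_compose[OF s(1) w(2)])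
  have [measurable]: "(\<lambda>D. weight f h (snd D t h)) \<in> borel_measurable (Hist j)"
    "(\<lambda>D. penalty f h (snd D t h)) \<in> borel_measurable (Hist j)"
    "(\<lambda>D. rate f h (queries h t D)) \<in> borel_measurable (Hist j)" if "t \<in> {1..i}" for t
    using that ij
    by (auto intro!: measurable_compose[OF s(2) w(1)] measurable_compose[OF s(2) w(2)] measurable_rate[OF f h])
  show ?thesis unfolding capital_def[abs_def] by measurable
qed

lemma capital_append_round:
  assumes "i \<le> j"
  shows "capital f h i (append_round j D r) = capital f h i D"
proof -
  have "queries h t (append_round j D r) = queries h t D" "t \<noteq> Suc j" if "t \<in> {1..i}" for t
    using that assms by (auto simp: queries_def past_append_round)
  then have "(\<Sum>t\<in>{1..i}. penalty f h (((snd D)(Suc j := r)) t h)) = (\<Sum>t\<in>{1..i}. penalty f h (snd D t h))"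
    and "(\<Prod>t\<in>{1..i}. weight f h (((snd D)(Suc j := r)) t h) * ennreal (exp (rate f h (queries h t (append_round j D r))))) =
      (\<Prod>t\<in>{1..i}. weight f h (snd D t h) * ennreal (exp (rate f h (queries h t D))))"
    by (auto intro!: sum.cong prod.cong)
  then show ?thesis
    unfolding capital_def by simp
qed

text \<open>Given \<open>D\<close>, only the samples of the new round are random: their compensated
  weight has conditional mean at most one by \<open>query_weight\<close>, and their penalty has mean
  zero.\<close>

lemma capital_step:
  assumes f: "admissible f" and h: "h \<in> {1..hor M}" and j: "j < K" and D: "D \<in> space (Hist j)"
  shows "(\<integral>\<^sup>+r. capital f h (Suc j) (append_round j D r) \<partial>new_round j D) \<le> capital f h j D"
proof -
  define B where "B = (\<Sum>t<n h. penalty f h (fst D h t)) + (\<Sum>t\<in>{1..j}. penalty f h (snd D t h))"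
  define P where "P = (\<Prod>t<n h. weight f h (fst D h t) * ennreal (exp (rate f h (\<nu> h)))) *
     (\<Prod>t\<in>{1..j}. weight f h (snd D t h) * ennreal (exp (rate f h (queries h t D))))"
  have cD: "capital f h j D = B + P" by (simp add: capital_def B_def P_def)
  let ?\<mu> = "online_query ua (det (pol (Suc j) D)) h"
  have \<pi>: "is_policy M (det (pol (Suc j) D))" using j D by (intro is_policy_pol) auto
  note \<mu> = online_query_space[OF \<pi> h, of ua]
  note w = measurable_weight[OF f h]
  have q: "queries h (Suc j) (append_round j D r) = ?\<mu>" for r
    by (simp add: queries_def past_append_round past_history[OF D])
  have q': "queries h t (append_round j D r) = queries h t D" if "t \<in> {1..j}" for t r
    using that by (simp add: queries_def past_append_round)
  have ins: "{1..Suc j} = insert (Suc j) {1..j}" by auto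
  have eq: "capital f h (Suc j) (append_round j D r) =
      B + penalty f h (r h) + P * ennreal (exp (rate f h ?\<mu>)) * weight f h (r h)" for r
      proof -
    have "(\<Sum>t\<in>{1..j}. penalty f h (((snd D)(Suc j := r)) t h)) = (\<Sum>t\<in>{1..j}. penalty f h (snd D t h))"
      and "(\<Prod>t\<in>{1..j}. weight f h (((snd D)(Suc j := r)) t h) * ennreal (exp (rate f h (queries h t (append_round j D r))))) =
        (\<Prod>t\<in>{1..j}. weight f h (snd D t h) * ennreal (exp (rate f h (queries h t D))))"
      using q' by (auto intro!: sum.cong prod.cong)
    then show ?thesis
      unfolding capital_def ins using q[of r] by (simp add: B_def P_def mult_ac add_ac)
  qed
  have R: "sets (new_round j D) = sets (Traj (hor M))" "prob_space (new_round j D)"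
    using measurable_space[OF measurable_round[OF j] D] by (simp_all add: space_prob_algebra)
  have m: "(\<lambda>r. weight f h (r h)) \<in> borel_measurable (new_round j D)" "(\<lambda>r. penalty f h (r h)) \<in> borel_measurable (new_round j D)"
    using measurable_compose[OF component_measurable[OF h] w(1)] measurable_compose[OF component_measurable[OF h] w(2)]
    by (simp_all add: measurable_cong_sets[OF R(1) refl])
  have "(\<integral>\<^sup>+r. capital f h (Suc j) (append_round j D r) \<partial>new_round j D) =
     B + (\<integral>\<^sup>+r. penalty f h (r h) \<partial>new_round j D) +
     P * ennreal (exp (rate f h ?\<mu>)) * (\<integral>\<^sup>+r. weight f h (r h) \<partial>new_round j D)"
    unfolding eq using m prob_space.emeasure_space_1[OF R(2)]
    by (simp add: nn_integral_add nn_integral_cmult)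
  also have "\<dots> = B + P * ((\<integral>\<^sup>+xa. \<integral>\<^sup>+z. weight f h z \<partial>outcome M h xa \<partial>?\<mu>) * ennreal (exp (rate f h ?\<mu>)))"
    by (simp add: nn_integral_collect[OF \<pi> h w(1)] nn_integral_collect[OF \<pi> h w(2)] outcome_weight(2)[OF f h] mult_ac)
  also have "\<dots> \<le> B + P * 1"
    by (intro add_left_mono mult_left_mono query_weight[OF f h \<mu>]) simp
  finally show ?thesis by (simp add: cD)
qed

text \<open>Only the marginal law of the step-\<open>h\<close> offline samples enters, so dependence
  between steps is harmless; within the step, independence turns the mean of the product into a
  product of means, each at most one.\<close>

lemma capital_start:
  assumes f: "admissible f" and h: "h \<in> {1..hor M}"
  shows "(\<integral>\<^sup>+D. capital f h 0 D \<partial>I 0) \<le> 1"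
proof -
  have D: "Doff \<in> space (prob_algebra (offlineM M n))"
    and law: "distr Doff (Pi\<^sub>M {..<n h} (\<lambda>_. Z)) (\<lambda>\<omega>. \<omega> h) = Pi\<^sub>M {..<n h} (\<lambda>_. \<nu> h \<bind> outcome M h)"
    using offline h by (auto simp: offline_law_def)
  note \<nu>' = \<nu>_space[OF h] and w = measurable_weight[OF f h]
  let ?N = "\<nu> h \<bind> outcome M h"
  let ?Q = "Pi\<^sub>M {..<n h} (\<lambda>_. ?N)"
  let ?w = "\<lambda>z. weight f h z * ennreal (exp (rate f h (\<nu> h)))"
  have N: "prob_space ?N" "sets ?N = sets Z"
    using prob_space_bind'[OF \<nu>' measurable_outcome[OF h]] sets_bind'[OF \<nu>' measurable_outcome[OF h]] by simp_all
  note K = outcome_kernel[OF \<nu>' h]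
  have u: "(\<lambda>_. undefined) \<in> space (Pi\<^sub>M {1..0::nat} (\<lambda>_. Traj (hor M)))"
    by (simp add: space_PiM One_nat_def)
  have e: "(\<lambda>\<omega>. (\<omega>, \<lambda>_. undefined)) \<in> Doff \<rightarrow>\<^sub>M Hist 0"
    unfolding measurable_law[OF D] historyM_def using u by (intro measurable_Pair) auto
  have p: "(\<lambda>\<omega>. \<omega> h) \<in> Doff \<rightarrow>\<^sub>M Pi\<^sub>M {..<n h} (\<lambda>_. Z)"
    unfolding measurable_law[OF D] offlineM_def using h by measurable
  have wN: "?w \<in> borel_measurable ?N" "penalty f h \<in> borel_measurable ?N"
    using w by (simp_all add: measurable_cong_sets[OF N(2) refl])
  have wt: "(\<lambda>\<omega>. ?w (\<omega> t)) \<in> borel_measurable ?Q" "(\<lambda>\<omega>. penalty f h (\<omega> t)) \<in> borel_measurable ?Q" if "t \<in> {..<n h}" for t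
    by (rule measurable_compose[OF measurable_component_singleton[OF that]], rule wN)+
  then have m: "(\<lambda>\<omega>. \<Sum>t<n h. penalty f h (\<omega> t)) \<in> borel_measurable ?Q" "(\<lambda>\<omega>. \<Prod>t<n h. ?w (\<omega> t)) \<in> borel_measurable ?Q"
    by (intro borel_measurable_sum borel_measurable_prod_ennreal; simp)+
  have "(\<integral>\<^sup>+D. capital f h 0 D \<partial>I 0) = (\<integral>\<^sup>+\<omega>. capital f h 0 (\<omega>, \<lambda>_. undefined) \<partial>Doff)"
    unfolding interaction.simps by (rule nn_integral_distr[OF e]) (use measurable_capital[OF f h order.refl] in simp)
  also have "\<dots> = (\<integral>\<^sup>+\<omega>. (\<Sum>t<n h. penalty f h (\<omega> h t)) + (\<Prod>t<n h. ?w (\<omega> h t)) \<partial>Doff)"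
    by (simp add: capital_def One_nat_def)
  also have "\<dots> = (\<integral>\<^sup>+\<omega>. (\<Sum>t<n h. penalty f h (\<omega> t)) + (\<Prod>t<n h. ?w (\<omega> t)) \<partial>?Q)"
    unfolding law[symmetric] by (rule nn_integral_distr[OF p, symmetric]) (unfold law, intro borel_measurable_add m)
  also have "\<dots> = (\<Sum>t<n h. \<integral>\<^sup>+\<omega>. penalty f h (\<omega> t) \<partial>?Q) + (\<integral>\<^sup>+\<omega>. (\<Prod>t<n h. ?w (\<omega> t)) \<partial>?Q)"
    unfolding nn_integral_add[OF m] using wt(2) by (subst nn_integral_sum) auto
  also have "(\<Sum>t<n h. \<integral>\<^sup>+\<omega>. penalty f h (\<omega> t) \<partial>?Q) = 0"
  proof (intro sum.neutral ballI)
    fix t assume t: "t \<in> {..<n h}"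
    have "(\<integral>\<^sup>+\<omega>. penalty f h (\<omega> t) \<partial>?Q) = (\<integral>\<^sup>+z. penalty f h z \<partial>distr ?Q ?N (\<lambda>\<omega>. \<omega> t))"
      using t wN(2) by (intro nn_integral_distr[symmetric]) auto
    also have "\<dots> = (\<integral>\<^sup>+z. penalty f h z \<partial>?N)"
      using t N by (subst distr_PiM_component) auto
    also have "\<dots> = 0"
      by (subst nn_integral_bind[OF w(2) K]) (simp add: outcome_weight(2)[OF f h])
    finally show "(\<integral>\<^sup>+\<omega>. penalty f h (\<omega> t) \<partial>?Q) = 0" .
  qed
  also have "(\<integral>\<^sup>+\<omega>. (\<Prod>t<n h. ?w (\<omega> t)) \<partial>?Q) = (\<Prod>t<n h. \<integral>\<^sup>+z. ?w z \<partial>?N)"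
  proof -
    interpret prob_space ?N by (rule N)
    interpret product_sigma_finite "\<lambda>_::nat. ?N" by standard
    show ?thesis using wN(1) by (intro product_nn_integral_prod[of "{..<n h}" "\<lambda>_. ?w"]) auto
  qed
  also have "\<dots> \<le> 1"
  proof (rule prod_le_1, intro conjI)
    have "(\<integral>\<^sup>+z. ?w z \<partial>?N) = (\<integral>\<^sup>+xa. \<integral>\<^sup>+z. weight f h z \<partial>outcome M h xa \<partial>\<nu> h) * ennreal (exp (rate f h (\<nu> h)))"
      using w(1) by (subst nn_integral_multc) (auto simp: measurable_cong_sets[OF N(2) refl] nn_integral_bind[OF w(1) K])
    then show "(\<integral>\<^sup>+z. ?w z \<partial>?N) \<le> 1"
      using query_weight[OF f h \<nu>'] by simp
  qed simp
  finally show ?thesis by simp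
qed

lemma capital_maximal:
  assumes "admissible f" "h \<in> {1..hor M}"
  shows "a * emeasure (I K) {D \<in> space (Hist K). \<exists>i\<le>K. a \<le> capital f h i D} \<le> 1"
  using assms
  by (intro maximal_inequality measurable_capital capital_start capital_append_round capital_step)

section \<open>Simultaneous confidence\<close>

text \<open>Speaks of fixed members of \<open>F\<close> only; the data-dependent fits are brought in
  afterwards by deterministic reasoning on this event.\<close>

definition confident :: "real \<Rightarrow> ('x, 'a) history set" where
  "confident a = {D \<in> space (Hist K). \<forall>f\<in>F. \<forall>h\<in>{1..hor M}. \<forall>i\<le>K. capital f h i D < ennreal a}"

text \<open>A union bound over \<open>F\<close> and the steps; the rounds are already covered by the
  maximal inequality, so \<open>K\<close> does not enter.\<close>

lemma confident_measure:
  assumes a: "0 < a"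
  shows "confident a \<in> sets (I K)"
    and "1 - real (hor M) * real (card F) / a \<le> measure (I K) (confident a)"
proof -
  note IK = prob_algebraD[OF interaction_space[OF order.refl]]
  interpret prob_space "I K" by (rule IK)
  have F: "finite F" using fun_class by (simp add: function_class_def)
  define A where "A = (\<lambda>(f, h). {D \<in> space (Hist K). \<exists>i\<le>K. ennreal a \<le> capital f h i D})"
  let ?S = "F \<times> {1..hor M}"
  have mA: "A p \<in> sets (I K)" if q: "p \<in> ?S" for p
  proof -
    obtain f h where p: "p = (f, h)" "f \<in> F" "h \<in> {1..hor M}" using q by blast
    have [measurable]: "capital f h i \<in> borel_measurable (Hist K)" if "i \<in> {..K}" for i
      using p that by (intro measurable_capital admissible_class) auto
    have "{D \<in> space (Hist K). \<exists>i\<in>{..K}. ennreal a \<le> capital f h i D} \<in> sets (Hist K)"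
      by measurable
    then show ?thesis using IK p by (simp add: A_def Bex_def)
  qed
  have PA: "prob (A p) \<le> 1 / a" if q: "p \<in> ?S" for p
  proof -
    obtain f h where p: "p = (f, h)" "f \<in> F" "h \<in> {1..hor M}" using q by blast
    have "ennreal a * emeasure (I K) (A p) \<le> 1"
      using capital_maximal[OF admissible_class[OF p(2)] p(3)] by (simp add: A_def p)
    then have "ennreal (a * prob (A p)) \<le> ennreal 1"
      using a by (simp add: emeasure_eq_measure ennreal_mult)
    then show ?thesis using a by (simp add: field_simps)
  qed
  have eq: "confident a = space (I K) - (\<Union>p\<in>?S. A p)"
  proof -
    have "x \<in> confident a \<longleftrightarrow> x \<in> space (Hist K) \<and>
        \<not> (\<exists>f\<in>F. \<exists>h\<in>{1..hor M}. \<exists>i\<le>K. ennreal a \<le> capital f h i x)" for x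
      unfolding confident_def by (simp only: mem_Collect_eq not_le[symmetric]) blast
    moreover have "x \<in> (\<Union>p\<in>?S. A p) \<longleftrightarrow> x \<in> space (Hist K) \<and>
        (\<exists>f\<in>F. \<exists>h\<in>{1..hor M}. \<exists>i\<le>K. ennreal a \<le> capital f h i x)" for x
      by (auto simp: A_def simp del: atLeastAtMost_iff)
    ultimately show ?thesis unfolding IK(3) by blast
  qed
  have U: "(\<Union>p\<in>?S. A p) \<in> sets (I K)" using F mA by (intro sets.finite_UN) auto
  then show "confident a \<in> sets (I K)" unfolding eq by auto
  have "prob (\<Union>p\<in>?S. A p) \<le> (\<Sum>p\<in>?S. prob (A p))"
    using F mA by (intro finite_measure_subadditive_finite) auto
  also have "\<dots> \<le> (\<Sum>p\<in>?S. 1 / a)" using PA by (rule sum_mono)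
  also have "\<dots> = real (hor M) * real (card F) / a" by (simp add: card_cartesian_product)
  finally show "1 - real (hor M) * real (card F) / a \<le> prob (confident a)"
    unfolding eq using prob_compl[OF U] by simp
qed

section \<open>Deterministic consequences of confidence\<close>

abbreviation "fitted k D \<equiv> fit k (past k D)"
abbreviation "policy k D \<equiv> det (pol k (past k D))"

lemma past_space: "D \<in> space (Hist K) \<Longrightarrow> k \<in> {1..K} \<Longrightarrow> past k D \<in> space (Hist (k - 1))"
  using measurable_space[OF measurable_past[of k K]] by auto

lemma fitted_component:
  assumes D: "D \<in> space (Hist K)" and k: "k \<in> {1..K}"
  shows "fitted k D (Suc (hor M)) = (\<lambda>_. 0)"
    and "greedy M (fitted k D) (pol k (past k D))"
    and "h \<in> {1..hor M} \<Longrightarrow> is_arg_min (\<lambda>g. empirical_loss l g (fitted k D (Suc h)) (step_data n k h (past k D)))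
        (\<lambda>g. g \<in> component F h) (fitted k D h)"
    and "admissible (fitted k D)"
    and "is_policy M (policy k D)"
proof -
  note run = bspec[OF algorithm[unfolded fitted_Q_iteration_def] k, THEN conjunct1, THEN bspec, OF past_space[OF D k]]
  then show zero: "fitted k D (Suc (hor M)) = (\<lambda>_. 0)" and "greedy M (fitted k D) (pol k (past k D))"
    by blast+
  show opt: "is_arg_min (\<lambda>g. empirical_loss l g (fitted k D (Suc h)) (step_data n k h (past k D)))
        (\<lambda>g. g \<in> component F h) (fitted k D h)" if "h \<in> {1..hor M}" for h
    using run that by blast
  show "admissible (fitted k D)"
    unfolding admissible_def
  proof
    fix h assume h: "h \<in> {1..Suc (hor M)}"
    show "fitted k D h \<in> component F h"
    proof (cases "h = Suc (hor M)")
      case True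
      then show ?thesis using zero component_Suc_horizon by simp
    next
      case False
      then have "h \<in> {1..hor M}" using h by auto
      then show ?thesis using opt by (auto simp: is_arg_min_def)
    qed
  qed
  show "is_policy M (policy k D)" using k past_space[OF D k] by (intro is_policy_pol)
qed

text \<open>Residuals, weights and losses at step \<open>h\<close> see only two consecutive
  components, so a fit may be replaced by a member of \<open>F\<close> agreeing with it there;
  \<open>consecutive_closed\<close> provides it. At the last step any member with the right
  component will do, all of them being zero beyond.\<close>

lemma class_representative:
  assumes f: "admissible f" and h: "h \<in> {1..hor M}"
  obtains g where "g \<in> F" "g h = f h" "g (Suc h) = f (Suc h)"
proof (cases "h = hor M")
  case True
  have "f h \<in> component F h" "f (Suc h) = (\<lambda>_. 0)"
    using f h True component_Suc_horizon by (auto simp: admissible_def)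
  moreover obtain g where g: "g \<in> F" "g h = f h" using calculation(1) by (auto simp: component_def)
  moreover have "g (Suc h) = (\<lambda>_. 0)" using g(1) True fun_class by (auto simp: function_class_def)
  ultimately show ?thesis using that by simp
next
  case False
  then have "h \<in> {1..<hor M}" "f h \<in> component F h" "f (Suc h) \<in> component F (Suc h)"
    using f h by (auto simp: admissible_def)
  then show ?thesis using that consecutive unfolding consecutive_closed_def by blast
qed

lemma empirical_loss_eq:
  "empirical_loss l g g' zs = (\<Sum>z\<leftarrow>zs. loss_fun l (g (fst z, fst (snd z))) (target g' z))"
  by (simp add: empirical_loss_def target_def sample_cost_def vmin_def split_beta')

lemma step_data_past: "step_data n k h (past k D) = step_data n k h D"
  by (auto simp: step_data_def past_def)

lemma prod_list_step_data:
  fixes g :: "('x, 'a) sample \<Rightarrow> 'b::comm_monoid_mult"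
  shows "(\<Prod>z\<leftarrow>step_data n k h D. g z) = (\<Prod>t<n h. g (fst D h t)) * (\<Prod>t\<in>{1..<k}. g (snd D t h))"
proof -
  have "(\<Prod>t<n h. g (fst D h t)) = (\<Prod>t\<leftarrow>[0..<n h]. g (fst D h t))"
    using prod.distinct_set_conv_list[of "[0..<n h]" "\<lambda>t. g (fst D h t)"] by (simp add: atLeast0LessThan)
  moreover have "(\<Prod>t\<in>{1..<k}. g (snd D t h)) = (\<Prod>t\<leftarrow>[1..<k]. g (snd D t h))"
    using prod.distinct_set_conv_list[of "[1..<k]" "\<lambda>t. g (snd D t h)"] by simp
  ultimately show ?thesis by (simp add: step_data_def comp_def)
qed

text \<open>On the event the capital is below \<open>a\<close>. It dominates the product of the
  weights, at least one by minimality, times the exponential of the accumulated rates, so these sum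
  to at most \<open>ln a\<close>.\<close>

lemma rate_sum_le:
  assumes a: "0 < a" and D: "D \<in> confident a" and k: "k \<in> {1..K}" and h: "h \<in> {1..hor M}"
  shows "real (n h) * rate (fitted k D) h (\<nu> h) + (\<Sum>t\<in>{1..<k}. rate (fitted k D) h (queries h t D)) \<le> ln a"
proof -
  have DK: "D \<in> space (Hist K)" using D by (simp add: confident_def)
  note fc = fitted_component[OF DK k]
  obtain f where f: "f \<in> F" "f h = fitted k D h" "f (Suc h) = fitted k D (Suc h)"
    using class_representative[OF fc(4) h] .
  have rate: "rate (fitted k D) h \<mu> = rate f h \<mu>" for \<mu>
    by (simp add: rate_def mean_residual_def f)
  note adm = admissible_class[OF f(1)]
  let ?zs = "step_data n k h D"
  let ?T = "backup f h"
  \<comment> \<open>The fit of round \<open>k\<close> has seen \<open>k - 1\<close> online rounds,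
    so the capital is read at index \<open>k - 1\<close>.\<close>
  have ij: "{1..k - 1} = {1..<k}" using k by auto
  have "k - 1 \<le> K" using k by auto
  then have cap: "capital f h (k - 1) D < ennreal a" using D f(1) h unfolding confident_def by blast
  \<comment> \<open>Finite capital excludes every penalty, so the almost sure statement about flawed
    samples becomes a pointwise one on the event.\<close>
  then have fin: "capital f h (k - 1) D \<noteq> top" by (metis order.strict_trans ennreal_less_top less_irrefl)
  have "(\<Sum>t<n h. penalty f h (fst D h t)) \<noteq> top" "(\<Sum>t\<in>{1..<k}. penalty f h (snd D t h)) \<noteq> top"
    using fin unfolding capital_def ij by auto
  then have "penalty f h (fst D h t) \<noteq> top" if "t < n h" for t
    using that by auto
  moreover have "penalty f h (snd D t h) \<noteq> top" if "t \<in> {1..<k}" for t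
    using that \<open>(\<Sum>t\<in>{1..<k}. penalty f h (snd D t h)) \<noteq> top\<close> by (simp only: ennreal_sum_eq_top finite_atLeastLessThan) blast
  ultimately have pen: "penalty f h z \<noteq> top" if "z \<in> set ?zs" for z
    using that by (auto simp: step_data_def)
  then have unflawed: "\<not> flawed l (?T (fst z, fst (snd z))) (target (f (Suc h)) z)" if "z \<in> set ?zs" for z
    using pen[OF that] unfolding penalty_def by presburger
  define w where "w z = excess_weight l (f h (fst z, fst (snd z))) (?T (fst z, fst (snd z))) (target (f (Suc h)) z)" for z
  have w: "0 \<le> w z" "weight f h z = ennreal (w z)" for z
    by (simp_all add: w_def weight_def excess_weight_def)
  have "1 \<le> (\<Prod>z\<leftarrow>?zs. w z)"
    unfolding w_def
  proof (rule prod_excess_weight_ge_1[OF unflawed])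
    show "0 \<le> f h (fst z, fst (snd z)) \<and> f h (fst z, fst (snd z)) \<le> 1" for z :: "('x, 'a) sample"
      using admissibleD(2)[OF adm h] by simp
    \<comment> \<open>Completeness makes the Bellman image a competitor of the minimiser.\<close>
    have "?T \<in> component F h"
      using adm h by (intro bellman_component) (auto simp: admissible_def)
    then have "\<not> empirical_loss l ?T (f (Suc h)) ?zs < empirical_loss l (f h) (f (Suc h)) ?zs"
      using fc(3)[OF h] by (simp add: is_arg_min_def f step_data_past)
    then show "(\<Sum>z\<leftarrow>?zs. loss_fun l (f h (fst z, fst (snd z))) (target (f (Suc h)) z))
        \<le> (\<Sum>z\<leftarrow>?zs. loss_fun l (?T (fst z, fst (snd z))) (target (f (Suc h)) z))"
      by (simp add: empirical_loss_eq)
  qed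
  then have "1 \<le> (\<Prod>t<n h. w (fst D h t)) * (\<Prod>t\<in>{1..<k}. w (snd D t h))"
    unfolding prod_list_step_data .
  then have "ennreal 1 \<le> ennreal ((\<Prod>t<n h. w (fst D h t)) * (\<Prod>t\<in>{1..<k}. w (snd D t h)))"
    by (rule ennreal_leI)
  then have one: "1 \<le> (\<Prod>t<n h. weight f h (fst D h t)) * (\<Prod>t\<in>{1..<k}. weight f h (snd D t h))"
    using w(1) by (simp add: w(2) prod_ennreal prod_nonneg ennreal_mult)
  let ?r = "real (n h) * rate f h (\<nu> h) + (\<Sum>t\<in>{1..<k}. rate f h (queries h t D))"
  have "ennreal (exp ?r) = (\<Prod>t<n h. ennreal (exp (rate f h (\<nu> h)))) * (\<Prod>t\<in>{1..<k}. ennreal (exp (rate f h (queries h t D))))"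
    by (subst (1 2) prod_ennreal) (auto simp: exp_add exp_sum exp_of_nat_mult prod_nonneg simp flip: ennreal_mult)
  then have "ennreal (exp ?r) \<le> (\<Prod>t<n h. weight f h (fst D h t)) * (\<Prod>t\<in>{1..<k}. weight f h (snd D t h)) *
      ((\<Prod>t<n h. ennreal (exp (rate f h (\<nu> h)))) * (\<Prod>t\<in>{1..<k}. ennreal (exp (rate f h (queries h t D)))))"
    using mult_right_mono[OF one, of "ennreal (exp ?r)"] by simp
  also have "\<dots> = (\<Prod>t<n h. weight f h (fst D h t) * ennreal (exp (rate f h (\<nu> h)))) *
      (\<Prod>t\<in>{1..<k}. weight f h (snd D t h) * ennreal (exp (rate f h (queries h t D))))"
    by (simp add: prod.distrib mult_ac)
  also have "\<dots> \<le> capital f h (k - 1) D"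
    unfolding capital_def ij by (simp add: add_increasing)
  also note cap
  finally have "exp ?r < a" by (subst (asm) ennreal_less_iff) auto
  then have "?r < ln a" using a by (metis exp_less_cancel_iff exp_ln)
  then show ?thesis by (simp add: rate)
qed

end

section \<open>Summing the rounds\<close>

lemma sum_sqrt_le:
  fixes x :: "'i \<Rightarrow> real"
  assumes "\<And>i. i \<in> A \<Longrightarrow> 0 \<le> x i"
  shows "(\<Sum>i\<in>A. sqrt (x i)) \<le> sqrt (real (card A) * (\<Sum>i\<in>A. x i))"
proof -
  have "(\<Sum>i\<in>A. 1 * sqrt (x i))\<^sup>2 \<le> (\<Sum>i\<in>A. 1\<^sup>2) * (\<Sum>i\<in>A. (sqrt (x i))\<^sup>2)"
    by (rule Cauchy_Schwarz_ineq_sum)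
  also have "(\<Sum>i\<in>A. (sqrt (x i))\<^sup>2) = (\<Sum>i\<in>A. x i)"
    using assms by (intro sum.cong) auto
  finally show ?thesis by (intro real_le_rsqrt) simp
qed

text \<open>Arithmetic-geometric mean for \<open>x / c\<close> and \<open>9 * c * p\<close>, whose
  product is \<open>9 * p * x\<close>; the free \<open>c\<close> decides which share of
  \<open>x\<close> is given away.\<close>

lemma sqrt_mult_le_amgm:
  fixes p x c :: real
  assumes "0 \<le> p" "0 \<le> x" "0 < c"
  shows "6 * sqrt (p * x) \<le> x / c + 9 * c * p"
  using arith_geo_mean_sqrt[of "x / c" "9 * c * p"] assms
  by (simp add: real_sqrt_mult field_simps)

lemma sum_bce_gap_le:
  fixes g s e :: "'i \<Rightarrow> real"
  assumes "\<And>i. i \<in> A \<Longrightarrow> g i \<le> 6 * sqrt (s i * e i) + 4 * s i"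
    and "\<And>i. i \<in> A \<Longrightarrow> 0 \<le> s i" "\<And>i. i \<in> A \<Longrightarrow> e i \<le> W" and W: "0 \<le> W"
  shows "(\<Sum>i\<in>A. g i) \<le> 6 * sqrt (real (card A) * (\<Sum>i\<in>A. s i) * W) + 4 * (\<Sum>i\<in>A. s i)"
proof -
  have "(\<Sum>i\<in>A. g i) \<le> (\<Sum>i\<in>A. 6 * sqrt (s i * W) + 4 * s i)"
  proof (rule sum_mono)
    fix i assume i: "i \<in> A"
    have "sqrt (s i * e i) \<le> sqrt (s i * W)"
      using assms(2,3)[OF i] by (intro real_sqrt_le_mono mult_left_mono)
    then show "g i \<le> 6 * sqrt (s i * W) + 4 * s i" using assms(1)[OF i] by linarith
  qed
  also have "\<dots> = 6 * (\<Sum>i\<in>A. sqrt (s i * W)) + 4 * (\<Sum>i\<in>A. s i)"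
    by (simp add: sum.distrib sum_distrib_left)
  also have "(\<Sum>i\<in>A. sqrt (s i * W)) \<le> sqrt (real (card A) * (\<Sum>i\<in>A. s i * W))"
    using assms(2) W by (intro sum_sqrt_le) simp
  finally show ?thesis by (simp add: sum_distrib_right mult.assoc)
qed

text \<open>\<open>X\<close> and \<open>Y\<close> are the gap sums of one round along the executed
  and the comparator policy. Each occurs under a root on its own right-hand side; splitting the root
  and applying the arithmetic-geometric mean returns half of it, which is absorbed. \<open>Y\<close>
  is solved alone and then inserted into the bound for \<open>X\<close>.\<close>

lemma bce_round_bound:
  fixes X Y V H s t :: real
  assumes X: "X \<le> 6 * sqrt (H * s * (V + 2 * X + Y)) + 4 * s"
    and Y: "Y \<le> 6 * sqrt (H * t * (V + Y)) + 4 * t"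
    and nn: "0 \<le> X" "0 \<le> Y" "0 \<le> V" "0 \<le> s" "0 \<le> t" "1 \<le> H"
  shows "X + Y \<le> 12 * sqrt (H * s * V) + 18 * sqrt (H * t * V) + 80 * (H * s) + 66 * (H * t)"
proof -
  have st: "s \<le> H * s" "t \<le> H * t" using nn by (auto simp: mult_le_cancel_right1)
  have "sqrt (H * t * (V + Y)) \<le> sqrt (H * t * V) + sqrt (H * t * Y)"
    using nn sqrt_add_le_add_sqrt[of "H * t * V" "H * t * Y"] by (simp add: distrib_left)
  \<comment> \<open>The share \<open>c = 2\<close> leaves \<open>Y / 2\<close> for
    absorption.\<close>
  moreover have "6 * sqrt (H * t * Y) \<le> Y / 2 + 9 * 2 * (H * t)"
    using nn by (intro sqrt_mult_le_amgm) auto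
  ultimately have Y': "Y \<le> 12 * sqrt (H * t * V) + 44 * (H * t)"
    using Y st by linarith
  have "sqrt (H * s * (V + (2 * X + Y))) \<le> sqrt (H * s * V) + sqrt (H * s * (2 * X + Y))"
    using nn sqrt_add_le_add_sqrt[of "H * s * V" "H * s * (2 * X + Y)"] by (simp add: distrib_left)
  \<comment> \<open>With \<open>c = 4\<close> the term carries a quarter of
    \<open>2 * X + Y\<close>: half of \<open>X\<close> is absorbed, and doubling the rest leaves
    \<open>Y / 2\<close>.\<close>
  moreover have "6 * sqrt (H * s * (2 * X + Y)) \<le> (2 * X + Y) / 4 + 9 * 4 * (H * s)"
    using nn by (intro sqrt_mult_le_amgm) auto
  ultimately have "X \<le> 12 * sqrt (H * s * V) + Y / 2 + 80 * (H * s)"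
    using X[unfolded add.assoc] st(1) by argo
  with Y' show ?thesis by linarith
qed

text \<open>The root of the constant is replaced by \<open>1 + r\<close>, so that all constants stay
  linear and can be compared with \<open>hidden_factor\<close>.\<close>

lemma sum_sqrt_budget:
  fixes S :: "nat \<Rightarrow> real"
  assumes S: "\<And>k. k \<in> {1..K} \<Longrightarrow> 0 \<le> S k" "(\<Sum>k=1..K. S k) \<le> r * T" and rT: "0 \<le> r" "0 \<le> T"
  shows "(\<Sum>k=1..K. sqrt (S k)) \<le> (1 + r) * sqrt (real K * T)"
proof -
  have "(\<Sum>k=1..K. sqrt (S k)) \<le> sqrt (real (card {1..K}) * (\<Sum>k=1..K. S k))"
    using S(1) by (rule sum_sqrt_le)
  also have "\<dots> \<le> sqrt (r * (real K * T))"
    using mult_left_mono[OF S(2), of "real K"] by (intro real_sqrt_le_mono) (simp add: mult_ac)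
  also have "\<dots> = sqrt r * sqrt (real K * T)" by (rule real_sqrt_mult)
  also have "\<dots> \<le> (1 + r) * sqrt (real K * T)"
    using arith_geo_mean_sqrt[of 1 r] rT by (intro mult_right_mono) auto
  finally show ?thesis .
qed

lemma sum_sq_gap_le:
  fixes gap s :: "nat \<Rightarrow> nat \<Rightarrow> real"
  assumes gap: "\<And>k h. k \<in> {1..K} \<Longrightarrow> h \<in> {1..H} \<Longrightarrow> gap k h \<le> sqrt (s k h)"
    and s: "\<And>k h. k \<in> {1..K} \<Longrightarrow> h \<in> {1..H} \<Longrightarrow> 0 \<le> s k h"
      "\<And>h. h \<in> {1..H} \<Longrightarrow> (\<Sum>k=1..K. s k h) \<le> r * B"
    and rB: "0 \<le> r" "0 \<le> B"
  shows "(\<Sum>k=1..K. \<Sum>h=1..H. gap k h) \<le> (1 + r) * (real H * sqrt (real K * B))"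
proof -
  have "(\<Sum>k=1..K. gap k h) \<le> (1 + r) * sqrt (real K * B)" if h: "h \<in> {1..H}" for h
    using gap h by (intro order_trans[OF sum_mono sum_sqrt_budget[OF s(1)[OF _ h] s(2)[OF h] rB]])
  then have "(\<Sum>h=1..H. \<Sum>k=1..K. gap k h) \<le> (\<Sum>h=1..H. (1 + r) * sqrt (real K * B))" by (rule sum_mono)
  then show ?thesis by (subst sum.swap) (simp add: mult_ac)
qed

text \<open>The budgets hold per step, so summing \<open>H\<close> steps with the extra factor
  \<open>H\<close> from Cauchy-Schwarz gives \<open>H^2 * B\<close>; its root yields the leading
  \<open>H\<close>.\<close>

lemma sum_bce_round_le:
  fixes X Y :: "nat \<Rightarrow> real" and s s' :: "nat \<Rightarrow> nat \<Rightarrow> real"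
  assumes H: "1 \<le> H" and B: "0 \<le> B" and V: "0 \<le> V" and r: "0 \<le> r" "0 \<le> r'"
    and X: "\<And>k. k \<in> {1..K} \<Longrightarrow> 0 \<le> X k"
      "\<And>k. k \<in> {1..K} \<Longrightarrow> X k \<le> 6 * sqrt (real H * (\<Sum>h=1..H. s k h) * (V + 2 * X k + Y k)) + 4 * (\<Sum>h=1..H. s k h)"
    and Y: "\<And>k. k \<in> {1..K} \<Longrightarrow> 0 \<le> Y k"
      "\<And>k. k \<in> {1..K} \<Longrightarrow> Y k \<le> 6 * sqrt (real H * (\<Sum>h=1..H. s' k h) * (V + Y k)) + 4 * (\<Sum>h=1..H. s' k h)"
    and s: "\<And>k h. k \<in> {1..K} \<Longrightarrow> h \<in> {1..H} \<Longrightarrow> 0 \<le> s k h"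
      "\<And>h. h \<in> {1..H} \<Longrightarrow> (\<Sum>k=1..K. s k h) \<le> r * B"
    and s': "\<And>k h. k \<in> {1..K} \<Longrightarrow> h \<in> {1..H} \<Longrightarrow> 0 \<le> s' k h"
      "\<And>h. h \<in> {1..H} \<Longrightarrow> (\<Sum>k=1..K. s' k h) \<le> r' * B"
  shows "(\<Sum>k=1..K. X k + Y k) \<le> (12 * (1 + r) + 18 * (1 + r')) * (real H * sqrt (V * real K * B))
    + (80 * r + 66 * r') * ((real H)\<^sup>2 * B)"
proof -
  define S S' where "S k = real H * (\<Sum>h=1..H. s k h)" and "S' k = real H * (\<Sum>h=1..H. s' k h)" for k
  have budget: "(\<Sum>k=1..K. real H * (\<Sum>h=1..H. u k h)) \<le> c * ((real H)\<^sup>2 * B)"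
      "(\<Sum>k=1..K. sqrt (real H * (\<Sum>h=1..H. u k h) * V)) \<le> (1 + c) * (real H * sqrt (V * real K * B))"
    if u: "\<forall>k\<in>{1..K}. \<forall>h\<in>{1..H}. 0 \<le> u k h" "\<forall>h\<in>{1..H}. (\<Sum>k=1..K. u k h) \<le> c * B"
      and c: "0 \<le> c" for u c
  proof -
    have "(\<Sum>k=1..K. \<Sum>h=1..H. u k h) \<le> (\<Sum>h=1..H. c * B)" using u(2) by (subst sum.swap) (intro sum_mono, blast)
    from mult_left_mono[OF this, of "real H"]
    show 1: "(\<Sum>k=1..K. real H * (\<Sum>h=1..H. u k h)) \<le> c * ((real H)\<^sup>2 * B)"
      by (simp add: sum_distrib_left power2_eq_square mult_ac)
    have "(\<Sum>k=1..K. real H * (\<Sum>h=1..H. u k h) * V) \<le> c * ((real H)\<^sup>2 * B * V)"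
      unfolding sum_distrib_right[symmetric] using mult_right_mono[OF 1 V] by (simp add: mult_ac)
    then have "(\<Sum>k=1..K. sqrt (real H * (\<Sum>h=1..H. u k h) * V)) \<le> (1 + c) * sqrt (real K * ((real H)\<^sup>2 * B * V))"
      using u(1) V B c by (intro sum_sqrt_budget) (auto intro!: mult_nonneg_nonneg sum_nonneg)
    also have "sqrt (real K * ((real H)\<^sup>2 * B * V)) = real H * sqrt (V * real K * B)"
      by (simp add: real_sqrt_mult)
    finally show "(\<Sum>k=1..K. sqrt (real H * (\<Sum>h=1..H. u k h) * V)) \<le> (1 + c) * (real H * sqrt (V * real K * B))" .
  qed
  have "(\<Sum>k=1..K. X k + Y k) \<le> (\<Sum>k=1..K. 12 * sqrt (S k * V) + 18 * sqrt (S' k * V) + 80 * S k + 66 * S' k)"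
    unfolding S_def S'_def using X Y V H s(1) s'(1) by (intro sum_mono bce_round_bound) (auto intro!: sum_nonneg)
  also have "\<dots> = 12 * (\<Sum>k=1..K. sqrt (S k * V)) + 18 * (\<Sum>k=1..K. sqrt (S' k * V))
      + 80 * (\<Sum>k=1..K. S k) + 66 * (\<Sum>k=1..K. S' k)"
    by (simp only: sum.distrib sum_distrib_left)
  also have "\<dots> \<le> 12 * ((1 + r) * (real H * sqrt (V * real K * B))) + 18 * ((1 + r') * (real H * sqrt (V * real K * B)))
      + 80 * (r * ((real H)\<^sup>2 * B)) + 66 * (r' * ((real H)\<^sup>2 * B))"
  proof -
    have "\<forall>k\<in>{1..K}. \<forall>h\<in>{1..H}. 0 \<le> s k h" "\<forall>h\<in>{1..H}. (\<Sum>k=1..K. s k h) \<le> r * B"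
      "\<forall>k\<in>{1..K}. \<forall>h\<in>{1..H}. 0 \<le> s' k h" "\<forall>h\<in>{1..H}. (\<Sum>k=1..K. s' k h) \<le> r' * B"
      using s s' by blast+
    then show ?thesis
      using budget[of s r] budget[of s' r'] r unfolding S_def S'_def by linarith
  qed
  finally show ?thesis by (simp only: distrib_right mult.assoc add.assoc)
qed

text \<open>The left side dominates the coefficients of both losses: \<open>30 = 12 + 18\<close>,
  \<open>200 = 80 * 5 / 2\<close> and \<open>33 = 66 / 2\<close> come from
  \<open>sum_bce_round_le\<close>. The logarithm passes to its square because
  \<open>1 + ln K \<ge> 1\<close>.\<close>

lemma hidden_factor_ge:
  assumes "1 \<le> K" "0 < c0"
  shows "30 + 200 * (1 + ln (real K)) + 33 * (1 / c0) \<le> hidden_factor c0 K"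
proof -
  define L where "L = 1 + ln (real K)"
  have L: "1 \<le> L" using assms by (simp add: L_def)
  have L2: "1 \<le> L\<^sup>2" "L \<le> L\<^sup>2" using L one_le_power[OF L, of 2] by (simp_all add: power2_eq_square)
  have "1 / c0 \<le> 1 / c0 * L\<^sup>2" "0 \<le> 1 / c0 * L\<^sup>2" using assms L2 by (simp_all add: divide_right_mono)
  moreover have "hidden_factor c0 K = 1000 * L\<^sup>2 + 1000 * (1 / c0 * L\<^sup>2)"
    unfolding hidden_factor_def L_def by (simp only: distrib_left distrib_right mult.assoc mult_1_right mult_1_left)
  ultimately show ?thesis using L2 L unfolding L_def[symmetric] by linarith
qed

section \<open>Regret bound\<close>

lemma le_the_enat_Max:
  assumes "finite A" "h \<in> A" "enat c \<le> f h" "\<And>i. i \<in> A \<Longrightarrow> f i \<noteq> \<infinity>"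
  shows "c \<le> the_enat (MAX i\<in>A. f i)"
proof -
  have "(MAX i\<in>A. f i) \<in> f ` A" using assms by (intro Max_in) auto
  then obtain m where m: "(MAX i\<in>A. f i) = enat m" using assms(4) by fastforce
  have "f h \<le> (MAX i\<in>A. f i)" using assms(1,2) by (intro Max_ge) auto
  then have "enat c \<le> (MAX i\<in>A. f i)" using assms(3) by (rule order_trans[rotated])
  then show ?thesis using m by simp
qed

lemma eluder_order_pos: "1 \<le> eluder_order l"
  by (cases l) auto

lemma residual_self: "residual l u u = 0"
  by (cases l) auto

lemma residual_nonneg: "0 \<le> residual l u v"
  by (cases l) auto

section \<open>Action averaging and coverage\<close>

context bellman_complete_class
begin

lemma finite_residual_class: "finite (residual_class M F l h)" "finite (residual_class_V M F l h)"
proof -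
  have "residual_class M F l h = (\<lambda>f xa. residual_at f h xa) ` F"
    by (auto simp: residual_class_def)
  then show "finite (residual_class M F l h)" using fun_class by (simp add: function_class_def)
  moreover have "residual_class_V M F l h = (\<lambda>\<psi> x. \<integral>a. \<psi> (x, a) \<partial>uniform_count_measure UNIV) ` residual_class M F l h"
    by (auto simp: residual_class_V_def)
  ultimately show "finite (residual_class_V M F l h)" by simp
qed

lemma le_eluder_Q:
  assumes "1 \<le> K" "h \<in> {1..hor M}"
    and "enat c \<le> eluder_dim (eluder_order l) (residual_class M F l h) {occ M \<pi> h | \<pi>. is_policy M \<pi>} (1 / real K)"
  shows "c \<le> the_enat (eluder_Q M F l K)"
  unfolding eluder_Q_def
proof (rule le_the_enat_Max[where h=h])
  fix i
  show "eluder_dim (eluder_order l) (residual_class M F l i) {occ M \<pi> i | \<pi>. is_policy M \<pi>} (1 / real K) \<noteq> \<infinity>"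
    using assms(1) by (intro eluder_dim_finite finite_residual_class eluder_order_pos) simp
qed (use assms in simp_all)

lemma le_eluder_V:
  assumes "1 \<le> K" "h \<in> {1..hor M}"
    and "enat c \<le> eluder_dim (eluder_order l) (residual_class_V M F l h) {occ_obs M \<pi> h | \<pi>. is_policy M \<pi>} (1 / real K)"
  shows "c \<le> the_enat (eluder_V M F l K)"
  unfolding eluder_V_def
proof (rule le_the_enat_Max[where h=h])
  fix i
  show "eluder_dim (eluder_order l) (residual_class_V M F l i) {occ_obs M \<pi> i | \<pi>. is_policy M \<pi>} (1 / real K) \<noteq> \<infinity>"
    using assms(1) by (intro eluder_dim_finite finite_residual_class eluder_order_pos) simp
qed (use assms in simp_all)

text \<open>Uniform queries control the action-averaged residual, while the executed policy pays for
  its chosen action. A nonnegative value at one action is at most the sum over all actions, hence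
  \<open>CARD('a)\<close> times the average: the origin of the factor \<open>A\<close>.\<close>

lemma mean_residual_uniform:
  assumes \<pi>: "is_policy M \<pi>" and f: "admissible f" and h: "h \<in> {1..hor M}"
  defines "v \<equiv> \<lambda>x. \<integral>a. residual l (f h (x, a)) (backup f h (x, a)) \<partial>uniform_count_measure UNIV"
  shows "mean_residual (online_query True \<pi> h) f h = (\<integral>x. v x \<partial>occ_obs M \<pi> h)"
    and "mean_residual (occ M \<pi> h) f h \<le> real CARD('a) * (\<integral>x. v x \<partial>occ_obs M \<pi> h)"
proof -
  let ?U = "uniform_count_measure UNIV :: 'a measure"
  let ?r = "\<lambda>xa. residual_at f h xa"
  note O = prob_algebraD[OF occ_space(2)[OF \<pi> h]] and U = prob_algebraD[OF uniform_space]
  interpret pair_sigma_finite "occ_obs M \<pi> h" ?U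
    unfolding pair_sigma_finite_def using O(1) U(1) by (simp add: prob_space_imp_sigma_finite)
  have q: "online_query True \<pi> h = occ_obs M \<pi> h \<Otimes>\<^sub>M ?U" by (simp add: online_query_def)
  have int: "integrable (occ_obs M \<pi> h \<Otimes>\<^sub>M ?U) ?r"
    using residual_integrable(1)[OF f h online_query_space[OF \<pi> h, of True]] by (simp add: q)
  show "mean_residual (online_query True \<pi> h) f h = (\<integral>x. v x \<partial>occ_obs M \<pi> h)"
    unfolding mean_residual_def q v_def by (rule integral_fst'[OF int, symmetric])
  have v: "v x = (\<Sum>a\<in>UNIV. ?r (x, a)) / real CARD('a)" for x
    unfolding v_def by (rule integral_uniform_count_measure) simp
  have r: "0 \<le> ?r xa" "?r xa \<le> 1" for xa
    using residual_bounds admissibleD(2,6)[OF f h] by auto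
  have le: "?r xa \<le> real CARD('a) * v (fst xa)" for xa
    using member_le_sum[of "snd xa" UNIV "\<lambda>a. ?r (fst xa, a)"] r by (simp add: v)
  note [measurable] = admissibleD(1,5)[OF f h]
  have rm: "?r \<in> borel_measurable (obs_act M)" by measurable
  have vm: "v \<in> borel_measurable X"
  proof -
    have [measurable]: "(\<lambda>x. ?r (x, a)) \<in> borel_measurable X" for a
      by (rule measurable_compose[OF _ rm]) measurable
    show ?thesis unfolding v[abs_def] by measurable
  qed
  have vb: "0 \<le> v x \<and> v x \<le> 1" for x
  proof -
    have "(\<Sum>a\<in>UNIV. ?r (x, a)) \<le> (\<Sum>a\<in>(UNIV :: 'a set). 1)" using r by (intro sum_mono)
    then show ?thesis using r by (simp add: v sum_nonneg field_simps)
  qed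
  have [measurable]: "fst \<in> obs_act M \<rightarrow>\<^sub>M X" unfolding obs_act_def by measurable
  have "integrable (occ M \<pi> h) (\<lambda>xa. v (fst xa))"
    using vb vm by (intro integral_bounded(1)[OF occ_space(1)[OF \<pi> h], of _ 1] AE_I2) auto
  then have "mean_residual (occ M \<pi> h) f h \<le> (\<integral>xa. real CARD('a) * v (fst xa) \<partial>occ M \<pi> h)"
    unfolding mean_residual_def using le residual_integrable(1)[OF f h occ_space(1)[OF \<pi> h]]
    by (intro integral_mono) auto
  also have "\<dots> = real CARD('a) * (\<integral>x. v x \<partial>occ_obs M \<pi> h)"
    using integral_fst_occ[OF \<pi> h vm] by simp
  finally show "mean_residual (occ M \<pi> h) f h \<le> real CARD('a) * (\<integral>x. v x \<partial>occ_obs M \<pi> h)" .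
qed

text \<open>Finite coverage forces absolute continuity, since otherwise the coefficient is infinite
  by definition; the density is then almost everywhere at most the coefficient.\<close>

lemma occ_le_coverage:
  assumes \<pi>: "is_policy M \<pi>" and h: "h \<in> {1..hor M}" and cov: "coverage M \<nu> \<pi> < \<infinity>"
    and \<nu>: "\<nu> h \<in> space (prob_algebra (obs_act M))" and G: "G \<in> borel_measurable (obs_act M)"
  shows "(\<integral>\<^sup>+xa. G xa \<partial>occ M \<pi> h) \<le> ennreal (enn2real (coverage M \<nu> \<pi>)) * (\<integral>\<^sup>+xa. G xa \<partial>\<nu> h)"
proof -
  note O = prob_algebraD[OF occ_space(1)[OF \<pi> h]] and N = prob_algebraD[OF \<nu>]
  interpret prob_space "\<nu> h" by (rule N)
  let ?c = "\<lambda>h. if absolutely_continuous (\<nu> h) (occ M \<pi> h)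
     then esssup (\<nu> h) (RN_deriv (\<nu> h) (occ M \<pi> h)) else \<infinity>"
  have le: "?c h \<le> coverage M \<nu> \<pi>"
    unfolding coverage_def using h by (intro Max_ge) auto
  then have ac: "absolutely_continuous (\<nu> h) (occ M \<pi> h)" and ess: "esssup (\<nu> h) (RN_deriv (\<nu> h) (occ M \<pi> h)) \<le> coverage M \<nu> \<pi>"
    using cov by (auto split: if_splits)
  have "AE xa in \<nu> h. RN_deriv (\<nu> h) (occ M \<pi> h) xa \<le> coverage M \<nu> \<pi>"
    using esssup_AE[of "RN_deriv (\<nu> h) (occ M \<pi> h)" "\<nu> h"] by eventually_elim (use ess in \<open>auto intro: order_trans\<close>)
  then have ae: "AE xa in \<nu> h. RN_deriv (\<nu> h) (occ M \<pi> h) xa * G xa \<le> coverage M \<nu> \<pi> * G xa"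
    by eventually_elim (rule mult_right_mono, auto)
  have Gm: "G \<in> borel_measurable (\<nu> h)" using G by (simp add: measurable_cong_sets[OF N(2) refl])
  have "(\<integral>\<^sup>+xa. G xa \<partial>occ M \<pi> h) = (\<integral>\<^sup>+xa. RN_deriv (\<nu> h) (occ M \<pi> h) xa * G xa \<partial>\<nu> h)"
    using O(2) N(2) Gm by (intro RN_deriv_nn_integral ac) auto
  also have "\<dots> \<le> (\<integral>\<^sup>+xa. coverage M \<nu> \<pi> * G xa \<partial>\<nu> h)" using ae by (rule nn_integral_mono_AE)
  also have "\<dots> = coverage M \<nu> \<pi> * (\<integral>\<^sup>+xa. G xa \<partial>\<nu> h)" using Gm by (rule nn_integral_cmult)
  finally show ?thesis using cov by (simp add: ennreal_enn2real_if less_top)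
qed

text \<open>A density between probability measures cannot stay below a constant less than one: test
  with the function \<open>1\<close>. Used to absorb the additive \<open>1\<close> of the eluder
  sum.\<close>

lemma coverage_ge_1:
  assumes \<pi>: "is_policy M \<pi>" and cov: "coverage M \<nu> \<pi> < \<infinity>"
    and \<nu>: "\<nu> 1 \<in> space (prob_algebra (obs_act M))"
  shows "1 \<le> enn2real (coverage M \<nu> \<pi>)"
proof -
  have h: "1 \<in> {1..hor M}" using horizon_pos by simp
  have "ennreal 1 \<le> ennreal (enn2real (coverage M \<nu> \<pi>))"
    using occ_le_coverage[OF \<pi> h cov \<nu>, of "\<lambda>_. 1"]
      prob_space.emeasure_space_1[OF prob_algebraD(1)[OF occ_space(1)[OF \<pi> h]]]
      prob_space.emeasure_space_1[OF prob_algebraD(1)[OF \<nu>]] by simp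
  then show ?thesis by (subst (asm) ennreal_le_iff) auto
qed

lemma mean_residual_le_coverage:
  assumes \<pi>: "is_policy M \<pi>" and f: "admissible f" and h: "h \<in> {1..hor M}" and cov: "coverage M \<nu> \<pi> < \<infinity>"
    and \<nu>: "\<nu> h \<in> space (prob_algebra (obs_act M))"
  shows "mean_residual (occ M \<pi> h) f h \<le> enn2real (coverage M \<nu> \<pi>) * mean_residual (\<nu> h) f h"
proof -
  note [measurable] = admissibleD(1,5)[OF f h]
  note r = residual_integrable[OF f h occ_space(1)[OF \<pi> h]] residual_integrable[OF f h \<nu>]
  have "ennreal (mean_residual (occ M \<pi> h) f h) \<le> ennreal (enn2real (coverage M \<nu> \<pi>)) * ennreal (mean_residual (\<nu> h) f h)"
    unfolding r(4,8) by (rule occ_le_coverage[OF \<pi> h cov \<nu>]) measurable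
  then have "ennreal (mean_residual (occ M \<pi> h) f h) \<le> ennreal (enn2real (coverage M \<nu> \<pi>) * mean_residual (\<nu> h) f h)"
    using r(6) by (simp add: ennreal_mult)
  then show ?thesis using r(6) by (subst (asm) ennreal_le_iff) auto
qed

text \<open>Completeness puts the Bellman image in a class with one element, so it coincides with
  the function. This covers \<open>card F = 1\<close>, where \<open>\<beta>\<close> can be
  arbitrarily small.\<close>

lemma singleton_residual:
  assumes "card F = 1" and f: "admissible f" and h: "h \<in> {1..hor M}"
  shows "mean_residual \<mu> f h = 0"
proof -
  obtain f0 where F: "F = {f0}" using assms(1) by (rule card_1_singletonE)
  have "f h \<in> component F h" "backup f h \<in> component F h"
    using f h by (auto simp: admissible_def intro!: bellman_component)
  then have "f h = backup f h" by (auto simp: F component_def)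
  then show ?thesis by (simp add: mean_residual_def residual_self)
qed

end

section \<open>From residual sums to regret\<close>

context hybrid_interaction
begin

lemma residual_sum_le:
  assumes a: "1 \<le> a" and D: "D \<in> confident a" and k: "k \<in> {1..K}" and h: "h \<in> {1..hor M}"
  shows "(\<Sum>i\<in>{1..<k}. mean_residual (queries h i D) (fitted k D) h) \<le> slack l * ln a"
    and "real (n h) * mean_residual (\<nu> h) (fitted k D) h \<le> slack l * ln a"
proof -
  have DK: "D \<in> space (Hist K)" using D by (simp add: confident_def)
  note f = fitted_component(4)[OF DK k]
  have "queries h i D \<in> space (prob_algebra (obs_act M))" if "i \<in> {1..<k}" for i
    using that k h DK by (intro queries_space[of _ K]) auto
  then have nn: "0 \<le> (\<Sum>i\<in>{1..<k}. rate (fitted k D) h (queries h i D))"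
    by (intro sum_nonneg rate_bounds(1)[OF f h])
  have nn': "0 \<le> real (n h) * rate (fitted k D) h (\<nu> h)"
    using rate_bounds(1)[OF f h \<nu>_space[OF h]] by simp
  have "real (n h) * rate (fitted k D) h (\<nu> h) + (\<Sum>i\<in>{1..<k}. rate (fitted k D) h (queries h i D)) \<le> ln a"
    using a by (intro rate_sum_le D k h) simp
  then have "(\<Sum>i\<in>{1..<k}. rate (fitted k D) h (queries h i D)) \<le> ln a" "real (n h) * rate (fitted k D) h (\<nu> h) \<le> ln a"
    using nn nn' by linarith+
  then show "(\<Sum>i\<in>{1..<k}. mean_residual (queries h i D) (fitted k D) h) \<le> slack l * ln a"
    and "real (n h) * mean_residual (\<nu> h) (fitted k D) h \<le> slack l * ln a"
    using slack_pos[of l] by (simp_all add: rate_def field_simps flip: sum_divide_distrib)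
qed

text \<open>The eluder sum gives \<open>1 + d + R * d * L\<close>. The terms free of
  \<open>R\<close> are absorbed using \<open>1 \<le> C\<close> and \<open>1 \<le> \<beta>\<close>,
  the latter only for \<open>card F \<noteq> 1\<close>; hence the case split.\<close>

lemma online_residual_le:
  assumes K: "1 \<le> K" and a: "1 \<le> a" and D: "D \<in> confident a" and h: "h \<in> {1..hor M}"
    and big: "card F \<noteq> 1 \<Longrightarrow> 1 \<le> 2 * ln a" and C: "1 \<le> C"
  shows "(\<Sum>k=1..K. mean_residual (occ M (policy k D) h) (fitted k D) h)
    \<le> (2 + slack l / 2) * ((dim_term M F l ua K + C) * (2 * ln a)) * (1 + ln (real K))"
proof (cases "card F = 1")
  case True
  have DK: "D \<in> space (Hist K)" using D by (simp add: confident_def)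
  have "(\<Sum>k=1..K. mean_residual (occ M (policy k D) h) (fitted k D) h) = 0"
    using singleton_residual[OF True fitted_component(4)[OF DK] h] by (intro sum.neutral) auto
  moreover have "0 \<le> dim_term M F l ua K" by (simp add: dim_term_def)
  ultimately show ?thesis using a K C slack_pos[of l] by simp
next
  case False
  have DK: "D \<in> space (Hist K)" using D by (simp add: confident_def)
  note fc = fitted_component[OF DK]
  define L where "L = 1 + ln (real K)"
  define \<beta> where "\<beta> = 2 * ln a"
  define R where "R = slack l * ln a"
  have L: "1 \<le> L" using K by (simp add: L_def)
  have \<beta>: "1 \<le> \<beta>" using big False by (simp add: \<beta>_def)
  have R: "0 \<le> R" "R = slack l / 2 * \<beta>" using a slack_pos[of l] by (simp_all add: R_def \<beta>_def)
  define \<psi> where "\<psi> k xa = residual l (fitted k D h xa) (bellman M h (fitted k D (Suc h)) xa)" for k xa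
  define v where "v k x = (\<integral>a. \<psi> k (x, a) \<partial>uniform_count_measure UNIV)" for k x
  have \<psi>_class: "\<psi> k \<in> residual_class M F l h" if k: "k \<in> {1..K}" for k
  proof -
    obtain g where "g \<in> F" "g h = fitted k D h" "g (Suc h) = fitted k D (Suc h)"
      using class_representative[OF fc(4)[OF k] h] .
    then show ?thesis unfolding residual_class_def \<psi>_def[abs_def] by (intro CollectI exI[of _ g]) simp
  qed
  have mr: "mean_residual \<mu> (fitted k D) h = (\<integral>xa. \<psi> k xa \<partial>\<mu>)" for k \<mu>
    by (simp add: mean_residual_def \<psi>_def)
  have q: "queries h i D = online_query ua (policy i D) h" for i by (simp add: queries_def)
  have sum_le: "(\<Sum>k=1..K. mean_residual (occ M (policy k D) h) (fitted k D) h) \<le> 2 * dim_term M F l ua K + C + R * dim_term M F l ua K * L"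
  proof (cases ua)
    case False
    define d where "d = real (the_enat (eluder_Q M F l K))"
    have "(\<Sum>k=1..K. \<integral>xa. \<psi> k xa \<partial>occ M (policy k D) h) \<le> 1 + d + R * d * (1 + ln (real K))"
    proof (rule sum_eluder_le[where q="eluder_order l" and \<Psi>="residual_class M F l h", OF K eluder_order_pos R(1)])
      show "0 \<le> (\<integral>xa. \<psi> k xa \<partial>occ M (policy i D) h)" for k i
        by (rule integral_nonneg_AE) (simp add: \<psi>_def residual_nonneg)
      show "occ M (policy k D) h \<in> {occ M \<pi> h | \<pi>. is_policy M \<pi>}" if "k \<in> {1..K}" for k
        using fc(5)[OF that] by blast
      show "(\<integral>xa. \<psi> k xa \<partial>occ M (policy k D) h) \<le> 1" if "k \<in> {1..K}" for k
        using residual_integrable(3)[OF fc(4)[OF that] h occ_space(1)[OF fc(5)[OF that] h]] by (simp add: mr)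
      have "queries h i D = occ M (policy i D) h" for i
        unfolding q online_query_def using False by simp
      then show "(\<Sum>i\<in>{1..<k}. \<integral>xa. \<psi> k xa \<partial>occ M (policy i D) h) \<le> R" if "k \<in> {1..K}" for k
        using residual_sum_le(1)[OF a D that h] unfolding mr R_def by simp
    qed (auto simp: d_def intro: \<psi>_class le_eluder_Q[OF K h])
    moreover have "dim_term M F l ua K = d" "0 \<le> d" using False by (simp_all add: dim_term_def d_def)
    ultimately show ?thesis using C by (simp add: mr L_def)
  next
    case True
    define d where "d = real (the_enat (eluder_V M F l K))"
    let ?A = "real CARD('a)"
    note U = mean_residual_uniform[OF fc(5) fc(4) h, folded \<psi>_def v_def]
    have "(\<Sum>k=1..K. \<integral>x. v k x \<partial>occ_obs M (policy k D) h) \<le> 1 + d + R * d * (1 + ln (real K))"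
    proof (rule sum_eluder_le[OF K eluder_order_pos R(1)])
      show "0 \<le> (\<integral>x. v k x \<partial>occ_obs M (policy i D) h)" for k i
        by (intro integral_nonneg_AE AE_I2) (simp add: v_def \<psi>_def residual_nonneg)
      show "occ_obs M (policy k D) h \<in> {occ_obs M \<pi> h | \<pi>. is_policy M \<pi>}" if "k \<in> {1..K}" for k
        using fc(5)[OF that] by blast
      show "v k \<in> residual_class_V M F l h" if "k \<in> {1..K}" for k
        unfolding residual_class_V_def v_def[abs_def] using \<psi>_class that by blast
      show "(\<integral>x. v k x \<partial>occ_obs M (policy k D) h) \<le> 1" if k: "k \<in> {1..K}" for k
        using residual_integrable(3)[OF fc(4)[OF k] h online_query_space[OF fc(5)[OF k] h, of True]]
        unfolding U(1)[OF k k] .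
      show "(\<Sum>i\<in>{1..<k}. \<integral>x. v k x \<partial>occ_obs M (policy i D) h) \<le> R" if k: "k \<in> {1..K}" for k
      proof -
        have "(\<integral>x. v k x \<partial>occ_obs M (policy i D) h) = mean_residual (queries h i D) (fitted k D) h" if "i \<in> {1..<k}" for i
        proof -
          have "i \<in> {1..K}" using that k by auto
          moreover have "queries h i D = online_query True (policy i D) h" unfolding q using True by simp
          ultimately show ?thesis using U(1)[OF _ k] by simp
        qed
        then show ?thesis using residual_sum_le(1)[OF a D k h] by (simp add: R_def)
      qed
    qed (auto simp: d_def intro: le_eluder_V[OF K h])
    then have "?A * (\<Sum>k=1..K. \<integral>x. v k x \<partial>occ_obs M (policy k D) h) \<le> ?A * (1 + d + R * d * L)"
      unfolding L_def by (rule mult_left_mono) simp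
    moreover have "(\<Sum>k=1..K. mean_residual (occ M (policy k D) h) (fitted k D) h)
        \<le> ?A * (\<Sum>k=1..K. \<integral>x. v k x \<partial>occ_obs M (policy k D) h)"
      unfolding sum_distrib_left using U(2) by (intro sum_mono)
    \<comment> \<open>The factor \<open>A\<close> also multiplies the additive \<open>1\<close>; the
      maximum with \<open>1\<close> in \<open>dim_term\<close> pays for it.\<close>
    moreover have "?A * (1 + d + R * d * L) \<le> 2 * dim_term M F l ua K + R * dim_term M F l ua K * L"
    proof -
      define A where "A = ?A"
      have A: "0 \<le> A" by (simp add: A_def)
      have e: "dim_term M F l ua K = A * max 1 d" using True by (simp add: dim_term_def d_def A_def)
      have m: "A * 1 \<le> A * max 1 d" "A * d \<le> A * max 1 d" by (intro mult_left_mono A max.cobounded1 max.cobounded2)+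
      have "R * L * (A * d) \<le> R * L * (A * max 1 d)"
        by (rule mult_left_mono[OF m(2)]) (use R L in simp)
      then show ?thesis using m unfolding e A_def[symmetric] by (simp add: algebra_simps)
    qed
    ultimately show ?thesis using C by linarith
  qed
  also have "\<dots> \<le> (2 + slack l / 2) * ((dim_term M F l ua K + C) * \<beta>) * L"
  proof -
    define d where "d = dim_term M F l ua K"
    have d: "0 \<le> d" by (simp add: d_def dim_term_def)
    have "1 * (d + C) \<le> (\<beta> * L) * (d + C)"
      using d C \<beta> L mult_mono[of 1 \<beta> 1 L] by (intro mult_right_mono) auto
    then have "d + C \<le> (d + C) * \<beta> * L" by (simp add: mult_ac)
    then have 1: "2 * d + C \<le> 2 * ((d + C) * \<beta> * L)" using C by linarith
    have "R * d * L \<le> R * (d + C) * L" using R L C by (intro mult_right_mono mult_left_mono) auto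
    then have 2: "R * d * L \<le> slack l / 2 * ((d + C) * \<beta> * L)" unfolding R(2) by (simp add: mult_ac)
    have "(2 + slack l / 2) * ((d + C) * \<beta>) * L = 2 * ((d + C) * \<beta> * L) + slack l / 2 * ((d + C) * \<beta> * L)"
      by (simp add: algebra_simps)
    then show ?thesis unfolding d_def[symmetric] using 1 2 by linarith
  qed
  finally show ?thesis unfolding \<beta>_def L_def .
qed

text \<open>The offline samples make the residual under \<open>\<nu> h\<close> of order
  \<open>ln a / (c0 * K)\<close> in every single round, so summing the rounds cancels
  \<open>K\<close>.\<close>

lemma offline_residual_le:
  assumes a: "1 \<le> a" and D: "D \<in> confident a" and k: "k \<in> {1..K}" and h: "h \<in> {1..hor M}"
    and c0: "0 < c0" "c0 * real K \<le> real (n h)"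
    and \<pi>: "is_policy M \<pi>" and cov: "coverage M \<nu> \<pi> < \<infinity>"
  shows "mean_residual (occ M \<pi> h) (fitted k D) h \<le> slack l / 2 * (enn2real (coverage M \<nu> \<pi>) * (2 * ln a)) / (c0 * real K)"
proof -
  have DK: "D \<in> space (Hist K)" using D by (simp add: confident_def)
  note f = fitted_component(4)[OF DK k] and \<nu> = \<nu>_space[OF h]
  define m where "m = mean_residual (\<nu> h) (fitted k D) h"
  have m: "0 \<le> m" using residual_integrable(2)[OF f h \<nu>] by (simp add: m_def)
  have cK: "0 < c0 * real K" using c0 k by simp
  have "c0 * real K * m \<le> real (n h) * m" using c0(2) m by (rule mult_right_mono)
  also have "\<dots> \<le> slack l * ln a" using residual_sum_le(2)[OF a D k h] by (simp add: m_def)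
  finally have "m \<le> slack l * ln a / (c0 * real K)" using cK by (simp add: field_simps)
  then have "enn2real (coverage M \<nu> \<pi>) * m \<le> enn2real (coverage M \<nu> \<pi>) * (slack l * ln a / (c0 * real K))"
    by (rule mult_left_mono) simp
  then show ?thesis
    using mean_residual_le_coverage[OF \<pi> f h cov \<nu>] by (simp add: m_def mult_ac)
qed

text \<open>Both policies are compared with the predicted initial value
  \<open>vmin (f 1) (init M)\<close>, which cancels.\<close>

lemma value_gap_round:
  assumes D: "D \<in> space (Hist K)" and \<pi>: "is_policy M \<pi>'" and k: "k \<in> {1..K}"
  shows "policy_value M (policy k D) \<le> policy_value M \<pi>' + (\<Sum>h=1..hor M. gap (policy k D) (fitted k D) h)
    + (\<Sum>h=1..hor M. gap \<pi>' (fitted k D) h)"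
  using greedy_value_bound[OF fitted_component(5,4,2)[OF D k]] value_bounds(1)[OF \<pi> fitted_component(4)[OF D k]]
  by linarith

lemma regret_bound:
  assumes K: "1 \<le> K" and a: "1 \<le> a" and D: "D \<in> confident a"
    and big: "card F \<noteq> 1 \<Longrightarrow> 1 \<le> 2 * ln a"
    and c0: "0 < c0" "\<And>h. h \<in> {1..hor M} \<Longrightarrow> c0 * real K \<le> real (n h)"
    and \<pi>: "is_policy M \<pi>'" and cov: "coverage M \<nu> \<pi>' < \<infinity>"
  defines "B \<equiv> (dim_term M F l ua K + enn2real (coverage M \<nu> \<pi>')) * (2 * ln a)"
  shows "l = Sq \<Longrightarrow> regret M pol K D \<pi>' \<le> hidden_factor c0 K * (real (hor M) * sqrt (real K * B))"
    and "l = Bce \<Longrightarrow> regret M pol K D \<pi>' \<le> hidden_factor c0 K *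
      (real (hor M) * sqrt (policy_value M \<pi>' * real K * B) + (real (hor M))\<^sup>2 * B)"
proof -
  have DK: "D \<in> space (Hist K)" using D by (simp add: confident_def)
  note fc = fitted_component[OF DK]
  define L where "L = 1 + ln (real K)"
  define C where "C = enn2real (coverage M \<nu> \<pi>')"
  define s where "s k h = mean_residual (occ M (policy k D) h) (fitted k D) h" for k h
  define s' where "s' k h = mean_residual (occ M \<pi>' h) (fitted k D) h" for k h
  have L: "1 \<le> L" using K by (simp add: L_def)
  have "1 \<in> {1..hor M}" using horizon_pos by simp
  then have C: "1 \<le> C" unfolding C_def using \<nu>_space by (intro coverage_ge_1 \<pi> cov) auto
  have d: "0 \<le> dim_term M F l ua K" by (simp add: dim_term_def)
  have B: "0 \<le> B" "C * (2 * ln a) \<le> B"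
    using d C a by (auto simp: B_def C_def intro!: mult_right_mono)
  have s: "0 \<le> s k h" if "k \<in> {1..K}" "h \<in> {1..hor M}" for k h
    unfolding s_def using that by (intro residual_integrable(2) fc(4) occ_space(1) fc(5))
  have s': "0 \<le> s' k h" if "k \<in> {1..K}" "h \<in> {1..hor M}" for k h
    unfolding s'_def using that by (intro residual_integrable(2) fc(4) occ_space(1) \<pi>)
  have on: "(\<Sum>k=1..K. s k h) \<le> (2 + slack l / 2) * L * B" if "h \<in> {1..hor M}" for h
    using online_residual_le[OF K a D that big C] by (simp add: s_def B_def C_def L_def mult_ac)
  define i where "i = 1 / c0"
  have i: "0 \<le> i" using c0 by (simp add: i_def)
  have off: "(\<Sum>k=1..K. s' k h) \<le> slack l / 2 * i * B" if h: "h \<in> {1..hor M}" for h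
  proof -
    have "(\<Sum>k=1..K. s' k h) \<le> (\<Sum>k=1..K. slack l / 2 * (C * (2 * ln a)) / (c0 * real K))"
      unfolding s'_def C_def using h c0 by (intro sum_mono offline_residual_le a D \<pi> cov)
    also have "\<dots> = slack l / 2 * i * (C * (2 * ln a))" using K c0 by (simp add: i_def)
    also have "\<dots> \<le> slack l / 2 * i * B"
      using B(2) slack_pos[of l] i by (intro mult_left_mono) auto
    finally show ?thesis .
  qed
  note hid = hidden_factor_ge[OF K c0(1), folded L_def i_def]
  define X Y where "X k = (\<Sum>h=1..hor M. gap (policy k D) (fitted k D) h)"
    and "Y k = (\<Sum>h=1..hor M. gap \<pi>' (fitted k D) h)" for k
  have reg: "regret M pol K D \<pi>' \<le> (\<Sum>k=1..K. X k + Y k)"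
    unfolding regret_def X_def Y_def using value_gap_round[OF DK \<pi>] by (intro sum_mono) (simp add: algebra_simps)
  {
    assume l: "l = Sq"
    define q where "q = real (hor M) * sqrt (real K * B)"
    have q: "0 \<le> q" using B by (simp add: q_def)
    \<comment> \<open>With \<open>slack Sq = 20\<close> the online budget factor
      \<open>2 + slack l / 2\<close> is \<open>12\<close> and the offline one,
      \<open>slack l / 2\<close>, is \<open>10\<close>.\<close>
    have "(\<Sum>k=1..K. X k) \<le> (1 + 12 * L) * q"
      unfolding X_def q_def
    proof (rule sum_sq_gap_le[OF _ s])
      show "gap (policy k D) (fitted k D) h \<le> sqrt (s k h)" if "k \<in> {1..K}" "h \<in> {1..hor M}" for k h
        unfolding s_def using that by (intro gap_le_sq l fc(4,5))
    qed (use on l L B in auto)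
    moreover have "(\<Sum>k=1..K. Y k) \<le> (1 + 10 * i) * q"
      unfolding Y_def q_def
    proof (rule sum_sq_gap_le[OF _ s'])
      show "gap \<pi>' (fitted k D) h \<le> sqrt (s' k h)" if "k \<in> {1..K}" "h \<in> {1..hor M}" for k h
        unfolding s'_def using that by (intro gap_le_sq l fc(4) \<pi>)
    qed (use off l i B in auto)
    moreover have "(1 + 12 * L) * q + (1 + 10 * i) * q \<le> hidden_factor c0 K * q"
      unfolding distrib_right[symmetric] using hid L i q by (intro mult_right_mono) linarith+
    ultimately show "regret M pol K D \<pi>' \<le> hidden_factor c0 K * (real (hor M) * sqrt (real K * B))"
      using reg unfolding sum.distrib q_def[symmetric] by linarith
  next
    assume l: "l = Bce"
    let ?V = "policy_value M \<pi>'"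
    have V: "0 \<le> ?V" using \<pi> by (rule policy_value_nonneg)
    define q where "q = real (hor M) * sqrt (?V * real K * B)"
    define p where "p = (real (hor M))\<^sup>2 * B"
    have pq: "0 \<le> q" "0 \<le> p" using B V by (simp_all add: q_def p_def)
    have X0: "0 \<le> X k" and Y0: "0 \<le> Y k" for k
      unfolding X_def Y_def by (auto intro!: sum_nonneg gap_nonneg)
    have "(\<Sum>k=1..K. X k + Y k) \<le> (12 * (1 + 5 / 2 * L) + 18 * (1 + 1 / 2 * i)) * q + (80 * (5 / 2 * L) + 66 * (1 / 2 * i)) * p"
      unfolding q_def p_def
    proof (rule sum_bce_round_le[where s=s and s'=s', OF horizon_pos B(1) V _ _ X0 _ Y0 _ s _ s'])
      fix k assume k: "k \<in> {1..K}"
      \<comment> \<open>The mean estimate along the executed policy is at most its value plus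
        \<open>X k\<close>, and that value is at most \<open>?V + X k + Y k\<close>; hence
        \<open>2 * X k\<close>.\<close>
      show "X k \<le> 6 * sqrt (real (hor M) * (\<Sum>h=1..hor M. s k h) * (?V + 2 * X k + Y k)) + 4 * (\<Sum>h=1..hor M. s k h)"
        using sum_bce_gap_le[of "{1..hor M}" "gap (policy k D) (fitted k D)" "s k"
            "q_mean (policy k D) (fitted k D)" "?V + 2 * X k + Y k"]
          gap_le_bce[OF l fc(5)[OF k] fc(4)[OF k]] s[OF k] value_bounds(2)[OF fc(5)[OF k] fc(4)[OF k]] value_gap_round[OF DK \<pi> k]
          V X0[of k] Y0[of k]
        unfolding s_def X_def[symmetric] Y_def[symmetric] by force
      show "Y k \<le> 6 * sqrt (real (hor M) * (\<Sum>h=1..hor M. s' k h) * (?V + Y k)) + 4 * (\<Sum>h=1..hor M. s' k h)"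
        using sum_bce_gap_le[of "{1..hor M}" "gap \<pi>' (fitted k D)" "s' k"
            "q_mean \<pi>' (fitted k D)" "?V + Y k"]
          gap_le_bce[OF l \<pi> fc(4)[OF k]] s'[OF k] value_bounds(2)[OF \<pi> fc(4)[OF k]] V Y0[of k]
        unfolding s'_def Y_def[symmetric] by force
    qed (use on off l L i in auto)
    also have "\<dots> \<le> hidden_factor c0 K * q + hidden_factor c0 K * p"
      using hid L i pq by (intro add_mono mult_right_mono) argo+
    finally show "regret M pol K D \<pi>' \<le> hidden_factor c0 K *
        (real (hor M) * sqrt (?V * real K * B) + (real (hor M))\<^sup>2 * B)"
      using reg unfolding q_def[symmetric] p_def[symmetric] distrib_left by linarith
  }
qed

end

text \<open>One event serves all comparators at once. Infinite coverage is set apart because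
  \<open>enn2real\<close> would turn it into \<open>0\<close>, whereas the intended bound is then
  vacuous.\<close>

theorem theorem12:
  fixes M :: "('x, 'a::finite) mdp"
    and F :: "('x, 'a) qtuple set"
    and l :: loss
    and ua :: bool
    and K :: nat
    and n :: "nat \<Rightarrow> nat"
    and \<nu> :: "nat \<Rightarrow> ('x \<times> 'a) measure"
    and Doff :: "(nat \<Rightarrow> nat \<Rightarrow> ('x, 'a) sample) measure"
    and fit :: "nat \<Rightarrow> ('x, 'a) history \<Rightarrow> ('x, 'a) qtuple"
    and pol :: "nat \<Rightarrow> ('x, 'a) history \<Rightarrow> ('x, 'a) det_policy"
    and \<delta> c0 \<beta> :: real
  assumes mdp: "valid_mdp M"
    and function_class: "function_class M F" "consecutive_closed M F"
    and complete: "bellman_complete M F"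
    and targets: "l = Bce \<Longrightarrow> unit_targets M F"
    and rounds: "1 \<le> K"
    and offline: "offline_law M \<nu> n Doff"
    and offline_size: "0 < c0" "\<And>h. h \<in> {1..hor M} \<Longrightarrow> c0 * real K \<le> real (n h)"
    and confidence: "0 < \<delta>" "\<delta> < 1"
    and beta: "\<beta> = 2 * ln (real (hor M) * real (card F) / \<delta>)"
    and algorithm: "fitted_Q_iteration M F l n K fit pol"
  shows "\<exists>E \<in> sets (interaction M ua n Doff pol K).
    measure (interaction M ua n Doff pol K) E \<ge> 1 - \<delta> \<and>
    (\<forall>D\<in>E. \<forall>\<pi>'\<in>greedy_policies M F. coverage M \<nu> \<pi>' < \<infinity> \<longrightarrow>
      (let H = real (hor M); C = enn2real (coverage M \<nu> \<pi>'); d = dim_term M F l ua K;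
           V = policy_value M \<pi>'
       in (l = Sq \<longrightarrow> regret M pol K D \<pi>' \<le>
             hidden_factor c0 K * (H * sqrt (real K * (d + C) * \<beta>))) \<and>
          (l = Bce \<longrightarrow> regret M pol K D \<pi>' \<le>
             hidden_factor c0 K *
               (H * sqrt (V * real K * (d + C) * \<beta>) + H\<^sup>2 * (d + C) * \<beta>))))"
proof -
  interpret hybrid_interaction M F l ua K n \<nu> Doff fit pol
    using mdp function_class complete targets offline algorithm by unfold_locales
  \<comment> \<open>The level at which the failure bound \<open>H * |F| / a\<close> of the union
    bound equals \<open>\<delta>\<close>.\<close>
  define a where "a = real (hor M) * real (card F) / \<delta>"
  have F: "finite F" "F \<noteq> {}" using function_class by (auto simp: function_class_def)
  have cF: "1 \<le> card F" using F card_gt_0_iff[of F] by linarith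
  have cH: "1 \<le> real (hor M)" using horizon_pos by simp
  have mono: "c \<le> a" if "c \<le> real (card F)" "0 \<le> c" for c
  proof -
    have "1 * c \<le> real (hor M) * real (card F)" using that cH by (intro mult_mono) auto
    moreover have "\<delta> * c \<le> 1 * c" using confidence that by (intro mult_right_mono) auto
    ultimately show ?thesis using confidence by (simp add: a_def field_simps)
  qed
  have a1: "1 \<le> a" using cF by (intro mono) auto
  \<comment> \<open>Two functions give \<open>a \<ge> 2\<close>, and
    \<open>2 * ln 2 \<ge> 4 / 3\<close>.\<close>
  have big: "1 \<le> 2 * ln a" if "card F \<noteq> 1"
  proof -
    have "2 \<le> a" using cF that by (intro mono) auto
    then have "ln 2 \<le> ln a" by simp
    then show ?thesis using ln2_ge_two_thirds by simp
  qed
  have \<beta>: "\<beta> = 2 * ln a" by (simp add: beta a_def)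
  have "0 < a" using a1 by simp
  note E = confident_measure[OF this]
  have "real (hor M) * real (card F) / a = \<delta>"
    using cF cH confidence by (simp add: a_def)
  with E(2) have "1 - \<delta> \<le> measure (I K) (confident a)" by simp
  moreover have "is_policy M \<pi>'" if "\<pi>' \<in> greedy_policies M F" for \<pi>'
    using that by (auto simp: greedy_policies_def intro!: is_policy_det)
  note bound = regret_bound[OF rounds a1 _ big offline_size this]
  ultimately show ?thesis
    using E(1) bound unfolding Let_def \<beta> mult.assoc by blast
qed

end
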